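(* Let $P$ be a poset with underlying set $[n]$. Then: (a) As right $H_n(0)$-modules, $\phi[M_P]\cong M_{\overline{P}^*}$, $\theta[M_P]\cong \mathbf{M}_P$, and $\chi[M_P]\cong\mathbf{M}_{\overline{P}}$. (b) $\mathrm{ch}([\phi[M_P]])=\rho(K_P)$, $\mathrm{ch}([\theta[M_P]])=\psi(K_P)$, and $\mathrm{ch}([\chi[M_P]])=K_P$. (Here $\phi,\theta,\chi$ denote the (anti-)involutions of $H_n(0)$ defined in the context.)
   Context: Permutations in $\mathfrak{S}_n$ are composed as functions, $(\sigma\tau)(i)=\sigma(\tau(i))$; $s_i=(i\ i{+}1)$, $\ell$ is the length, and $\mathrm{Des}_R(\gamma)=\{i\in[n-1]:\ell(\gamma s_i)<\ell(\gamma)\}$. The $0$-Hecke algebra $H_n(0)$ is the associative unital $\mathbb{C}$-algebra generated by $\overline{\pi}_1,\dots,\overline{\pi}_{n-1}$ with relations $\overline{\pi}_i^2=-\overline{\pi}_i$, $\overline{\pi}_i\overline{\pi}_{i+1}\overline{\pi}_i=\overline{\pi}_{i+1}\overline{\pi}_i\overline{\pi}_{i+1}$, $\overline{\pi}_i\overline{\pi}_j=\overline{\pi}_j\overline{\pi}_i$ for $|i-j|\ge 2$; put $\pi_i=\overline{\pi}_i+1$. For a partial order $P$ on $[n]$, $\Sigma_R(P)$ is the set of $\sigma\in\mathfrak{S}_n$ with $\sigma^{-1}(i)<\sigma^{-1}(j)$ whenever $i\prec_P j$. The poset module $M_P$ is the right $H_n(0)$-module with $\mathbb{C}$-basis $\Sigma_R(P)$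 and action $\gamma\cdot\overline{\pi}_i=-\gamma$ if $i\in\mathrm{Des}_R(\gamma)$; $0$ if $i\notin\mathrm{Des}_R(\gamma)$, $\gamma s_i\notin\Sigma_R(P)$; $\gamma s_i$ if $i\notin\mathrm{Des}_R(\gamma)$, $\gamma s_i\in\Sigma_R(P)$. The module $\mathbf{M}_P$ is the right $H_n(0)$-module with the same basis $\Sigma_R(P)$ and action $\gamma\cdot\pi_i=\gamma$ if $i\in\mathrm{Des}_R(\gamma)$; $0$ if $i\notin\mathrm{Des}_R(\gamma)$, $\gamma s_i\notin\Sigma_R(P)$; $\gamma s_i$ if $i\notin\mathrm{Des}_R(\gamma)$, $\gamma s_i\in\Sigma_R(P)$. Poset involutions on posets on $[n]$: $u\preceq_{\overline{P}}v\iff n+1-u\preceq_P n+1-v$, and $u\preceq_{P^*}v\iff v\preceq_P u$; $\overline{P}^*$ is $(\overline{P})^*$. $\phi$ and $\theta$ are the algebra involutions, and $\chi$ the algebra anti-involution, of $H_n(0)$ given by $\phi(\overline{\pi}_i)=\overline{\pi}_{n-i}$, $\theta(\overline{\pi}_i)=-\pi_i$, $\chi(\overline{\pi}_i)=\overline{\pi}_i$. For an automorphism $\mu$ and a right module $M$, $\mu[M]$ is the space $M$ with action $v\cdot_\mu h=v\cdot\mu(h)$. For an anti-automorphism $\nu$, $\nu[M]$ is the dual space $M^*$ with right action $(\delta\cdot^\nu h)(v)=\delta(v\cdot\nu(h))$. For a composition $\alpha$ of $n$, $\mathrm{set}(\alpha)=\{\alpha_1,\alpha_1+\alpha_2,\dots,\alpha_1+\cdots+\alpha_{\ell(\alpha)-1}\}\subseteq[n-1]$;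 $F_\alpha=\sum x_{i_1}\cdots x_{i_n}$ over $1\le i_1\le\cdots\le i_n$ with $i_j<i_{j+1}$ if $j\in\mathrm{set}(\alpha)$. $\alpha^{\mathrm r}$ is the reversed composition and $\alpha^{\mathrm c}$ is the composition with $\mathrm{set}(\alpha^{\mathrm c})=[n-1]\setminus\mathrm{set}(\alpha)$. $\rho$ and $\psi$ are the linear maps on $\mathrm{QSym}$ with $\rho(F_\alpha)=F_{\alpha^{\mathrm r}}$ and $\psi(F_\alpha)=F_{\alpha^{\mathrm c}}$. $\mathrm{ch}$ is the quasisymmetric characteristic of right modules: the linear isomorphism $\bigoplus_n G_0(\mathbf{mod}\text{-}H_n(0))\to\mathrm{QSym}$ (Grothendieck groups of finite-dimensional right modules) sending to $F_\alpha$ the class of the one-dimensional module on which $\overline{\pi}_i$ acts by $-1$ if $i\in\mathrm{set}(\alpha)$ and by $0$ otherwise. A $P$-partition is a map $f:[n]\to\mathbb{N}=\{1,2,\dots\}$ such that $i\preceq_P j$ implies $f(i)\le f(j)$, and $i\preceq_P j$ with $i>j$ implies $f(i)<f(j)$; $K_P=\sum_f\prod_{i\in[n]}x_{f(i)}$ over all $P$-partitions $f$. *)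

theory Defs
  imports
    Complex_Main
    "HOL-Algebra.Module"
    "HOL-Algebra.QuotRing"
    "HOL-Algebra.Generated_Groups"
    "HOL-Algebra.Product_Groups"
    "HOL-Algebra.Free_Abelian_Groups"
    "HOL-Combinatorics.Permutations"
begin

section \<open>Right modules\<close>

text \<open>The locale \<^locale>\<open>module\<close> of the library is about modules over commutative rings.
  As there, the multiplicative part of the \<open>ring\<close> record of a module is unused.\<close>

record ('r, 'v) rmodule = "'v ring" +
  ract :: "'v \<Rightarrow> 'r \<Rightarrow> 'v"

locale right_module = R?: ring R + M?: abelian_group M
  for R (structure) and M (structure) +
  assumes ract_closed: "\<lbrakk>v \<in> carrier M; h \<in> carrier R\<rbrakk> \<Longrightarrow> ract M v h \<in> carrier M"
    and ract_add_left: "\<lbrakk>v \<in> carrier M; w \<in> carrier M; h \<in> carrier R\<rbrakk>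
      \<Longrightarrow> ract M (v \<oplus>\<^bsub>M\<^esub> w) h = ract M v h \<oplus>\<^bsub>M\<^esub> ract M w h"
    and ract_add_right: "\<lbrakk>v \<in> carrier M; h \<in> carrier R; k \<in> carrier R\<rbrakk>
      \<Longrightarrow> ract M v (h \<oplus>\<^bsub>R\<^esub> k) = ract M v h \<oplus>\<^bsub>M\<^esub> ract M v k"
    and ract_mult: "\<lbrakk>v \<in> carrier M; h \<in> carrier R; k \<in> carrier R\<rbrakk>
      \<Longrightarrow> ract M v (h \<otimes>\<^bsub>R\<^esub> k) = ract M (ract M v h) k"
    and ract_one: "v \<in> carrier M \<Longrightarrow> ract M v \<one>\<^bsub>R\<^esub> = v"

definition rmod_hom ::
  "('r, 'm) ring_scheme \<Rightarrow> ('r, 'v, 'x) rmodule_scheme \<Rightarrow> ('r, 'w, 'y) rmodule_scheme \<Rightarrow> ('v \<Rightarrow> 'w) set"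
  where "rmod_hom R M N =
    {f. f \<in> carrier M \<rightarrow> carrier N \<and>
        (\<forall>v\<in>carrier M. \<forall>w\<in>carrier M. f (v \<oplus>\<^bsub>M\<^esub> w) = f v \<oplus>\<^bsub>N\<^esub> f w) \<and>
        (\<forall>v\<in>carrier M. \<forall>h\<in>carrier R. f (ract M v h) = ract N (f v) h)}"

definition rmod_iso ::
  "('r, 'm) ring_scheme \<Rightarrow> ('r, 'v, 'x) rmodule_scheme \<Rightarrow> ('r, 'w, 'y) rmodule_scheme \<Rightarrow> bool"
  where "rmod_iso R M N \<longleftrightarrow> right_module R M \<and> right_module R N \<and>
    (\<exists>f\<in>rmod_hom R M N. bij_betw f (carrier M) (carrier N))"

definition short_exact ::
  "('r, 'm) ring_scheme \<Rightarrow> ('r, 'u, 'x) rmodule_scheme \<Rightarrow> ('r, 'v, 'y) rmodule_scheme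
    \<Rightarrow> ('r, 'w, 'z) rmodule_scheme \<Rightarrow> bool"
  where "short_exact R M' M M'' \<longleftrightarrow>
    (\<exists>f\<in>rmod_hom R M' M. \<exists>g\<in>rmod_hom R M M''.
       inj_on f (carrier M') \<and> g ` carrier M = carrier M'' \<and>
       f ` carrier M' = {v \<in> carrier M. g v = \<zero>\<^bsub>M''\<^esub>})"

definition opposite_ring :: "('r, 'm) ring_scheme \<Rightarrow> ('r, 'm) ring_scheme"
  where "opposite_ring R = R\<lparr>monoid.mult := \<lambda>x y. y \<otimes>\<^bsub>R\<^esub> x\<rparr>"

section \<open>The 0-Hecke algebra\<close>

text \<open>Words under concatenation, so that \<open>word \<Rightarrow>\<^sub>0 complex\<close> is the free associative unital
  complex algebra on generators indexed by the natural numbers.\<close>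

datatype word = Word (letters: "nat list")

instantiation word :: monoid_add
begin

definition zero_word :: word where "0 = Word []"

definition plus_word :: "word \<Rightarrow> word \<Rightarrow> word" where "u + w = Word (letters u @ letters w)"

instance
  by standard (simp_all add: zero_word_def plus_word_def)

end

type_synonym free_elt = "word \<Rightarrow>\<^sub>0 complex"
type_synonym hecke_elt = "free_elt set"

definition free_alg :: "nat \<Rightarrow> free_elt ring"
  where "free_alg n =
    \<lparr>carrier = {p. \<forall>w\<in>Poly_Mapping.keys p. set (letters w) \<subseteq> {1..<n}},
     monoid.mult = (*), one = 1, ring.zero = 0, ring.add = (+)\<rparr>"

definition free_gen :: "nat \<Rightarrow> free_elt"
  where "free_gen i = Poly_Mapping.single (Word [i]) 1"

definition hecke_relations :: "nat \<Rightarrow> free_elt set"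
  where "hecke_relations n =
    {free_gen i * free_gen i + free_gen i | i. i \<in> {1..<n}} \<union>
    {free_gen i * free_gen (i + 1) * free_gen i
       - free_gen (i + 1) * free_gen i * free_gen (i + 1) | i. i \<in> {1..<n} \<and> i + 1 \<in> {1..<n}} \<union>
    {free_gen i * free_gen j - free_gen j * free_gen i | i j.
       i \<in> {1..<n} \<and> j \<in> {1..<n} \<and> (i + 2 \<le> j \<or> j + 2 \<le> i)}"

definition hecke_ideal :: "nat \<Rightarrow> free_elt set"
  where "hecke_ideal n = genideal (free_alg n) (hecke_relations n)"

definition hecke :: "nat \<Rightarrow> hecke_elt ring"
  where "hecke n = free_alg n Quot hecke_ideal n"

text \<open>The structure map of the complex algebra \<open>hecke n\<close>: \<open>scal n c\<close> is \<open>c\<close> times the unit.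
  Complex scalars act on a right module through it.\<close>

definition scal :: "nat \<Rightarrow> complex \<Rightarrow> hecke_elt"
  where "scal n c = hecke_ideal n +>\<^bsub>free_alg n\<^esub> Poly_Mapping.single 0 c"

definition pi_bar :: "nat \<Rightarrow> nat \<Rightarrow> hecke_elt"
  where "pi_bar n i = hecke_ideal n +>\<^bsub>free_alg n\<^esub> free_gen i"

definition pi_gen :: "nat \<Rightarrow> nat \<Rightarrow> hecke_elt"
  where "pi_gen n i = pi_bar n i \<oplus>\<^bsub>hecke n\<^esub> \<one>\<^bsub>hecke n\<^esub>"

definition algebra_involution :: "nat \<Rightarrow> (hecke_elt \<Rightarrow> hecke_elt) \<Rightarrow> bool"
  where "algebra_involution n f \<longleftrightarrow>
    f \<in> ring_hom (hecke n) (hecke n) \<and> (\<forall>c. f (scal n c) = scal n c) \<and>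
    (\<forall>h\<in>carrier (hecke n). f (f h) = h)"

definition algebra_anti_involution :: "nat \<Rightarrow> (hecke_elt \<Rightarrow> hecke_elt) \<Rightarrow> bool"
  where "algebra_anti_involution n f \<longleftrightarrow>
    f \<in> ring_hom (hecke n) (opposite_ring (hecke n)) \<and> (\<forall>c. f (scal n c) = scal n c) \<and>
    (\<forall>h\<in>carrier (hecke n). f (f h) = h)"

definition hecke_phi :: "nat \<Rightarrow> hecke_elt \<Rightarrow> hecke_elt"
  where "hecke_phi n = (THE f. f \<in> extensional (carrier (hecke n)) \<and> algebra_involution n f \<and>
    (\<forall>i\<in>{1..<n}. f (pi_bar n i) = pi_bar n (n - i)))"

definition hecke_theta :: "nat \<Rightarrow> hecke_elt \<Rightarrow> hecke_elt"
  where "hecke_theta n = (THE f. f \<in> extensional (carrier (hecke n)) \<and> algebra_involution n f \<and>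
    (\<forall>i\<in>{1..<n}. f (pi_bar n i) = \<ominus>\<^bsub>hecke n\<^esub> pi_gen n i))"

definition hecke_chi :: "nat \<Rightarrow> hecke_elt \<Rightarrow> hecke_elt"
  where "hecke_chi n = (THE f. f \<in> extensional (carrier (hecke n)) \<and> algebra_anti_involution n f \<and>
    (\<forall>i\<in>{1..<n}. f (pi_bar n i) = pi_bar n i))"

type_synonym 'v hmod = "(hecke_elt, 'v) rmodule"

definition twist :: "(hecke_elt \<Rightarrow> hecke_elt) \<Rightarrow> 'v hmod \<Rightarrow> 'v hmod"
  where "twist \<mu> M = M\<lparr>ract := \<lambda>v h. ract M v (\<mu> h)\<rparr>"

text \<open>Elements of the dual space are complex linear functionals, made extensional so that each of
  them has a unique representation.\<close>

definition dual_twist :: "nat \<Rightarrow> (hecke_elt \<Rightarrow> hecke_elt) \<Rightarrow> 'v hmod \<Rightarrow> ('v \<Rightarrow> complex) hmod"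
  where "dual_twist n \<nu> M =
    \<lparr>carrier = {\<delta> \<in> extensional (carrier M).
       (\<forall>v\<in>carrier M. \<forall>w\<in>carrier M. \<delta> (v \<oplus>\<^bsub>M\<^esub> w) = \<delta> v + \<delta> w) \<and>
       (\<forall>v\<in>carrier M. \<forall>c. \<delta> (ract M v (scal n c)) = c * \<delta> v)},
     monoid.mult = undefined, one = undefined,
     ring.zero = (\<lambda>v\<in>carrier M. 0),
     ring.add = (\<lambda>\<delta> \<epsilon>. \<lambda>v\<in>carrier M. \<delta> v + \<epsilon> v),
     ract = (\<lambda>\<delta> h. \<lambda>v\<in>carrier M. \<delta> (ract M v (\<nu> h)))\<rparr>"

section \<open>Modules given by an action on a basis\<close>

definition basis_vec :: "'b \<Rightarrow> 'b \<Rightarrow> complex"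
  where "basis_vec b = (\<lambda>c. if c = b then 1 else 0)"

definition basis_space :: "'b set \<Rightarrow> ('b \<Rightarrow> complex) hmod"
  where "basis_space B =
    \<lparr>carrier = {v. \<forall>b. b \<notin> B \<longrightarrow> v b = 0},
     monoid.mult = undefined, one = undefined,
     ring.zero = (\<lambda>b. 0), ring.add = (\<lambda>v w b. v b + w b),
     ract = undefined\<rparr>"

text \<open>Vectors are their coordinate functions with respect to the basis \<open>B\<close>. For a finite set \<open>B\<close>, the right \<open>hecke n\<close>-module with complex basis \<open>B\<close> on which, for every
  \<open>i\<close>, the generator \<open>e i\<close> sends the basis element \<open>b\<close> to \<open>A b i\<close>.\<close>

definition basis_module ::
  "nat \<Rightarrow> 'b set \<Rightarrow> (nat \<Rightarrow> hecke_elt) \<Rightarrow> ('b \<Rightarrow> nat \<Rightarrow> 'b \<Rightarrow> complex) \<Rightarrow> ('b \<Rightarrow> complex) hmod"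
  where "basis_module n B e A = (basis_space B)\<lparr>ract := (THE a.
     case_prod a \<in> extensional (carrier (basis_space B) \<times> carrier (hecke n)) \<and>
     right_module (hecke n) ((basis_space B)\<lparr>ract := a\<rparr>) \<and>
     (\<forall>v\<in>carrier (basis_space B). \<forall>c. a v (scal n c) = (\<lambda>b. c * v b)) \<and>
     (\<forall>b\<in>B. \<forall>i\<in>{1..<n}. a (basis_vec b) (e i) = A b i))\<rparr>"

section \<open>Permutations, posets and poset modules\<close>

definition simple_refl :: "nat \<Rightarrow> nat \<Rightarrow> nat"
  where "simple_refl i = transpose i (i + 1)"

definition perm_length :: "nat \<Rightarrow> (nat \<Rightarrow> nat) \<Rightarrow> nat"
  where "perm_length n \<sigma> = (LEAST k. \<exists>w. length w = k \<and> set w \<subseteq> {1..<n} \<and>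
    \<sigma> = foldr (\<circ>) (map simple_refl w) id)"

definition des_right :: "nat \<Rightarrow> (nat \<Rightarrow> nat) \<Rightarrow> nat set"
  where "des_right n \<gamma> = {i \<in> {1..<n}. perm_length n (\<gamma> \<circ> simple_refl i) < perm_length n \<gamma>}"

definition Sigma_R :: "nat \<Rightarrow> nat rel \<Rightarrow> (nat \<Rightarrow> nat) set"
  where "Sigma_R n P = {\<sigma>. \<sigma> permutes {1..n} \<and>
    (\<forall>(i, j)\<in>P. i \<noteq> j \<longrightarrow> inv_into UNIV \<sigma> i < inv_into UNIV \<sigma> j)}"

definition poset_module :: "nat \<Rightarrow> nat rel \<Rightarrow> ((nat \<Rightarrow> nat) \<Rightarrow> complex) hmod"
  where "poset_module n P = basis_module n (Sigma_R n P) (pi_bar n)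
    (\<lambda>\<gamma> i. if i \<in> des_right n \<gamma> then (\<lambda>\<tau>. - basis_vec \<gamma> \<tau>)
            else if \<gamma> \<circ> simple_refl i \<in> Sigma_R n P then basis_vec (\<gamma> \<circ> simple_refl i)
            else (\<lambda>\<tau>. 0))"

definition bold_poset_module :: "nat \<Rightarrow> nat rel \<Rightarrow> ((nat \<Rightarrow> nat) \<Rightarrow> complex) hmod"
  where "bold_poset_module n P = basis_module n (Sigma_R n P) (pi_gen n)
    (\<lambda>\<gamma> i. if i \<in> des_right n \<gamma> then basis_vec \<gamma>
            else if \<gamma> \<circ> simple_refl i \<in> Sigma_R n P then basis_vec (\<gamma> \<circ> simple_refl i)
            else (\<lambda>\<tau>. 0))"

definition poset_bar :: "nat \<Rightarrow> nat rel \<Rightarrow> nat rel"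
  where "poset_bar n P = {(u, v). u \<in> {1..n} \<and> v \<in> {1..n} \<and> (n + 1 - u, n + 1 - v) \<in> P}"

section \<open>Quasisymmetric functions\<close>

text \<open>A formal power series in the variables \<open>x_1, x_2, ...\<close> is the function giving the
  coefficient of each monomial; the monomial with exponent \<open>m k\<close> at \<open>x_k\<close> is the finitely supported
  function \<open>m\<close>, and index 0 does not occur.\<close>

type_synonym monomial = "nat \<Rightarrow>\<^sub>0 nat"
type_synonym series = "monomial \<Rightarrow> int"

definition QSym :: "series monoid"
  where "QSym =
    \<lparr>carrier = {f.
       (\<forall>m. f m \<noteq> 0 \<longrightarrow> Poly_Mapping.keys m \<subseteq> {1..}) \<and>
       (\<exists>d. \<forall>m. f m \<noteq> 0 \<longrightarrow> (\<Sum>k\<in>Poly_Mapping.keys m. Poly_Mapping.lookup m k) \<le> d) \<and>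
       (\<forall>m m'. Poly_Mapping.keys m \<subseteq> {1..} \<longrightarrow> Poly_Mapping.keys m' \<subseteq> {1..} \<longrightarrow>
          map (Poly_Mapping.lookup m) (sorted_list_of_set (Poly_Mapping.keys m)) =
          map (Poly_Mapping.lookup m') (sorted_list_of_set (Poly_Mapping.keys m')) \<longrightarrow>
          f m = f m')},
     monoid.mult = (\<lambda>f g m. f m + g m), one = (\<lambda>m. 0)\<rparr>"

text \<open>The sum over \<open>f \<in> S\<close> of the monomials \<open>x_(f 1) ... x_(f n)\<close>.\<close>

definition gen_series :: "nat \<Rightarrow> (nat \<Rightarrow> nat) set \<Rightarrow> series"
  where "gen_series n S =
    (\<lambda>m. int (card {f \<in> S. (\<Sum>i\<in>{1..n}. Poly_Mapping.single (f i) (1::nat)) = m}))"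

definition composition :: "nat \<Rightarrow> nat list \<Rightarrow> bool"
  where "composition n \<alpha> \<longleftrightarrow> 0 \<notin> set \<alpha> \<and> sum_list \<alpha> = n"

definition comp_set :: "nat list \<Rightarrow> nat set"
  where "comp_set \<alpha> = {sum_list (take k \<alpha>) | k. k \<in> {1..<length \<alpha>}}"

definition comp_complement :: "nat list \<Rightarrow> nat list"
  where "comp_complement \<alpha> = (THE \<beta>. composition (sum_list \<alpha>) \<beta> \<and>
    comp_set \<beta> = {1..<sum_list \<alpha>} - comp_set \<alpha>)"

definition fundamental :: "nat list \<Rightarrow> series"
  where "fundamental \<alpha> = gen_series (sum_list \<alpha>)
    {f \<in> {1..sum_list \<alpha>} \<rightarrow>\<^sub>E {1..}. \<forall>j\<in>{1..<sum_list \<alpha>}.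
       f j \<le> f (j + 1) \<and> (j \<in> comp_set \<alpha> \<longrightarrow> f j < f (j + 1))}"

definition P_partitions :: "nat \<Rightarrow> nat rel \<Rightarrow> (nat \<Rightarrow> nat) set"
  where "P_partitions n P = {f \<in> {1..n} \<rightarrow>\<^sub>E {1..}.
    \<forall>(i, j)\<in>P. f i \<le> f j \<and> (i > j \<longrightarrow> f i < f j)}"

definition K_series :: "nat \<Rightarrow> nat rel \<Rightarrow> series"
  where "K_series n P = gen_series n (P_partitions n P)"

section \<open>Grothendieck groups and the quasisymmetric characteristic\<close>

definition finite_dimensional :: "nat \<Rightarrow> 'v hmod \<Rightarrow> bool"
  where "finite_dimensional n M \<longleftrightarrow> (\<exists>B. finite B \<and> B \<subseteq> carrier M \<and>
    (\<forall>v\<in>carrier M. \<exists>c. v = (\<Oplus>\<^bsub>M\<^esub>b\<in>B. ract M b (scal n (c b)))))"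

text \<open>Every finite-dimensional module is isomorphic to one whose elements are of type
  \<^typ>\<open>nat \<Rightarrow> complex\<close>, so this type serves as the universe in which the Grothendieck group is
  formed.\<close>

type_synonym std_hmod = "(nat \<Rightarrow> complex) hmod"

definition fd_modules :: "nat \<Rightarrow> std_hmod set"
  where "fd_modules n = {M. right_module (hecke n) M \<and> finite_dimensional n M}"

definition G0_relations :: "nat \<Rightarrow> (std_hmod \<Rightarrow>\<^sub>0 int) set"
  where "G0_relations n = {frag_of M - frag_of M' - frag_of M'' | M' M M''.
    M' \<in> fd_modules n \<and> M \<in> fd_modules n \<and> M'' \<in> fd_modules n \<and>
    short_exact (hecke n) M' M M''}"

definition G0_kernel :: "nat \<Rightarrow> (std_hmod \<Rightarrow>\<^sub>0 int) set"
  where "G0_kernel n = generate (free_Abelian_group (fd_modules n)) (G0_relations n)"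

definition G0 :: "nat \<Rightarrow> (std_hmod \<Rightarrow>\<^sub>0 int) set monoid"
  where "G0 n = free_Abelian_group (fd_modules n) Mod G0_kernel n"

text \<open>The class of a finite-dimensional module of any type is that of an isomorphic module in the
  universe; isomorphic modules have the same class.\<close>

definition G0_class :: "nat \<Rightarrow> 'v hmod \<Rightarrow> (std_hmod \<Rightarrow>\<^sub>0 int) set"
  where "G0_class n M = the_elem
    ((\<lambda>N. G0_kernel n #>\<^bsub>free_Abelian_group (fd_modules n)\<^esub> frag_of N) `
      {N \<in> fd_modules n. rmod_iso (hecke n) N M})"

abbreviation G0_sum :: "(nat \<Rightarrow> (std_hmod \<Rightarrow>\<^sub>0 int) set) monoid"
  where "G0_sum \<equiv> sum_group UNIV G0"

definition G0_sum_class :: "nat \<Rightarrow> 'v hmod \<Rightarrow> nat \<Rightarrow> (std_hmod \<Rightarrow>\<^sub>0 int) set"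
  where "G0_sum_class n M = (\<lambda>m. if m = n then G0_class n M else \<one>\<^bsub>G0 m\<^esub>)"

definition simple_module :: "nat list \<Rightarrow> (unit \<Rightarrow> complex) hmod"
  where "simple_module \<alpha> = basis_module (sum_list \<alpha>) UNIV (pi_bar (sum_list \<alpha>))
    (\<lambda>b i. if i \<in> comp_set \<alpha> then (\<lambda>c. - basis_vec b c) else (\<lambda>c. 0))"

text \<open>\<open>ch\<close>, \<open>\<rho>\<close> and \<open>\<psi>\<close> are specified by their values on classes of simple modules and on the
  fundamental functions. These generate the groups in question, so each of the following predicates
  determines its argument there. Quasisymmetric functions have integer coefficients, as
  Grothendieck groups are not tensored with the complex numbers.\<close>

definition qsym_characteristic :: "((nat \<Rightarrow> (std_hmod \<Rightarrow>\<^sub>0 int) set) \<Rightarrow> series) \<Rightarrow> bool"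
  where "qsym_characteristic ch \<longleftrightarrow> ch \<in> iso G0_sum QSym \<and>
    (\<forall>n \<alpha>. composition n \<alpha> \<longrightarrow> ch (G0_sum_class n (simple_module \<alpha>)) = fundamental \<alpha>)"

definition qsym_rho :: "(series \<Rightarrow> series) \<Rightarrow> bool"
  where "qsym_rho \<rho> \<longleftrightarrow> \<rho> \<in> hom QSym QSym \<and>
    (\<forall>n \<alpha>. composition n \<alpha> \<longrightarrow> \<rho> (fundamental \<alpha>) = fundamental (rev \<alpha>))"

definition qsym_psi :: "(series \<Rightarrow> series) \<Rightarrow> bool"
  where "qsym_psi \<psi> \<longleftrightarrow> \<psi> \<in> hom QSym QSym \<and>
    (\<forall>n \<alpha>. composition n \<alpha> \<longrightarrow> \<psi> (fundamental \<alpha>) = fundamental (comp_complement \<alpha>))"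

end

theory Submission
  imports Defs
begin

text \<open>In coordinates with respect to the basis \<open>Sigma_R n P\<close>, the generators of the 0-Hecke
  algebra act on the poset module by \<open>(v \<cdot> pi_bar i)(\<sigma>) = v (\<sigma> s_i) - v \<sigma>\<close> if \<open>i\<close> is a descent
  of \<open>\<sigma>\<close>, where \<open>v (\<sigma> s_i)\<close> counts as \<open>0\<close> if \<open>\<sigma> s_i\<close> is not in the basis, and by \<open>0\<close> otherwise.
  With \<open>w\<close> the longest permutation,
  \<open>\<sigma> \<mapsto> w \<sigma> w\<close> gives the isomorphism for \<open>\<phi>\<close>, the sign change \<open>\<sigma> \<mapsto> sign(\<sigma>) \<sigma>\<close> the one for \<open>\<theta>\<close>, and
  \<open>\<sigma>* \<mapsto> w \<sigma>\<close> the one for \<open>\<chi>\<close>.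
  Ordering the basis by length makes all generators triangular, so the composition factors are read
  off the diagonal: each \<open>\<sigma>\<close> contributes the fundamental function of its descent set, or of the
  complement for the bold module. On the other side, sorting the values of a P-partition, with ties
  broken by position, yields a unique permutation, and a map is a P-partition iff its sorting
  permutation lies in \<open>Sigma_R n P\<close>; hence \<open>K_P\<close> is the sum of the same fundamental functions.\<close>

section \<open>The universal property of the 0-Hecke algebra\<close>

text \<open>The algebra is a quotient, and its involutions and the modules are definite
  descriptions, so nothing can be computed before existence and uniqueness are settled. One
  universal property gives existence every time, and only the target ring changes:
  \<open>hecke n\<close> for \<phi> and \<theta>, its opposite for \<chi>, a ring of linear
  operators for modules. Uniqueness is agreement on scalars and generators. Coordinates are
  preferred to basis vectors because a relation between operators can then be tested at one
  permutation at a time, where it becomes a finite case distinction. The sign for \<theta> is needed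
  because \<open>-pi_i\<close> moves a basis element with coefficient -1 where the bold module has
  1. For \<chi>, dualizing transposes the matrices and so reverses every step from \<gamma> to
  \<gamma> s_i; left multiplication by w exchanges ascents and descents and restores the direction.
  The Grothendieck group is built from modules of functions on \<open>nat\<close> and its relations
  only mention short exact sequences, so modules must be transported to \<open>nat\<close>, and
  invariance under isomorphism must be derived.\<close>

lemma keys_uminus_eq: "Poly_Mapping.keys (- p) = Poly_Mapping.keys (p :: 'a \<Rightarrow>\<^sub>0 'b::ab_group_add)"
  by (auto simp: in_keys_iff)

lemma ring_free_alg: "ring (free_alg n)"
proof (rule ringI)
  show "abelian_group (free_alg n)"
  proof (rule abelian_groupI)
    fix x assume "x \<in> carrier (free_alg n)"
    then show "\<exists>y\<in>carrier (free_alg n). y \<oplus>\<^bsub>free_alg n\<^esub> x = \<zero>\<^bsub>free_alg n\<^esub>"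
      by (intro bexI[of _ "- x"]) (auto simp: free_alg_def keys_uminus_eq)
  qed (auto simp: free_alg_def algebra_simps dest!: subsetD[OF keys_add])
  show "Group.monoid (free_alg n)"
  proof (rule monoidI)
    fix x y assume "x \<in> carrier (free_alg n)" "y \<in> carrier (free_alg n)"
    then show "x \<otimes>\<^bsub>free_alg n\<^esub> y \<in> carrier (free_alg n)"
      by (fastforce simp: free_alg_def plus_word_def dest!: subsetD[OF keys_mult])
  qed (auto simp: free_alg_def mult.assoc zero_word_def)
qed (auto simp: free_alg_def algebra_simps)

lemma free_alg_simps [simp]:
  "x \<otimes>\<^bsub>free_alg n\<^esub> y = x * y" "x \<oplus>\<^bsub>free_alg n\<^esub> y = x + y"
  "\<one>\<^bsub>free_alg n\<^esub> = 1" "\<zero>\<^bsub>free_alg n\<^esub> = 0"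
  by (auto simp: free_alg_def)

lemma single_in_free_alg [simp]: "set (letters w) \<subseteq> {1..<n} \<Longrightarrow> Poly_Mapping.single w c \<in> carrier (free_alg n)"
  by (auto simp: free_alg_def)

lemma free_gen_in_free_alg: "i \<in> {1..<n} \<Longrightarrow> free_gen i \<in> carrier (free_alg n)"
  by (auto simp: free_gen_def)

lemma free_alg_a_inv: "p \<in> carrier (free_alg n) \<Longrightarrow> \<ominus>\<^bsub>free_alg n\<^esub> p = - p"
proof -
  interpret ring "free_alg n" by (rule ring_free_alg)
  assume p: "p \<in> carrier (free_alg n)"
  then have "- p \<in> carrier (free_alg n)"
    by (auto simp: free_alg_def keys_uminus_eq)
  then show ?thesis
    using p by (intro minus_equality) auto
qed

lemma free_alg_diff: 
  assumes "p \<in> carrier (free_alg n)" "q \<in> carrier (free_alg n)"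
  shows "p - q = p \<ominus>\<^bsub>free_alg n\<^esub> q" 
  using assms by (simp add: a_minus_def free_alg_a_inv)

lemma hecke_relations_subset: "hecke_relations n \<subseteq> carrier (free_alg n)"
proof -
  interpret ring "free_alg n" by (rule ring_free_alg)
  note [simp] = free_gen_in_free_alg
  have *: "free_gen i * free_gen j \<in> carrier (free_alg n)" if "i \<in> {1..<n}" "j \<in> {1..<n}" for i j
    using that m_closed[of "free_gen i" "free_gen j"] by simp
  have **: "free_gen i * free_gen j * free_gen k \<in> carrier (free_alg n)"
    if "i \<in> {1..<n}" "j \<in> {1..<n}" "k \<in> {1..<n}" for i j k
    using that *[of i j] m_closed[of "free_gen i * free_gen j" "free_gen k"] by simp
  have sum: "free_gen i * free_gen i + free_gen i \<in> carrier (free_alg n)" if "i \<in> {1..<n}" for i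
    using a_closed[OF *[OF that that] free_gen_in_free_alg[OF that]] by simp
  have diff: "p - q \<in> carrier (free_alg n)" if "p \<in> carrier (free_alg n)" "q \<in> carrier (free_alg n)" for p q
    using that by (simp add: free_alg_diff)
  show ?thesis
    unfolding hecke_relations_def
    by (safe intro!: sum diff * **)
qed

lemma ideal_hecke_ideal: "ideal (hecke_ideal n) (free_alg n)"
  unfolding hecke_ideal_def
  by (rule ring.genideal_ideal[OF ring_free_alg hecke_relations_subset])

lemma ring_hecke: "ring (hecke n)"
  unfolding hecke_def by (rule ideal.quotient_is_ring[OF ideal_hecke_ideal])

definition hecke_class :: "nat \<Rightarrow> free_elt \<Rightarrow> hecke_elt"
  where "hecke_class n p = hecke_ideal n +>\<^bsub>free_alg n\<^esub> p"

lemma hecke_class_ring_hom: "hecke_class n \<in> ring_hom (free_alg n) (hecke n)"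
  using ideal.rcos_ring_hom[OF ideal_hecke_ideal, of n]
  by (simp add: hecke_def hecke_class_def[abs_def])

lemma hecke_class_closed: "p \<in> carrier (free_alg n) \<Longrightarrow> hecke_class n p \<in> carrier (hecke n)"
  using hecke_class_ring_hom by (rule ring_hom_closed)

lemma hecke_class_add: "p \<in> carrier (free_alg n) \<Longrightarrow> q \<in> carrier (free_alg n) \<Longrightarrow>
    hecke_class n (p + q) = hecke_class n p \<oplus>\<^bsub>hecke n\<^esub> hecke_class n q"
  using ring_hom_add[OF hecke_class_ring_hom, of p n q] by simp

lemma hecke_class_mult: "p \<in> carrier (free_alg n) \<Longrightarrow> q \<in> carrier (free_alg n) \<Longrightarrow>
    hecke_class n (p * q) = hecke_class n p \<otimes>\<^bsub>hecke n\<^esub> hecke_class n q"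
  using ring_hom_mult[OF hecke_class_ring_hom, of p n q] by simp

lemma hecke_class_one: "hecke_class n 1 = \<one>\<^bsub>hecke n\<^esub>"
  using ring_hom_one[OF hecke_class_ring_hom, of n] by simp

lemma carrier_hecke: "carrier (hecke n) = hecke_class n ` carrier (free_alg n)"
  by (auto simp: hecke_def FactRing_def A_RCOSETS_def' hecke_class_def)

lemma scal_hecke_class: "scal n c = hecke_class n (Poly_Mapping.single 0 c)"
  by (simp add: scal_def hecke_class_def)

lemma pi_bar_hecke_class: "pi_bar n i = hecke_class n (free_gen i)"
  by (simp add: pi_bar_def hecke_class_def)

lemma single_zero_in_free_alg [simp]: "Poly_Mapping.single 0 c \<in> carrier (free_alg n)"
  by (simp add: zero_word_def)

lemma scal_closed [simp]: "scal n c \<in> carrier (hecke n)"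
  by (simp add: scal_hecke_class hecke_class_closed)

lemma pi_bar_closed [simp]: "i \<in> {1..<n} \<Longrightarrow> pi_bar n i \<in> carrier (hecke n)"
  by (simp add: pi_bar_hecke_class hecke_class_closed free_gen_in_free_alg)

lemma scal_add: "scal n (a + b) = scal n a \<oplus>\<^bsub>hecke n\<^esub> scal n b"
  by (simp add: scal_hecke_class single_add hecke_class_add)

lemma scal_mult: "scal n (a * b) = scal n a \<otimes>\<^bsub>hecke n\<^esub> scal n b"
  by (simp add: scal_hecke_class mult_single flip: hecke_class_mult)

lemma scal_one: "scal n 1 = \<one>\<^bsub>hecke n\<^esub>"
  by (simp add: scal_hecke_class hecke_class_one)

text \<open>Setting a vanishing coefficient is the same as adding a monomial, so the update
  induction becomes induction on monomial summands. The set \<open>W\<close> keeps the induction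
  inside a free algebra on restricted letters.\<close>

lemma free_elt_induct [consumes 1, case_names zero add]:
  fixes p :: "'a \<Rightarrow>\<^sub>0 'b::comm_monoid_add"
  assumes "Poly_Mapping.keys p \<subseteq> W" and "P 0"
    and "\<And>w c p. w \<in> W \<Longrightarrow> Poly_Mapping.keys p \<subseteq> W \<Longrightarrow> P p \<Longrightarrow> P (p + Poly_Mapping.single w c)"
  shows "P p"
  using assms(1)
proof (induction p rule: update_induct)
  case const
  then show ?case by (simp add: assms)
next
  case (update f a b)
  have upd: "Poly_Mapping.update a b f = f + Poly_Mapping.single a b"
    using \<open>a \<notin> Poly_Mapping.keys f\<close>
    by (intro poly_mapping_eqI) (auto simp: lookup_update lookup_add lookup_single in_keys_iff when_def)
  have "Poly_Mapping.keys (Poly_Mapping.update a b f) = insert a (Poly_Mapping.keys f)"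
    using \<open>b \<noteq> 0\<close> by (auto simp: keys_update)
  with update show ?case
    unfolding upd by (intro assms(3)) auto
qed

text \<open>Classes are sums of monomials, and a monomial is split off letter by letter from the
  front. Its coefficient stays with the tail until the empty word is left, which is a
  scalar.\<close>

lemma hecke_induct [consumes 1, case_names scal gen add mult]:
  assumes h: "h \<in> carrier (hecke n)"
    and scal: "\<And>c. P (scal n c)"
    and gen: "\<And>i. i \<in> {1..<n} \<Longrightarrow> P (pi_bar n i)"
    and add: "\<And>h k. h \<in> carrier (hecke n) \<Longrightarrow> k \<in> carrier (hecke n) \<Longrightarrow> P h \<Longrightarrow> P k \<Longrightarrow> P (h \<oplus>\<^bsub>hecke n\<^esub> k)"
    and mult: "\<And>h k. h \<in> carrier (hecke n) \<Longrightarrow> k \<in> carrier (hecke n) \<Longrightarrow> P h \<Longrightarrow> P k \<Longrightarrow> P (h \<otimes>\<^bsub>hecke n\<^esub> k)"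
  shows "P h"
proof -
  have word: "P (hecke_class n (Poly_Mapping.single (Word l) c))" if "set l \<subseteq> {1..<n}" for l c
    using that
  proof (induction l)
    case Nil
    then show ?case using scal[of c] by (simp add: scal_hecke_class zero_word_def)
  next
    case (Cons i l)
    have "Poly_Mapping.single (Word (i # l)) c = free_gen i * Poly_Mapping.single (Word l) c"
      by (simp add: free_gen_def mult_single plus_word_def)
    then have "hecke_class n (Poly_Mapping.single (Word (i # l)) c) =
        pi_bar n i \<otimes>\<^bsub>hecke n\<^esub> hecke_class n (Poly_Mapping.single (Word l) c)"
      using Cons.prems by (simp add: hecke_class_mult free_gen_in_free_alg pi_bar_hecke_class)
    then show ?case
      using Cons by (simp add: mult gen hecke_class_closed)
  qed
  obtain p where p: "p \<in> carrier (free_alg n)" "h = hecke_class n p"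
    using h by (auto simp: carrier_hecke)
  let ?W = "{w. set (letters w) \<subseteq> {1..<n}}"
  have "Poly_Mapping.keys p \<subseteq> ?W"
    using p by (auto simp: free_alg_def)
  then have "P (hecke_class n p)"
  proof (induction p rule: free_elt_induct)
    case zero
    show ?case using scal[of 0] by (simp add: scal_hecke_class)
  next
    case (add w c p)
    then have p: "p \<in> carrier (free_alg n)" and w: "set (letters w) \<subseteq> {1..<n}"
      by (auto simp: free_alg_def)
    have "P (hecke_class n (Poly_Mapping.single w c))"
      using word[OF w, of c] by simp
    then show ?case
      using p w add by (simp add: hecke_class_add hecke_class_closed assms(4))
  qed
  then show ?thesis by (simp add: p)
qed

text \<open>Centrality of the scalars is what later makes the action of every element on a module
  complex linear.\<close>

lemma scal_comm: "h \<in> carrier (hecke n) \<Longrightarrow> h \<otimes>\<^bsub>hecke n\<^esub> scal n c = scal n c \<otimes>\<^bsub>hecke n\<^esub> h"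
proof (induction h rule: hecke_induct)
  interpret ring "hecke n" by (rule ring_hecke)
  {
    case (scal d)
    show ?case by (simp add: mult.commute flip: scal_mult)
  next
    case (gen i)
    then show ?case
      by (simp add: pi_bar_hecke_class scal_hecke_class free_gen_in_free_alg flip: hecke_class_mult)
        (simp add: free_gen_def mult_single)
  next
    case (add h k)
    then show ?case by (simp add: l_distr r_distr)
  next
    case (mult h k)
    have "h \<otimes>\<^bsub>hecke n\<^esub> k \<otimes>\<^bsub>hecke n\<^esub> scal n c = h \<otimes>\<^bsub>hecke n\<^esub> (scal n c \<otimes>\<^bsub>hecke n\<^esub> k)"
      using mult by (simp add: m_assoc)
    also have "\<dots> = (h \<otimes>\<^bsub>hecke n\<^esub> scal n c) \<otimes>\<^bsub>hecke n\<^esub> k"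
      using mult.hyps by (simp add: m_assoc)
    finally show ?case using mult by (simp add: m_assoc)
  }
qed

text \<open>The data of the universal property: a structure map \<open>c\<close> for scalars and
  images \<open>x i\<close> of the generators obeying the relations. It is instantiated with
  \<open>hecke n\<close>, its opposite ring and \<open>op_ring\<close>. Commuting with scalars is
  asked of the \<open>x i\<close> alone, since words inherit it.\<close>

locale hecke_representation = ring R for R (structure) +
  fixes n :: nat and c :: "complex \<Rightarrow> 'a" and x :: "nat \<Rightarrow> 'a"
  assumes c_closed [simp]: "c z \<in> carrier R"
    and c_add: "c (z + w) = c z \<oplus> c w"
    and c_mult: "c (z * w) = c z \<otimes> c w"
    and c_one: "c 1 = \<one>"
    and x_closed [simp]: "i \<in> {1..<n} \<Longrightarrow> x i \<in> carrier R"
    and c_comm: "i \<in> {1..<n} \<Longrightarrow> x i \<otimes> c z = c z \<otimes> x i"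
    and x_square: "i \<in> {1..<n} \<Longrightarrow> x i \<otimes> x i = \<ominus> x i"
    and x_braid: "i \<in> {1..<n} \<Longrightarrow> i + 1 \<in> {1..<n} \<Longrightarrow> x i \<otimes> x (i + 1) \<otimes> x i = x (i + 1) \<otimes> x i \<otimes> x (i + 1)"
    and x_comm: "i \<in> {1..<n} \<Longrightarrow> j \<in> {1..<n} \<Longrightarrow> i + 2 \<le> j \<Longrightarrow> x i \<otimes> x j = x j \<otimes> x i"
begin

lemma c_zero: "c 0 = \<zero>"
  using c_add[of 0 0] add.l_cancel_one[of "c 0" "c 0"] by simp

text \<open>The default \<open>\<zero>\<close> for letters out of range puts the value of every word
  into the carrier, so that \<open>ev\<close> is additive and multiplicative without side
  conditions.\<close>

definition gen_val :: "nat \<Rightarrow> 'a"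
  where "gen_val i = (if i \<in> {1..<n} then x i else \<zero>)"

lemma gen_val_closed [simp]: "gen_val i \<in> carrier R"
  by (simp add: gen_val_def)

lemma gen_val_comm: "gen_val i \<otimes> c z = c z \<otimes> gen_val i"
  by (simp add: gen_val_def c_comm)

lemma gen_val_eq: "i \<in> {1..<n} \<Longrightarrow> gen_val i = x i"
  by (simp add: gen_val_def)

fun word_val :: "nat list \<Rightarrow> 'a" where
  "word_val [] = \<one>"
| "word_val (i # l) = gen_val i \<otimes> word_val l"

lemma word_val_closed [simp]: "word_val l \<in> carrier R"
  by (induction l) auto

lemma word_val_append: "word_val (k @ l) = word_val k \<otimes> word_val l"
  by (induction k) (auto simp: m_assoc)

lemma word_val_comm: "word_val l \<otimes> c z = c z \<otimes> word_val l"
proof (induction l)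
  case (Cons i l)
  have "word_val (i # l) \<otimes> c z = gen_val i \<otimes> (c z \<otimes> word_val l)"
    using Cons by (simp add: m_assoc)
  also have "\<dots> = (gen_val i \<otimes> c z) \<otimes> word_val l"
    by (simp add: m_assoc)
  finally show ?case by (simp add: gen_val_comm m_assoc)
qed simp

definition ev :: "free_elt \<Rightarrow> 'a"
  where "ev p = (\<Oplus>w\<in>Poly_Mapping.keys p. c (Poly_Mapping.lookup p w) \<otimes> word_val (letters w))"

text \<open>The keys of a sum can be fewer than those of its summands; enlarging the index set gives
  both sides of additivity a common one.\<close>

lemma ev_superset:
  assumes "finite A" "Poly_Mapping.keys p \<subseteq> A"
  shows "ev p = (\<Oplus>w\<in>A. c (Poly_Mapping.lookup p w) \<otimes> word_val (letters w))"
  unfolding ev_def using assms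
  by (intro add.finprod_mono_neutral_cong_left) (auto simp: in_keys_iff c_zero)

lemma ev_closed [simp]: "ev p \<in> carrier R"
  by (simp add: ev_def)

lemma ev_add: "ev (p + q) = ev p \<oplus> ev q"
proof -
  let ?A = "Poly_Mapping.keys p \<union> Poly_Mapping.keys q"
  have "ev (p + q) = (\<Oplus>w\<in>?A. c (Poly_Mapping.lookup (p + q) w) \<otimes> word_val (letters w))"
    using keys_add[of p q] by (intro ev_superset) auto
  also have "\<dots> = (\<Oplus>w\<in>?A. c (Poly_Mapping.lookup p w) \<otimes> word_val (letters w) \<oplus>
      c (Poly_Mapping.lookup q w) \<otimes> word_val (letters w))"
    by (simp add: lookup_add c_add l_distr)
  also have "\<dots> = ev p \<oplus> ev q"
    by (subst finsum_addf) (auto simp: ev_superset[of ?A])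
  finally show ?thesis .
qed

lemma ev_single: "ev (Poly_Mapping.single w z) = c z \<otimes> word_val (letters w)"
  by (subst ev_superset[of "{w}"]) auto

lemma ev_zero: "ev 0 = \<zero>"
  by (simp add: ev_def)

lemma ev_one: "ev 1 = \<one>"
  unfolding single_one[symmetric] ev_single by (simp add: zero_word_def c_one)

text \<open>The place where centrality enters: the coefficient \<open>z\<close> has to move past the
  word \<open>u\<close> to reach its own word \<open>w\<close>.\<close>

lemma ev_mult_single: "ev (p * Poly_Mapping.single w z) = ev p \<otimes> ev (Poly_Mapping.single w z)"
  using subset_UNIV[of "Poly_Mapping.keys p"]
proof (induction p rule: free_elt_induct)
  case zero
  show ?case by (simp add: ev_zero)
next
  case (add u a p)
  have "c (a * z) \<otimes> word_val (letters (u + w)) = c a \<otimes> (c z \<otimes> word_val (letters u)) \<otimes> word_val (letters w)"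
    by (simp add: plus_word_def word_val_append c_mult m_assoc)
  also have "\<dots> = (c a \<otimes> word_val (letters u)) \<otimes> (c z \<otimes> word_val (letters w))"
    by (subst word_val_comm[symmetric]) (simp add: m_assoc)
  finally have "c (a * z) \<otimes> word_val (letters (u + w)) = (c a \<otimes> word_val (letters u)) \<otimes> (c z \<otimes> word_val (letters w))" .
  with add show ?case
    by (simp add: distrib_right ev_add l_distr mult_single ev_single)
qed

lemma ev_mult: "ev (p * q) = ev p \<otimes> ev q"
  using subset_UNIV[of "Poly_Mapping.keys q"]
proof (induction q rule: free_elt_induct)
  case zero
  show ?case by (simp add: ev_zero)
next
  case (add u a q)
  then show ?case
    by (simp add: distrib_left ev_add r_distr ev_mult_single)
qed

lemma ev_gen: "i \<in> {1..<n} \<Longrightarrow> ev (free_gen i) = x i"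
  by (simp add: free_gen_def ev_single c_one gen_val_eq)

lemma ev_uminus: "ev (- p) = \<ominus> ev p"
  using ev_add[of "- p" p] by (simp add: ev_zero minus_equality)

lemma ev_diff: "ev (p - q) = ev p \<ominus> ev q"
  using ev_add[of p "- q"] by (simp add: ev_uminus a_minus_def)

lemma ev_ring_hom: "ev \<in> ring_hom (free_alg n) R"
  by (rule ring_hom_memI) (auto simp: ev_mult ev_add ev_one)

lemma ev_hecke_relations: "r \<in> hecke_relations n \<Longrightarrow> ev r = \<zero>"
proof -
  have sq: "ev (free_gen i * free_gen i + free_gen i) = \<zero>" if "i \<in> {1..<n}" for i
    using x_closed[OF that] unfolding ev_add ev_mult ev_gen[OF that] x_square[OF that] by (rule l_neg)
  have br: "ev (free_gen i * free_gen (i + 1) * free_gen i - free_gen (i + 1) * free_gen i * free_gen (i + 1)) = \<zero>"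
    if "i \<in> {1..<n}" "i + 1 \<in> {1..<n}" for i
    unfolding ev_diff ev_mult ev_gen[OF that(1)] ev_gen[OF that(2)] x_braid[OF that] a_minus_def
    using x_closed[OF that(1)] x_closed[OF that(2)] by (intro r_neg m_closed)
  have co: "ev (free_gen i * free_gen j - free_gen j * free_gen i) = \<zero>"
    if "i \<in> {1..<n}" "j \<in> {1..<n}" "i + 2 \<le> j \<or> j + 2 \<le> i" for i j
  proof -
    have "x i \<otimes> x j = x j \<otimes> x i"
      using that x_comm[of i j] x_comm[of j i] by auto
    then show ?thesis
      using x_closed[OF that(1)] x_closed[OF that(2)]
      by (simp add: ev_diff ev_mult ev_gen[OF that(1)] ev_gen[OF that(2)] a_minus_def r_neg del: x_closed)
  qed
  show "r \<in> hecke_relations n \<Longrightarrow> ev r = \<zero>"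
    unfolding hecke_relations_def
    by (elim UnE CollectE exE conjE) (simp_all only: sq br co)
qed

text \<open>The kernel of \<open>ev\<close> is an ideal and contains the relations, hence also the
  ideal generated by them.\<close>

lemma ev_hecke_ideal:
  assumes "p \<in> hecke_ideal n"
  shows "ev p = \<zero>"
proof -
  have "ideal (a_kernel (free_alg n) R ev) (free_alg n)"
    by (rule ring_hom_ring.kernel_is_ideal) (rule ring_hom_ringI2[OF ring_free_alg ring_axioms ev_ring_hom])
  moreover have "hecke_relations n \<subseteq> a_kernel (free_alg n) R ev"
    using hecke_relations_subset ev_hecke_relations unfolding a_kernel_def' by blast
  ultimately have "hecke_ideal n \<subseteq> a_kernel (free_alg n) R ev"
    unfolding hecke_ideal_def by (rule ring.genideal_minimal[OF ring_free_alg])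
  then show ?thesis
    using assms unfolding a_kernel_def' by blast
qed

lemma hecke_class_eqD:
  assumes "p \<in> carrier (free_alg n)" "q \<in> carrier (free_alg n)" "hecke_class n p = hecke_class n q"
  shows "ev p = ev q"
proof -
  interpret I: ideal "hecke_ideal n" "free_alg n" by (rule ideal_hecke_ideal)
  have "p \<in> hecke_ideal n +>\<^bsub>free_alg n\<^esub> q"
    using assms I.a_rcos_self unfolding hecke_class_def by blast
  then obtain h where "h \<in> hecke_ideal n" "p = h + q"
    by (auto simp: a_r_coset_def')
  then show ?thesis by (simp add: ev_add ev_hecke_ideal)
qed

lemma hecke_lift_exists:
  "\<exists>F\<in>ring_hom (hecke n) R. (\<forall>z. F (scal n z) = c z) \<and> (\<forall>i\<in>{1..<n}. F (pi_bar n i) = x i)"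
proof -
  \<comment> \<open>Evaluate any representative of the class; \<open>hecke_class_eqD\<close> makes
    the choice immaterial.\<close>
  define F where "F h = ev (SOME p. p \<in> carrier (free_alg n) \<and> hecke_class n p = h)" for h
  have F: "F (hecke_class n p) = ev p" if "p \<in> carrier (free_alg n)" for p
  proof -
    have "(SOME q. q \<in> carrier (free_alg n) \<and> hecke_class n q = hecke_class n p) \<in> carrier (free_alg n) \<and>
      hecke_class n (SOME q. q \<in> carrier (free_alg n) \<and> hecke_class n q = hecke_class n p) = hecke_class n p"
      by (rule someI) (use that in auto)
    then show ?thesis
      unfolding F_def using that hecke_class_eqD by blast
  qed
  interpret F: ring "free_alg n" by (rule ring_free_alg)
  show ?thesis
  proof (intro bexI[of _ F] conjI allI ballI)
    show "F \<in> ring_hom (hecke n) R"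
    proof (rule ring_hom_memI)
      fix h k assume "h \<in> carrier (hecke n)" "k \<in> carrier (hecke n)"
      then obtain p q where pq: "p \<in> carrier (free_alg n)" "q \<in> carrier (free_alg n)"
        "h = hecke_class n p" "k = hecke_class n q"
        by (auto simp: carrier_hecke)
      show "F (h \<otimes>\<^bsub>hecke n\<^esub> k) = F h \<otimes> F k"
        using pq F.m_closed[OF pq(1,2)] by (simp add: F ev_mult flip: hecke_class_mult)
      show "F (h \<oplus>\<^bsub>hecke n\<^esub> k) = F h \<oplus> F k"
        using pq F.a_closed[OF pq(1,2)] by (simp add: F ev_add flip: hecke_class_add)
    next
      show "F \<one>\<^bsub>hecke n\<^esub> = \<one>"
        using F[of 1] F.one_closed by (simp add: hecke_class_one ev_one)
    qed (auto simp: F_def)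
    show "F (scal n z) = c z" for z
      by (simp add: scal_hecke_class F ev_single) (simp add: zero_word_def)
    show "F (pi_bar n i) = x i" if "i \<in> {1..<n}" for i
      using that by (simp add: pi_bar_hecke_class F free_gen_in_free_alg ev_gen)
  qed
qed

end

lemma ring_hom_hecke_eqI:
  assumes "F \<in> ring_hom (hecke n) R" "G \<in> ring_hom (hecke n) R"
    and "\<And>z. F (scal n z) = G (scal n z)"
    and "\<And>i. i \<in> {1..<n} \<Longrightarrow> F (pi_bar n i) = G (pi_bar n i)"
    and h: "h \<in> carrier (hecke n)"
  shows "F h = G h"
  using h
  by (induction h rule: hecke_induct)
    (simp_all add: assms ring_hom_add[OF assms(1)] ring_hom_add[OF assms(2)]
      ring_hom_mult[OF assms(1)] ring_hom_mult[OF assms(2)])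

section \<open>The involutions\<close>

lemma pi_bar_square:
  assumes "i \<in> {1..<n}"
  shows "pi_bar n i \<otimes>\<^bsub>hecke n\<^esub> pi_bar n i = \<ominus>\<^bsub>hecke n\<^esub> pi_bar n i"
proof -
  interpret ring "hecke n" by (rule ring_hecke)
  let ?g = "free_gen i"
  have "?g * ?g + ?g \<in> hecke_ideal n"
    unfolding hecke_ideal_def using assms
    by (intro subsetD[OF ring.genideal_self[OF ring_free_alg hecke_relations_subset]]) (auto simp: hecke_relations_def)
  then have "hecke_class n (?g * ?g + ?g) = hecke_ideal n"
    unfolding hecke_class_def
    by (intro abelian_subgroup.a_rcos_const[OF abelian_subgroupI3] ideal.axioms(1)[OF ideal_hecke_ideal] ring.is_abelian_group[OF ring_free_alg])
  then have "pi_bar n i \<otimes>\<^bsub>hecke n\<^esub> pi_bar n i \<oplus>\<^bsub>hecke n\<^esub> pi_bar n i = \<zero>\<^bsub>hecke n\<^esub>"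
    using assms ring.ring_simprules(5)[OF ring_free_alg, of ?g n ?g]
    by (simp add: pi_bar_hecke_class hecke_class_add hecke_class_mult free_gen_in_free_alg)
       (simp add: hecke_def FactRing_def)
  then show ?thesis
    using assms by (intro minus_equality[symmetric]) auto
qed

lemma hecke_class_eqI:
  assumes "p \<in> carrier (free_alg n)" "q \<in> carrier (free_alg n)" "p - q \<in> hecke_ideal n"
  shows "hecke_class n p = hecke_class n q"
proof -
  interpret I: ideal "hecke_ideal n" "free_alg n" by (rule ideal_hecke_ideal)
  have "p = (p - q) + q" by simp
  then have "p \<in> hecke_ideal n +>\<^bsub>free_alg n\<^esub> q"
    using assms(3) by (force simp: a_r_coset_def')
  then show ?thesis
    unfolding hecke_class_def using assms by (intro I.a_repr_independence'[symmetric])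
qed

lemma pi_bar_braid:
  assumes "i \<in> {1..<n}" "i + 1 \<in> {1..<n}"
  shows "pi_bar n i \<otimes>\<^bsub>hecke n\<^esub> pi_bar n (i + 1) \<otimes>\<^bsub>hecke n\<^esub> pi_bar n i =
    pi_bar n (i + 1) \<otimes>\<^bsub>hecke n\<^esub> pi_bar n i \<otimes>\<^bsub>hecke n\<^esub> pi_bar n (i + 1)"
proof -
  let ?g = "free_gen i" and ?h = "free_gen (i + 1)"
  note g = free_gen_in_free_alg[OF assms(1)] and h = free_gen_in_free_alg[OF assms(2)]
  note cl = ring.ring_simprules(5)[OF ring_free_alg, of _ n, simplified]
  have "?g * ?h * ?g - ?h * ?g * ?h \<in> hecke_ideal n"
    unfolding hecke_ideal_def
    by (intro subsetD[OF ring.genideal_self[OF ring_free_alg hecke_relations_subset]])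
      (use assms in \<open>unfold hecke_relations_def, blast\<close>)
  then have "hecke_class n (?g * ?h * ?g) = hecke_class n (?h * ?g * ?h)"
    using g h by (intro hecke_class_eqI cl)
  then show ?thesis
    unfolding pi_bar_hecke_class
    by (simp add: hecke_class_mult[OF cl[OF g h] g] hecke_class_mult[OF cl[OF h g] h]
      hecke_class_mult[OF g h] hecke_class_mult[OF h g] del: One_nat_def add_Suc_right add_0_right)
qed

lemma pi_bar_comm:
  assumes "i \<in> {1..<n}" "j \<in> {1..<n}" "i + 2 \<le> j \<or> j + 2 \<le> i"
  shows "pi_bar n i \<otimes>\<^bsub>hecke n\<^esub> pi_bar n j = pi_bar n j \<otimes>\<^bsub>hecke n\<^esub> pi_bar n i"
proof -
  let ?g = "free_gen i" and ?h = "free_gen j"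
  note g = free_gen_in_free_alg[OF assms(1)] and h = free_gen_in_free_alg[OF assms(2)]
  note cl = ring.ring_simprules(5)[OF ring_free_alg, of _ n, simplified]
  have "?g * ?h - ?h * ?g \<in> hecke_ideal n"
    unfolding hecke_ideal_def
    by (intro subsetD[OF ring.genideal_self[OF ring_free_alg hecke_relations_subset]])
      (use assms in \<open>unfold hecke_relations_def, blast\<close>)
  then have "hecke_class n (?g * ?h) = hecke_class n (?h * ?g)"
    using g h by (intro hecke_class_eqI cl)
  then show ?thesis
    unfolding pi_bar_hecke_class by (simp add: hecke_class_mult g h)
qed

lemma pi_gen_closed [simp]: "i \<in> {1..<n} \<Longrightarrow> pi_gen n i \<in> carrier (hecke n)"
  unfolding pi_gen_def by (intro ring.ring_simprules(1)[OF ring_hecke] pi_bar_closed) (auto simp: ring.ring_simprules[OF ring_hecke])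

lemma ring_opposite_ring:
  assumes "ring R"
  shows "ring (opposite_ring R)"
proof -
  interpret ring R by fact
  show ?thesis
  proof (rule ringI)
    show "abelian_group (opposite_ring R)"
      by (rule abelian_groupI) (auto simp: opposite_ring_def a_ac intro: r_neg bexI[of _ "\<ominus>\<^bsub>R\<^esub> x" for x])
    show "Group.monoid (opposite_ring R)"
      by (rule monoidI) (auto simp: opposite_ring_def m_assoc)
  qed (auto simp: opposite_ring_def l_distr r_distr)
qed

lemma opposite_ring_simps [simp]:
  "carrier (opposite_ring R) = carrier R" "x \<otimes>\<^bsub>opposite_ring R\<^esub> y = y \<otimes>\<^bsub>R\<^esub> x"
  "\<one>\<^bsub>opposite_ring R\<^esub> = \<one>\<^bsub>R\<^esub>" "x \<oplus>\<^bsub>opposite_ring R\<^esub> y = x \<oplus>\<^bsub>R\<^esub> y"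
  "\<zero>\<^bsub>opposite_ring R\<^esub> = \<zero>\<^bsub>R\<^esub>"
  by (auto simp: opposite_ring_def)

lemma opposite_ring_a_inv [simp]: "\<ominus>\<^bsub>opposite_ring R\<^esub> x = \<ominus>\<^bsub>R\<^esub> x"
  by (simp add: a_inv_def m_inv_def opposite_ring_def)

lemma ring_hom_restrict:
  assumes "ring R" "f \<in> ring_hom R S"
  shows "restrict f (carrier R) \<in> ring_hom R S"
  using assms ring.ring_simprules(1,5,6)[OF assms(1)]
  by (auto simp: ring_hom_def)

text \<open>Shows that the descriptions defining the involutions denote. The ring \<open>R\<close>
  is \<open>hecke n\<close> or its opposite, which treats anti-involutions as well: in both cases
  \<open>f \<circ> f\<close> is an endomorphism of \<open>hecke n\<close>, so it is the identity
  once it fixes scalars and generators. Restricting to the carrier makes the lift extensional and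
  therefore unique.\<close>

lemma hecke_hom_the:
  fixes x :: "nat \<Rightarrow> hecke_elt"
  assumes R: "carrier R = carrier (hecke n)" and rep: "hecke_representation R n (scal n) x"
    and inv: "\<forall>f\<in>ring_hom (hecke n) R. (\<forall>z. f (scal n z) = scal n z) \<longrightarrow>
      (\<forall>i\<in>{1..<n}. f (pi_bar n i) = x i) \<longrightarrow> (\<forall>i\<in>{1..<n}. f (x i) = pi_bar n i)"
    and comp: "\<forall>f\<in>ring_hom (hecke n) R. f \<circ> f \<in> ring_hom (hecke n) (hecke n)"
    and f: "f = (THE f. f \<in> extensional (carrier (hecke n)) \<and>
      (f \<in> ring_hom (hecke n) R \<and> (\<forall>z. f (scal n z) = scal n z) \<and> (\<forall>h\<in>carrier (hecke n). f (f h) = h)) \<and>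
      (\<forall>i\<in>{1..<n}. f (pi_bar n i) = x i))"
  shows "f \<in> ring_hom (hecke n) R" "f (scal n z) = scal n z" "i \<in> {1..<n} \<Longrightarrow> f (pi_bar n i) = x i"
proof -
  let ?P = "\<lambda>f. f \<in> extensional (carrier (hecke n)) \<and>
      (f \<in> ring_hom (hecke n) R \<and> (\<forall>z. f (scal n z) = scal n z) \<and> (\<forall>h\<in>carrier (hecke n). f (f h) = h)) \<and>
      (\<forall>i\<in>{1..<n}. f (pi_bar n i) = x i)"
  obtain F where F: "F \<in> ring_hom (hecke n) R" "\<forall>z. F (scal n z) = scal n z" "\<forall>i\<in>{1..<n}. F (pi_bar n i) = x i"
    using hecke_representation.hecke_lift_exists[OF rep] by blast
  define G where "G = restrict F (carrier (hecke n))"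
  have G: "G \<in> ring_hom (hecke n) R" "\<forall>z. G (scal n z) = scal n z" "\<forall>i\<in>{1..<n}. G (pi_bar n i) = x i"
    using F ring_hom_restrict[OF ring_hecke F(1)] by (auto simp: G_def simp del: atLeastLessThan_iff)
  have inv_G: "\<forall>i\<in>{1..<n}. G (x i) = pi_bar n i"
    using inv G by blast
  have "(G \<circ> G) h = id h" if "h \<in> carrier (hecke n)" for h
  proof (rule ring_hom_hecke_eqI[of "G \<circ> G" n "hecke n" id])
    show "G \<circ> G \<in> ring_hom (hecke n) (hecke n)" using comp G(1) by blast
    show "id \<in> ring_hom (hecke n) (hecke n)" by (auto simp: ring_hom_def)
    fix i assume "i \<in> {1..<n}"
    then show "(G \<circ> G) (pi_bar n i) = id (pi_bar n i)"
      using inv_G G(3) by (simp del: atLeastLessThan_iff)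
  qed (use G that in auto)
  then have "?P G"
    using G by (auto simp: G_def simp del: atLeastLessThan_iff)
  moreover have "H = G" if "?P H" for H
  proof (rule extensionalityI)
    show "H \<in> extensional (carrier (hecke n))" "G \<in> extensional (carrier (hecke n))"
      using that by (simp_all add: G_def)
    fix h assume h: "h \<in> carrier (hecke n)"
    have H: "H \<in> ring_hom (hecke n) R" "\<And>z. H (scal n z) = G (scal n z)"
      "\<And>i. i \<in> {1..<n} \<Longrightarrow> H (pi_bar n i) = G (pi_bar n i)"
      using that G by (simp_all del: atLeastLessThan_iff)
    show "H h = G h"
      by (rule ring_hom_hecke_eqI[OF H(1) G(1)]) (fact H h)+
  qed
  ultimately have "?P f"
    unfolding f by (rule theI[of ?P])
  then show "f \<in> ring_hom (hecke n) R" "f (scal n z) = scal n z" "i \<in> {1..<n} \<Longrightarrow> f (pi_bar n i) = x i"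
    by blast+
qed

lemma hecke_phi:
  shows hecke_phi_hom: "hecke_phi n \<in> ring_hom (hecke n) (hecke n)"
    and hecke_phi_scal: "hecke_phi n (scal n z) = scal n z"
    and hecke_phi_pi_bar: "i \<in> {1..<n} \<Longrightarrow> hecke_phi n (pi_bar n i) = pi_bar n (n - i)"
proof -
  interpret ring "hecke n" by (rule ring_hecke)
  let ?x = "\<lambda>i. pi_bar n (n - i)"
  have mem: "n - i \<in> {1..<n}" if "i \<in> {1..<n}" for i
    using that by auto
  have rep: "hecke_representation (hecke n) n (scal n) ?x"
  proof (intro hecke_representation.intro hecke_representation_axioms.intro ring_hecke scal_closed scal_add scal_mult scal_one)
    fix i assume i: "i \<in> {1..<n}" "i + 1 \<in> {1..<n}"
    \<comment> \<open>Reflecting indices reverses neighbours: \<open>n - i\<close> is the successor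
      of \<open>n - (i + 1)\<close>, so the braid relation at \<open>j\<close> is read from right to
      left.\<close>
    then obtain j where j: "n - i = j + 1" "n - (i + 1) = j" "j \<in> {1..<n}" "j + 1 \<in> {1..<n}"
      by (auto intro: that[of "n - (i + 1)"])
    show "?x i \<otimes>\<^bsub>hecke n\<^esub> ?x (i + 1) \<otimes>\<^bsub>hecke n\<^esub> ?x i = ?x (i + 1) \<otimes>\<^bsub>hecke n\<^esub> ?x i \<otimes>\<^bsub>hecke n\<^esub> ?x (i + 1)"
      unfolding j(1,2) by (rule pi_bar_braid[OF j(3,4), symmetric])
  next
    fix i j assume i: "i \<in> {1..<n}" "j \<in> {1..<n}" "i + 2 \<le> j"
    then show "?x i \<otimes>\<^bsub>hecke n\<^esub> ?x j = ?x j \<otimes>\<^bsub>hecke n\<^esub> ?x i"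
      by (intro pi_bar_comm) auto
  qed (intro scal_comm pi_bar_square pi_bar_closed mem; assumption)+
  have "hecke_phi n = (THE f. f \<in> extensional (carrier (hecke n)) \<and>
      (f \<in> ring_hom (hecke n) (hecke n) \<and> (\<forall>z. f (scal n z) = scal n z) \<and> (\<forall>h\<in>carrier (hecke n). f (f h) = h)) \<and>
      (\<forall>i\<in>{1..<n}. f (pi_bar n i) = ?x i))"
    unfolding hecke_phi_def algebra_involution_def ..
  note eq = this
  have inv: "f (?x i) = pi_bar n i" if "f \<in> ring_hom (hecke n) (hecke n)" "\<forall>z. f (scal n z) = scal n z"
    "\<forall>i\<in>{1..<n}. f (pi_bar n i) = ?x i" "i \<in> {1..<n}" for f i
    using that mem[OF that(4)] by auto
  have comp: "f \<circ> f \<in> ring_hom (hecke n) (hecke n)" if "f \<in> ring_hom (hecke n) (hecke n)" for f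
    using that that by (rule ring_hom_trans)
  have inv': "\<forall>f\<in>ring_hom (hecke n) (hecke n). (\<forall>z. f (scal n z) = scal n z) \<longrightarrow>
      (\<forall>i\<in>{1..<n}. f (pi_bar n i) = ?x i) \<longrightarrow> (\<forall>i\<in>{1..<n}. f (?x i) = pi_bar n i)"
    using inv by blast
  have comp': "\<forall>f\<in>ring_hom (hecke n) (hecke n). f \<circ> f \<in> ring_hom (hecke n) (hecke n)"
    using comp by blast
  note the = hecke_hom_the[where x = ?x, OF refl rep inv' comp' eq]
  show "hecke_phi n \<in> ring_hom (hecke n) (hecke n)" "hecke_phi n (scal n z) = scal n z"
    "i \<in> {1..<n} \<Longrightarrow> hecke_phi n (pi_bar n i) = pi_bar n (n - i)"
    by (fact the)+
qed

lemma hecke_theta: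
  shows hecke_theta_hom: "hecke_theta n \<in> ring_hom (hecke n) (hecke n)"
    and hecke_theta_scal: "hecke_theta n (scal n z) = scal n z"
    and hecke_theta_pi_bar: "i \<in> {1..<n} \<Longrightarrow> hecke_theta n (pi_bar n i) = \<ominus>\<^bsub>hecke n\<^esub> pi_gen n i"
proof -
  interpret ring "hecke n" by (rule ring_hecke)
  let ?x = "\<lambda>i. \<ominus>\<^bsub>hecke n\<^esub> pi_gen n i"
  have sq: "pi_gen n i \<otimes>\<^bsub>hecke n\<^esub> pi_gen n i = pi_gen n i" if "i \<in> {1..<n}" for i
  proof -
    let ?p = "pi_bar n i"
    have p: "?p \<in> carrier (hecke n)" using that by simp
    have "pi_gen n i \<otimes>\<^bsub>hecke n\<^esub> pi_gen n i =
        (?p \<otimes>\<^bsub>hecke n\<^esub> ?p \<oplus>\<^bsub>hecke n\<^esub> ?p) \<oplus>\<^bsub>hecke n\<^esub> (?p \<oplus>\<^bsub>hecke n\<^esub> \<one>\<^bsub>hecke n\<^esub>)"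
      unfolding pi_gen_def using p by (simp add: l_distr r_distr a_ac)
    then show ?thesis
      using p that by (simp add: pi_gen_def pi_bar_square l_neg del: atLeastLessThan_iff)
  qed
  have braid: "pi_gen n i \<otimes>\<^bsub>hecke n\<^esub> pi_gen n j \<otimes>\<^bsub>hecke n\<^esub> pi_gen n i =
      pi_gen n j \<otimes>\<^bsub>hecke n\<^esub> pi_gen n i \<otimes>\<^bsub>hecke n\<^esub> pi_gen n j"
    if ij: "i \<in> {1..<n}" "j \<in> {1..<n}"
      and br: "pi_bar n i \<otimes>\<^bsub>hecke n\<^esub> pi_bar n j \<otimes>\<^bsub>hecke n\<^esub> pi_bar n i =
      pi_bar n j \<otimes>\<^bsub>hecke n\<^esub> pi_bar n i \<otimes>\<^bsub>hecke n\<^esub> pi_bar n j" for i j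
  proof -
    \<comment> \<open>With p, q for the two generators, (p+1)(q+1)(p+1) = pqp + (pq + qp) + (p^2 +
      p) + (p + q + 1), and p^2 + p vanishes. What remains is symmetric in p and q except for pqp,
      where the braid relation applies.\<close>
    have *: "pi_gen n i \<otimes>\<^bsub>hecke n\<^esub> pi_gen n j \<otimes>\<^bsub>hecke n\<^esub> pi_gen n i =
      (pi_bar n i \<otimes>\<^bsub>hecke n\<^esub> pi_bar n j \<otimes>\<^bsub>hecke n\<^esub> pi_bar n i) \<oplus>\<^bsub>hecke n\<^esub>
      (pi_bar n i \<otimes>\<^bsub>hecke n\<^esub> pi_bar n j \<oplus>\<^bsub>hecke n\<^esub> pi_bar n j \<otimes>\<^bsub>hecke n\<^esub> pi_bar n i) \<oplus>\<^bsub>hecke n\<^esub>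
      (pi_bar n i \<oplus>\<^bsub>hecke n\<^esub> pi_bar n j \<oplus>\<^bsub>hecke n\<^esub> \<one>\<^bsub>hecke n\<^esub>)"
      if ij: "i \<in> {1..<n}" "j \<in> {1..<n}" for i j
    proof -
      have c: "pi_bar n i \<in> carrier (hecke n)" "pi_bar n j \<in> carrier (hecke n)"
        using ij by auto
      let ?p = "pi_bar n i" and ?q = "pi_bar n j"
      have "pi_gen n i \<otimes>\<^bsub>hecke n\<^esub> pi_gen n j \<otimes>\<^bsub>hecke n\<^esub> pi_gen n i =
        (?p \<otimes>\<^bsub>hecke n\<^esub> ?q \<otimes>\<^bsub>hecke n\<^esub> ?p) \<oplus>\<^bsub>hecke n\<^esub>
        (?p \<otimes>\<^bsub>hecke n\<^esub> ?q \<oplus>\<^bsub>hecke n\<^esub> ?q \<otimes>\<^bsub>hecke n\<^esub> ?p) \<oplus>\<^bsub>hecke n\<^esub>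
        ((?p \<otimes>\<^bsub>hecke n\<^esub> ?p) \<oplus>\<^bsub>hecke n\<^esub> ?p) \<oplus>\<^bsub>hecke n\<^esub> (?p \<oplus>\<^bsub>hecke n\<^esub> ?q \<oplus>\<^bsub>hecke n\<^esub> \<one>\<^bsub>hecke n\<^esub>)"
        unfolding pi_gen_def using c by (simp add: l_distr r_distr a_ac)
      then show ?thesis
        using c ij by (simp add: pi_bar_square l_neg del: atLeastLessThan_iff)
    qed
    show ?thesis
      unfolding *[OF ij] *[OF ij(2,1)] br using ij by (simp add: a_ac)
  qed
  have rep: "hecke_representation (hecke n) n (scal n) ?x"
  proof (intro hecke_representation.intro hecke_representation_axioms.intro ring_hecke scal_closed scal_add scal_mult scal_one)
    fix i assume i: "i \<in> {1..<n}" "i + 1 \<in> {1..<n}"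
    then show "?x i \<otimes>\<^bsub>hecke n\<^esub> ?x (i + 1) \<otimes>\<^bsub>hecke n\<^esub> ?x i = ?x (i + 1) \<otimes>\<^bsub>hecke n\<^esub> ?x i \<otimes>\<^bsub>hecke n\<^esub> ?x (i + 1)"
      using braid[OF i pi_bar_braid[OF i]] by (simp add: l_minus r_minus del: atLeastLessThan_iff One_nat_def add_Suc_right add_0_right)
  next
    fix i j assume i: "i \<in> {1..<n}" "j \<in> {1..<n}" "i + 2 \<le> j"
    then have "pi_gen n i \<otimes>\<^bsub>hecke n\<^esub> pi_gen n j = pi_gen n j \<otimes>\<^bsub>hecke n\<^esub> pi_gen n i"
      using pi_bar_comm[of i n j] by (simp add: pi_gen_def l_distr r_distr a_ac)
    then show "?x i \<otimes>\<^bsub>hecke n\<^esub> ?x j = ?x j \<otimes>\<^bsub>hecke n\<^esub> ?x i"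
      using i by (simp add: l_minus r_minus)
  next
    fix i z assume "i \<in> {1..<n}"
    then show "?x i \<otimes>\<^bsub>hecke n\<^esub> scal n z = scal n z \<otimes>\<^bsub>hecke n\<^esub> ?x i"
      by (intro scal_comm) auto
  qed (auto simp: sq l_minus r_minus simp del: atLeastLessThan_iff)
  have "hecke_theta n = (THE f. f \<in> extensional (carrier (hecke n)) \<and>
      (f \<in> ring_hom (hecke n) (hecke n) \<and> (\<forall>z. f (scal n z) = scal n z) \<and> (\<forall>h\<in>carrier (hecke n). f (f h) = h)) \<and>
      (\<forall>i\<in>{1..<n}. f (pi_bar n i) = ?x i))"
    unfolding hecke_theta_def algebra_involution_def ..
  note eq = this
  have inv: "f (?x i) = pi_bar n i" if f: "f \<in> ring_hom (hecke n) (hecke n)" and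
    "\<forall>z. f (scal n z) = scal n z" and x: "\<forall>i\<in>{1..<n}. f (pi_bar n i) = ?x i" and i: "i \<in> {1..<n}" for f i
  proof -
    interpret f: ring_hom_ring "hecke n" "hecke n" f
      by (rule ring_hom_ringI2[OF ring_hecke ring_hecke f])
    have "f (?x i) = \<ominus>\<^bsub>hecke n\<^esub> (\<ominus>\<^bsub>hecke n\<^esub> pi_gen n i \<oplus>\<^bsub>hecke n\<^esub> \<one>\<^bsub>hecke n\<^esub>)"
      using i x by (simp add: pi_gen_def del: atLeastLessThan_iff)
    also have "\<dots> = pi_bar n i"
      using i by (simp add: pi_gen_def minus_add a_assoc l_neg r_neg del: atLeastLessThan_iff)
    finally show ?thesis .
  qed
  have comp: "f \<circ> f \<in> ring_hom (hecke n) (hecke n)" if "f \<in> ring_hom (hecke n) (hecke n)" for f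
    using that that by (rule ring_hom_trans)
  have inv': "\<forall>f\<in>ring_hom (hecke n) (hecke n). (\<forall>z. f (scal n z) = scal n z) \<longrightarrow>
      (\<forall>i\<in>{1..<n}. f (pi_bar n i) = ?x i) \<longrightarrow> (\<forall>i\<in>{1..<n}. f (?x i) = pi_bar n i)"
    using inv by blast
  have comp': "\<forall>f\<in>ring_hom (hecke n) (hecke n). f \<circ> f \<in> ring_hom (hecke n) (hecke n)"
    using comp by blast
  note the = hecke_hom_the[where x = ?x, OF refl rep inv' comp' eq]
  show "hecke_theta n \<in> ring_hom (hecke n) (hecke n)" "hecke_theta n (scal n z) = scal n z"
    "i \<in> {1..<n} \<Longrightarrow> hecke_theta n (pi_bar n i) = \<ominus>\<^bsub>hecke n\<^esub> pi_gen n i"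
    by (fact the)+
qed

text \<open>Each defining relation survives reading its words backwards: squares and braid words are
  palindromes, and the commutation relation only swaps its sides.\<close>

lemma hecke_chi:
  shows hecke_chi_hom: "hecke_chi n \<in> ring_hom (hecke n) (opposite_ring (hecke n))"
    and hecke_chi_scal: "hecke_chi n (scal n z) = scal n z"
    and hecke_chi_pi_bar: "i \<in> {1..<n} \<Longrightarrow> hecke_chi n (pi_bar n i) = pi_bar n i"
proof -
  interpret ring "hecke n" by (rule ring_hecke)
  interpret op: ring "opposite_ring (hecke n)" by (rule ring_opposite_ring[OF ring_hecke])
  let ?x = "\<lambda>i. pi_bar n i"
  have rep: "hecke_representation (opposite_ring (hecke n)) n (scal n) ?x"
  proof (intro hecke_representation.intro hecke_representation_axioms.intro op.ring_axioms)
    fix i assume i: "i \<in> {1..<n}" "i + 1 \<in> {1..<n}"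
    then show "?x i \<otimes>\<^bsub>opposite_ring (hecke n)\<^esub> ?x (i + 1) \<otimes>\<^bsub>opposite_ring (hecke n)\<^esub> ?x i =
        ?x (i + 1) \<otimes>\<^bsub>opposite_ring (hecke n)\<^esub> ?x i \<otimes>\<^bsub>opposite_ring (hecke n)\<^esub> ?x (i + 1)"
      using pi_bar_braid[OF i] by (simp add: m_assoc del: atLeastLessThan_iff One_nat_def add_Suc_right add_0_right)
  next
    fix i j assume i: "i \<in> {1..<n}" "j \<in> {1..<n}" "i + 2 \<le> j"
    then show "?x i \<otimes>\<^bsub>opposite_ring (hecke n)\<^esub> ?x j = ?x j \<otimes>\<^bsub>opposite_ring (hecke n)\<^esub> ?x i"
      using pi_bar_comm[of i n j] by auto
  next
    fix i z assume "i \<in> {1..<n}"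
    then show "?x i \<otimes>\<^bsub>opposite_ring (hecke n)\<^esub> scal n z = scal n z \<otimes>\<^bsub>opposite_ring (hecke n)\<^esub> ?x i"
      unfolding opposite_ring_simps by (intro scal_comm[symmetric]) auto
  next
    fix z w
    show "scal n (z * w) = scal n z \<otimes>\<^bsub>opposite_ring (hecke n)\<^esub> scal n w"
      by (simp add: mult.commute flip: scal_mult)
  qed (simp_all add: scal_add scal_one pi_bar_square del: atLeastLessThan_iff)
  have "hecke_chi n = (THE f. f \<in> extensional (carrier (hecke n)) \<and>
      (f \<in> ring_hom (hecke n) (opposite_ring (hecke n)) \<and> (\<forall>z. f (scal n z) = scal n z) \<and> (\<forall>h\<in>carrier (hecke n). f (f h) = h)) \<and>
      (\<forall>i\<in>{1..<n}. f (pi_bar n i) = ?x i))"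
    unfolding hecke_chi_def algebra_anti_involution_def ..
  note eq = this
  have inv: "f (?x i) = pi_bar n i" if "f \<in> ring_hom (hecke n) (opposite_ring (hecke n))"
    "\<forall>z. f (scal n z) = scal n z" "\<forall>i\<in>{1..<n}. f (pi_bar n i) = ?x i" "i \<in> {1..<n}" for f i
    using that by (simp del: atLeastLessThan_iff)
  have comp: "f \<circ> f \<in> ring_hom (hecke n) (hecke n)" if "f \<in> ring_hom (hecke n) (opposite_ring (hecke n))" for f
    using that by (auto simp: ring_hom_def Pi_def)
  have inv': "\<forall>f\<in>ring_hom (hecke n) (opposite_ring (hecke n)). (\<forall>z. f (scal n z) = scal n z) \<longrightarrow>
      (\<forall>i\<in>{1..<n}. f (pi_bar n i) = ?x i) \<longrightarrow> (\<forall>i\<in>{1..<n}. f (?x i) = pi_bar n i)"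
    using inv by blast
  have comp': "\<forall>f\<in>ring_hom (hecke n) (opposite_ring (hecke n)). f \<circ> f \<in> ring_hom (hecke n) (hecke n)"
    using comp by blast
  note the = hecke_hom_the[where x = ?x, OF opposite_ring_simps(1) rep inv' comp' eq]
  show "hecke_chi n \<in> ring_hom (hecke n) (opposite_ring (hecke n))" "hecke_chi n (scal n z) = scal n z"
    "i \<in> {1..<n} \<Longrightarrow> hecke_chi n (pi_bar n i) = pi_bar n i"
    by (fact the)+
qed

section \<open>Modules on coordinate spaces\<close>

lemma abelian_group_function_space:
  assumes "carrier M = {v :: 'b \<Rightarrow> complex. \<forall>b. b \<notin> B \<longrightarrow> v b = 0}"
    and "\<zero>\<^bsub>M\<^esub> = (\<lambda>b. 0)" and "\<And>v w. v \<oplus>\<^bsub>M\<^esub> w = (\<lambda>b. v b + w b)"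
  shows "abelian_group M"
proof (rule abelian_groupI)
  fix v assume "v \<in> carrier M"
  then show "\<exists>w\<in>carrier M. w \<oplus>\<^bsub>M\<^esub> v = \<zero>\<^bsub>M\<^esub>"
    by (intro bexI[of _ "\<lambda>b. - v b"]) (auto simp: assms)
qed (auto simp: assms algebra_simps)

text \<open>The elements whose action commutes with \<open>f\<close> include the scalars and
  generators and are closed under sums and products.\<close>

lemma rmod_hom_hecke:
  assumes M: "right_module (hecke n) M" and N: "right_module (hecke n) N"
    and f: "\<And>v. v \<in> carrier M \<Longrightarrow> f v \<in> carrier N"
    and add: "\<And>v w. v \<in> carrier M \<Longrightarrow> w \<in> carrier M \<Longrightarrow> f (v \<oplus>\<^bsub>M\<^esub> w) = f v \<oplus>\<^bsub>N\<^esub> f w"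
    and scal: "\<And>v z. v \<in> carrier M \<Longrightarrow> f (ract M v (scal n z)) = ract N (f v) (scal n z)"
    and gen: "\<And>v i. v \<in> carrier M \<Longrightarrow> i \<in> {1..<n} \<Longrightarrow> f (ract M v (pi_bar n i)) = ract N (f v) (pi_bar n i)"
  shows "f \<in> rmod_hom (hecke n) M N"
proof -
  interpret M: right_module "hecke n" M by fact
  interpret N: right_module "hecke n" N by fact
  have "\<forall>v\<in>carrier M. f (ract M v h) = ract N (f v) h" if "h \<in> carrier (hecke n)" for h
    using that
  proof (induction h rule: hecke_induct)
    case (add h k)
    then show ?case by (simp add: M.ract_add_right N.ract_add_right M.ract_closed assms)
  next
    case (mult h k)
    then show ?case by (simp add: M.ract_mult N.ract_mult M.ract_closed assms)
  qed (use scal gen in auto)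
  then show ?thesis
    using f add by (auto simp: rmod_hom_def)
qed

text \<open>Common shape of the poset modules, their twists, the one-dimensional modules and the
  filtration steps below: functions supported in \<open>B\<close> with pointwise addition, on which
  algebra scalars act as complex numbers.\<close>

locale hecke_mod =
  fixes n :: nat and B :: "'b set" and M :: "('b \<Rightarrow> complex) hmod"
  assumes carrier_eq: "carrier M = {v. \<forall>b. b \<notin> B \<longrightarrow> v b = 0}"
    and zero_eq: "\<zero>\<^bsub>M\<^esub> = (\<lambda>b. 0)"
    and add_eq: "v \<oplus>\<^bsub>M\<^esub> w = (\<lambda>b. v b + w b)"
    and right_module: "right_module (hecke n) M"
    and ract_scal: "v \<in> carrier M \<Longrightarrow> ract M v (scal n z) = (\<lambda>b. z * v b)"

sublocale hecke_mod \<subseteq> right_module "hecke n" M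
  by (rule right_module)

lemma hecke_modI:
  assumes "carrier M = {v :: 'b \<Rightarrow> complex. \<forall>b. b \<notin> B \<longrightarrow> v b = 0}"
    and "\<zero>\<^bsub>M\<^esub> = (\<lambda>b. 0)" and "\<And>v w. v \<oplus>\<^bsub>M\<^esub> w = (\<lambda>b. v b + w b)"
    and "\<And>v h. v \<in> carrier M \<Longrightarrow> h \<in> carrier (hecke n) \<Longrightarrow> ract M v h \<in> carrier M"
    and "\<And>v w h. v \<in> carrier M \<Longrightarrow> w \<in> carrier M \<Longrightarrow> h \<in> carrier (hecke n) \<Longrightarrow>
      ract M (\<lambda>b. v b + w b) h = (\<lambda>b. ract M v h b + ract M w h b)"
    and "\<And>v h k. v \<in> carrier M \<Longrightarrow> h \<in> carrier (hecke n) \<Longrightarrow> k \<in> carrier (hecke n) \<Longrightarrow>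
      ract M v (h \<oplus>\<^bsub>hecke n\<^esub> k) = (\<lambda>b. ract M v h b + ract M v k b)"
    and "\<And>v h k. v \<in> carrier M \<Longrightarrow> h \<in> carrier (hecke n) \<Longrightarrow> k \<in> carrier (hecke n) \<Longrightarrow>
      ract M v (h \<otimes>\<^bsub>hecke n\<^esub> k) = ract M (ract M v h) k"
    and "\<And>v z. v \<in> carrier M \<Longrightarrow> ract M v (scal n z) = (\<lambda>b. z * v b)"
  shows "hecke_mod n B M"
proof (rule hecke_mod.intro)
  show "right_module (hecke n) M"
  proof (intro right_module.intro right_module_axioms.intro)
    show "ring (hecke n)" by (rule ring_hecke)
    show "abelian_group M" by (rule abelian_group_function_space) fact+
    show "ract M v \<one>\<^bsub>hecke n\<^esub> = v" if "v \<in> carrier M" for v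
      using assms(8)[OF that, of 1] by (simp add: scal_one)
  qed (simp_all add: assms(3-8))
qed fact+

context hecke_mod
begin

lemma basis_vec_mem: "b \<in> B \<Longrightarrow> basis_vec b \<in> carrier M"
  by (auto simp: carrier_eq basis_vec_def)

lemma ract_sum:
  assumes "v \<in> carrier M" "w \<in> carrier M" "h \<in> carrier (hecke n)"
  shows "ract M (\<lambda>b. v b + w b) h = (\<lambda>b. ract M v h b + ract M w h b)"
  using ract_add_left[OF assms] by (simp add: add_eq)

lemma ract_smult:
  assumes "v \<in> carrier M" "h \<in> carrier (hecke n)"
  shows "ract M (\<lambda>b. z * v b) h = (\<lambda>b. z * ract M v h b)"
proof -
  have "ract M (\<lambda>b. z * v b) h = ract M (ract M v (scal n z)) h"
    by (simp add: ract_scal assms)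
  also have "\<dots> = ract M (ract M v h) (scal n z)"
    using assms by (simp add: scal_comm flip: ract_mult)
  finally show ?thesis
    using assms by (simp add: ract_scal ract_closed)
qed

lemma ract_add_elt:
  assumes "v \<in> carrier M" "h \<in> carrier (hecke n)" "k \<in> carrier (hecke n)"
  shows "ract M v (h \<oplus>\<^bsub>hecke n\<^esub> k) = (\<lambda>b. ract M v h b + ract M v k b)"
  using ract_add_right[OF assms] by (simp add: add_eq)

lemma ract_pi_gen:
  assumes "v \<in> carrier M" "i \<in> {1..<n}"
  shows "ract M v (pi_gen n i) = (\<lambda>b. ract M v (pi_bar n i) b + v b)"
  using assms by (simp add: pi_gen_def ract_add_elt ract_one ring.ring_simprules(6)[OF ring_hecke])

end

text \<open>Values are families over an arbitrary type \<open>'c\<close>, so that the same lemma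
  serves operators (\<open>'c = 'b\<close>) and linear functionals
  (\<open>'c = unit\<close>).\<close>

lemma linear_eq_on_basis:
  fixes f g :: "('b \<Rightarrow> complex) \<Rightarrow> 'c \<Rightarrow> complex"
  assumes B: "finite B" and V: "V = {v. \<forall>b. b \<notin> B \<longrightarrow> v b = 0}"
    and f: "\<And>v w. v \<in> V \<Longrightarrow> w \<in> V \<Longrightarrow> f (\<lambda>b. v b + w b) = (\<lambda>c. f v c + f w c)"
      "\<And>v z. v \<in> V \<Longrightarrow> f (\<lambda>b. z * v b) = (\<lambda>c. z * f v c)"
    and g: "\<And>v w. v \<in> V \<Longrightarrow> w \<in> V \<Longrightarrow> g (\<lambda>b. v b + w b) = (\<lambda>c. g v c + g w c)"
      "\<And>v z. v \<in> V \<Longrightarrow> g (\<lambda>b. z * v b) = (\<lambda>c. z * g v c)"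
    and eq: "\<And>b. b \<in> B \<Longrightarrow> f (basis_vec b) = g (basis_vec b)"
    and v: "v \<in> V"
  shows "f v = g v"
proof -
  have bv: "basis_vec b \<in> V" if "b \<in> B" for b
    using that by (auto simp: V basis_vec_def)
  have "f v = g v" if "finite S" "S \<subseteq> B" "\<forall>b. b \<notin> S \<longrightarrow> v b = 0" for S v
    using that
  proof (induction S arbitrary: v)
    case empty
    then have "v = (\<lambda>b. 0)" by auto
    moreover have "f (\<lambda>b. 0) = (\<lambda>c. 0)" "g (\<lambda>b. 0) = (\<lambda>c. 0)"
      using f(2)[of "\<lambda>b. 0" 0] g(2)[of "\<lambda>b. 0" 0] by (auto simp: V)
    ultimately show ?case by simp
  next
    case (insert s S)
    define v' where "v' = v(s := 0)"
    have v: "v = (\<lambda>b. v' b + (v s * basis_vec s b))"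
      by (auto simp: v'_def basis_vec_def)
    have v': "v' \<in> V"
      using insert.prems by (auto simp: v'_def V)
    have s: "basis_vec s \<in> V" "(\<lambda>b. v s * basis_vec s b) \<in> V"
      using insert.prems by (auto simp: V basis_vec_def)
    have "f v' = g v'"
      using insert by (auto simp: v'_def)
    then show ?case
      using insert.prems eq[of s]
      by (subst (1 2) v) (simp add: f g v' s)
  qed
  then show ?thesis using B v by (auto simp: V)
qed

section \<open>Linear operators and the modules they define\<close>

definition lin_op :: "(('b \<Rightarrow> complex) \<Rightarrow> 'b \<Rightarrow> complex) \<Rightarrow> bool"
  where "lin_op T \<longleftrightarrow> (\<forall>v w. T (\<lambda>b. v b + w b) = (\<lambda>b. T v b + T w b)) \<and>
    (\<forall>z v. T (\<lambda>b. z * v b) = (\<lambda>b. z * T v b))"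

text \<open>The product is composition in reverse order, so that right modules are representations.\<close>

definition op_ring :: "(('b \<Rightarrow> complex) \<Rightarrow> 'b \<Rightarrow> complex) ring"
  where "op_ring = \<lparr>carrier = Collect lin_op, monoid.mult = (\<lambda>S T. T \<circ> S), one = id,
    ring.zero = (\<lambda>v b. 0), ring.add = (\<lambda>S T v b. S v b + T v b)\<rparr>"

lemma op_ring_simps [simp]:
  "T \<in> carrier op_ring \<longleftrightarrow> lin_op T" "S \<otimes>\<^bsub>op_ring\<^esub> T = T \<circ> S" "\<one>\<^bsub>op_ring\<^esub> = id"
  "\<zero>\<^bsub>op_ring\<^esub> = (\<lambda>v b. 0)" "S \<oplus>\<^bsub>op_ring\<^esub> T = (\<lambda>v b. S v b + T v b)"
  by (auto simp: op_ring_def)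

lemma lin_opD:
  assumes "lin_op T"
  shows "T (\<lambda>b. v b + w b) = (\<lambda>b. T v b + T w b)" "T (\<lambda>b. z * v b) = (\<lambda>b. z * T v b)"
  using assms by (auto simp: lin_op_def)

lemma ring_op_ring: "ring (op_ring :: (('b \<Rightarrow> complex) \<Rightarrow> 'b \<Rightarrow> complex) ring)"
proof (rule ringI)
  show "abelian_group (op_ring :: (('b \<Rightarrow> complex) \<Rightarrow> 'b \<Rightarrow> complex) ring)"
  proof (rule abelian_groupI)
    fix T :: "('b \<Rightarrow> complex) \<Rightarrow> 'b \<Rightarrow> complex" assume "T \<in> carrier op_ring"
    then show "\<exists>S\<in>carrier op_ring. S \<oplus>\<^bsub>op_ring\<^esub> T = \<zero>\<^bsub>op_ring\<^esub>"
      by (intro bexI[of _ "\<lambda>v b. - T v b"]) (auto simp: lin_op_def algebra_simps)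
  qed (auto simp: lin_op_def algebra_simps)
  show "Group.monoid (op_ring :: (('b \<Rightarrow> complex) \<Rightarrow> 'b \<Rightarrow> complex) ring)"
    by (rule monoidI) (auto simp: lin_op_def)
qed (auto simp: lin_op_def)

lemma op_ring_a_inv:
  assumes "lin_op T"
  shows "\<ominus>\<^bsub>op_ring\<^esub> T = (\<lambda>v b. - T v b)"
proof -
  have "lin_op (\<lambda>v b. - T v b)"
    using assms by (auto simp: lin_op_def)
  then show ?thesis
    using assms by (intro abelian_group.minus_equality ring.is_abelian_group ring_op_ring) auto
qed

text \<open>The operators act on all functions, not only on those supported in \<open>B\<close>,
  which lets \<open>op_ring\<close> have \<open>id\<close> as its unit. The assumption
  \<open>supp\<close> is what later confines the generated algebra to the coordinate space.\<close>

locale hecke_ops =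
  fixes n :: nat and B :: "'b set" and T :: "nat \<Rightarrow> ('b \<Rightarrow> complex) \<Rightarrow> 'b \<Rightarrow> complex"
  assumes lin: "i \<in> {1..<n} \<Longrightarrow> lin_op (T i)"
    and supp: "i \<in> {1..<n} \<Longrightarrow> b \<notin> B \<Longrightarrow> T i v b = 0"
    and sq: "i \<in> {1..<n} \<Longrightarrow> T i (T i v) = (\<lambda>b. - T i v b)"
    and braid: "i \<in> {1..<n} \<Longrightarrow> i + 1 \<in> {1..<n} \<Longrightarrow>
      T i (T (i + 1) (T i v)) = T (i + 1) (T i (T (i + 1) v))"
    and comm: "i \<in> {1..<n} \<Longrightarrow> j \<in> {1..<n} \<Longrightarrow> i + 2 \<le> j \<Longrightarrow> T i (T j v) = T j (T i v)"

lemma (in hecke_ops) ring_hom_op_ring: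
  "\<exists>F\<in>ring_hom (hecke n) op_ring. (\<forall>z. F (scal n z) = (\<lambda>v b. z * v b)) \<and>
    (\<forall>i\<in>{1..<n}. F (pi_bar n i) = T i)"
proof -
  have "hecke_representation op_ring n (\<lambda>z v b. z * v b) T"
  proof (intro hecke_representation.intro ring_op_ring hecke_representation_axioms.intro)
    fix i assume "i \<in> {1..<n}"
    then show "T i \<otimes>\<^bsub>op_ring\<^esub> T i = \<ominus>\<^bsub>op_ring\<^esub> T i"
      using sq lin by (auto simp: op_ring_a_inv)
  next
    fix i j assume "i \<in> {1..<n}" "j \<in> {1..<n}" "i + 2 \<le> j"
    then have "T i (T j v) = T j (T i v)" for v
      by (rule comm)
    then show "T i \<otimes>\<^bsub>op_ring\<^esub> T j = T j \<otimes>\<^bsub>op_ring\<^esub> T i"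
      by auto
  qed (auto simp: lin_op_def algebra_simps lin_opD[OF lin] fun_eq_iff lin braid[simplified])
  then show ?thesis
    by (rule hecke_representation.hecke_lift_exists)
qed

lemma basis_space_simps [simp]:
  "carrier (basis_space B) = {v. \<forall>b. b \<notin> B \<longrightarrow> v b = 0}" "\<zero>\<^bsub>basis_space B\<^esub> = (\<lambda>b. 0)"
  "v \<oplus>\<^bsub>basis_space B\<^esub> w = (\<lambda>b. v b + w b)"
  by (auto simp: basis_space_def)

text \<open>The identity map is a homomorphism from \<open>M\<close> to \<open>N\<close> as soon as
  it respects the generators.\<close>

lemma hecke_mod_ract_eqI:
  assumes "hecke_mod n B M" "hecke_mod n B N"
    and gen: "\<And>v i. v \<in> carrier M \<Longrightarrow> i \<in> {1..<n} \<Longrightarrow> ract M v (pi_bar n i) = ract N v (pi_bar n i)"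
    and v: "v \<in> carrier M" and h: "h \<in> carrier (hecke n)"
  shows "ract M v h = ract N v h"
proof -
  interpret M: hecke_mod n B M by fact
  interpret N: hecke_mod n B N by fact
  have "id \<in> rmod_hom (hecke n) M N"
    using M.carrier_eq N.carrier_eq
    by (intro rmod_hom_hecke M.right_module N.right_module)
      (auto simp: M.add_eq N.add_eq M.ract_scal N.ract_scal gen)
  then show ?thesis using v h by (auto simp: rmod_hom_def)
qed

text \<open>Justifies the description in \<open>basis_module\<close>. Existence comes from the
  homomorphism into \<open>op_ring\<close>; uniqueness holds because two candidates agree on basis
  vectors, hence on all vectors for each generator, hence for all elements. The two alternatives in
  \<open>A\<close> allow the action to be prescribed through \<open>pi_bar\<close> or through
  \<open>pi_gen\<close>; \<open>T\<close> describes \<open>pi_bar\<close> in both.\<close>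

lemma
  fixes T :: "nat \<Rightarrow> ('b \<Rightarrow> complex) \<Rightarrow> 'b \<Rightarrow> complex"
  assumes B: "finite B" and ops: "hecke_ops n B T"
    and A: "(\<forall>b\<in>B. \<forall>i\<in>{1..<n}. e i = pi_bar n i \<and> A b i = T i (basis_vec b)) \<or>
      (\<forall>b\<in>B. \<forall>i\<in>{1..<n}. e i = pi_gen n i \<and> A b i = (\<lambda>c. T i (basis_vec b) c + basis_vec b c))"
  shows hecke_mod_basis_module: "hecke_mod n B (basis_module n B e A)"
    and ract_basis_module: "\<And>v i. v \<in> carrier (basis_space B) \<Longrightarrow> i \<in> {1..<n} \<Longrightarrow>
      ract (basis_module n B e A) v (pi_bar n i) = T i v"
proof -
  interpret hecke_ops n B T by fact
  let ?M = "\<lambda>a. (basis_space B)\<lparr>ract := a\<rparr>"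
  let ?P = "\<lambda>a. case_prod a \<in> extensional (carrier (basis_space B) \<times> carrier (hecke n)) \<and>
     right_module (hecke n) ((basis_space B)\<lparr>ract := a\<rparr>) \<and>
     (\<forall>v\<in>carrier (basis_space B). \<forall>c. a v (scal n c) = (\<lambda>b. c * v b)) \<and>
     (\<forall>b\<in>B. \<forall>i\<in>{1..<n}. a (basis_vec b) (e i) = A b i)"
  have mod: "hecke_mod n B (?M a)" if "?P a" for a
    using that by (intro hecke_mod.intro) auto
  have gen: "a v (pi_bar n i) = T i v" if a: "?P a" and v: "v \<in> carrier (basis_space B)" and i: "i \<in> {1..<n}" for a v i
  proof (rule linear_eq_on_basis[OF B refl, of "\<lambda>v. a v (pi_bar n i)" "T i"])
    interpret hecke_mod n B "?M a" by (rule mod[OF a])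
    fix b assume b: "b \<in> B"
    show "a (basis_vec b) (pi_bar n i) = T i (basis_vec b)"
      using A
    proof
      assume "\<forall>b\<in>B. \<forall>i\<in>{1..<n}. e i = pi_bar n i \<and> A b i = T i (basis_vec b)"
      then show ?thesis using a b i by metis
    next
      assume "\<forall>b\<in>B. \<forall>i\<in>{1..<n}. e i = pi_gen n i \<and> A b i = (\<lambda>c. T i (basis_vec b) c + basis_vec b c)"
      then have "a (basis_vec b) (pi_gen n i) = (\<lambda>c. T i (basis_vec b) c + basis_vec b c)"
        using a b i by metis
      then show ?thesis
        using ract_pi_gen[of "basis_vec b" i] basis_vec_mem[OF b] i by (auto simp: fun_eq_iff)
    qed
  next
    interpret hecke_mod n B "?M a" by (rule mod[OF a])
    fix v w :: "'b \<Rightarrow> complex" and z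
    assume v: "v \<in> {v. \<forall>b. b \<notin> B \<longrightarrow> v b = 0}"
    show "a (\<lambda>b. z * v b) (pi_bar n i) = (\<lambda>c. z * a v (pi_bar n i) c)"
      using ract_smult[of v "pi_bar n i" z] v i by simp
    assume w: "w \<in> {v. \<forall>b. b \<notin> B \<longrightarrow> v b = 0}"
    show "a (\<lambda>b. v b + w b) (pi_bar n i) = (\<lambda>c. a v (pi_bar n i) c + a w (pi_bar n i) c)"
      using ract_sum[of v w "pi_bar n i"] v w i by simp
  qed (use v lin_opD[OF lin[OF i]] in auto)
  obtain F where F: "F \<in> ring_hom (hecke n) op_ring" "\<And>z. F (scal n z) = (\<lambda>v b. z * v b)"
    "\<And>i. i \<in> {1..<n} \<Longrightarrow> F (pi_bar n i) = T i"
    using ring_hom_op_ring by blast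
  have lin_F: "lin_op (F h)" if "h \<in> carrier (hecke n)" for h
    using ring_hom_closed[OF F(1) that] by simp
  have F_add: "F (h \<oplus>\<^bsub>hecke n\<^esub> k) v = (\<lambda>b. F h v b + F k v b)"
    and F_mult: "F (h \<otimes>\<^bsub>hecke n\<^esub> k) v = F k (F h v)"
    if "h \<in> carrier (hecke n)" "k \<in> carrier (hecke n)" for h k v
    using ring_hom_add[OF F(1) that] ring_hom_mult[OF F(1) that] by auto
  have F_supp: "\<forall>v. (\<forall>b. b \<notin> B \<longrightarrow> v b = 0) \<longrightarrow> (\<forall>b. b \<notin> B \<longrightarrow> F h v b = 0)" if "h \<in> carrier (hecke n)" for h
    using that
  proof (induction h rule: hecke_induct)
    case (scal c)
    then show ?case by (auto simp: F(2))
  next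
    case (gen i)
    then show ?case by (auto simp: F(3) supp)
  next
    case (add h k)
    then show ?case by (simp add: F_add)
  next
    case (mult h k)
    then show ?case by (simp add: F_mult)
  qed
  \<comment> \<open>The value \<open>undefined\<close> off the carriers is what extensionality of
    \<open>case_prod a\<close> demands.\<close>
  define a where "a v h = (if v \<in> carrier (basis_space B) \<and> h \<in> carrier (hecke n) then F h v else undefined)" for v h
  have mod_a: "hecke_mod n B (?M a)"
  proof (rule hecke_modI)
    fix v h assume "v \<in> carrier (?M a)" "h \<in> carrier (hecke n)"
    then show "ract (?M a) v h \<in> carrier (?M a)"
      using F_supp by (auto simp: a_def)
  next
    fix v w h assume "v \<in> carrier (?M a)" "w \<in> carrier (?M a)" "h \<in> carrier (hecke n)"
    then show "ract (?M a) (\<lambda>b. v b + w b) h = (\<lambda>b. ract (?M a) v h b + ract (?M a) w h b)"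
      using lin_opD[OF lin_F] by (auto simp: a_def)
  next
    fix v h k assume v: "v \<in> carrier (?M a)" and hk: "h \<in> carrier (hecke n)" "k \<in> carrier (hecke n)"
    note cl = ring.ring_simprules(1,5)[OF ring_hecke, OF hk]
    show "ract (?M a) v (h \<oplus>\<^bsub>hecke n\<^esub> k) = (\<lambda>b. ract (?M a) v h b + ract (?M a) v k b)"
      using v hk cl by (simp add: a_def F_add)
    show "ract (?M a) v (h \<otimes>\<^bsub>hecke n\<^esub> k) = ract (?M a) (ract (?M a) v h) k"
      using v hk cl F_supp by (simp add: a_def F_mult)
  qed (auto simp: a_def F(2))
  have bv: "basis_vec b \<in> carrier (basis_space B)" if "b \<in> B" for b
    using that by (auto simp: basis_vec_def)
  have a_gen: "a (basis_vec b) (e i) = A b i" if b: "b \<in> B" and i: "i \<in> {1..<n}" for b i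
  proof -
    interpret hecke_mod n B "?M a" by (rule mod_a)
    have 1: "a (basis_vec b) (pi_bar n i) = T i (basis_vec b)"
      using bv[OF b] i by (simp add: a_def F(3))
    have "a (basis_vec b) (pi_gen n i) = (\<lambda>c. T i (basis_vec b) c + basis_vec b c)"
      using ract_pi_gen[of "basis_vec b" i] basis_vec_mem[OF b] i 1 by simp
    then show ?thesis using 1 A b i by metis
  qed
  have Pa: "?P a"
  proof (intro conjI)
    show "right_module (hecke n) (?M a)"
      using mod_a by (rule hecke_mod.right_module)
    show "case_prod a \<in> extensional (carrier (basis_space B) \<times> carrier (hecke n))"
      by (auto simp: a_def extensional_def)
  qed (use a_gen in \<open>auto simp: a_def F(2)\<close>)
  have uniq: "a' = a" if a': "?P a'" for a'
  proof -
    have "a' v h = a v h" for v h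
    proof (cases "v \<in> carrier (basis_space B) \<and> h \<in> carrier (hecke n)")
      case True
      then show ?thesis
        using hecke_mod_ract_eqI[OF mod[OF a'] mod_a, of v h] gen[OF a'] gen[OF Pa] by simp
    next
      case False
      then show ?thesis
        using extensional_arb[OF conjunct1[OF a'], of "(v, h)"] extensional_arb[OF conjunct1[OF Pa], of "(v, h)"] by auto
    qed
    then show ?thesis by blast
  qed
  have eq: "basis_module n B e A = ?M a"
    unfolding basis_module_def using Pa uniq by (intro arg_cong[of _ _ ?M] the_equality) blast+
  show "hecke_mod n B (basis_module n B e A)"
    unfolding eq by (rule mod_a)
  show "\<And>v i. v \<in> carrier (basis_space B) \<Longrightarrow> i \<in> {1..<n} \<Longrightarrow>
      ract (basis_module n B e A) v (pi_bar n i) = T i v"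
    unfolding eq using gen[OF Pa] by simp
qed

lemma rmod_isoI:
  assumes M: "right_module (hecke n) M" and N: "right_module (hecke n) N"
    and f: "f \<in> rmod_hom (hecke n) M N" and "bij_betw f (carrier M) (carrier N)"
  shows "rmod_iso (hecke n) M N"
  using assms by (auto simp: rmod_iso_def)

lemma hecke_mod_twist:
  assumes "hecke_mod n B M" and \<mu>: "\<mu> \<in> ring_hom (hecke n) (hecke n)" "\<And>z. \<mu> (scal n z) = scal n z"
  shows "hecke_mod n B (twist \<mu> M)"
proof -
  interpret hecke_mod n B M by fact
  show ?thesis
    by (rule hecke_modI)
      (auto simp: twist_def carrier_eq[symmetric] zero_eq add_eq ract_sum ract_scal \<mu>(2) ract_add_elt ract_mult ract_closed
        ring_hom_closed[OF \<mu>(1)] ring_hom_add[OF \<mu>(1)] ring_hom_mult[OF \<mu>(1)])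
qed

text \<open>The dual of a right module is naturally a left module, and an anti-homomorphism turns it
  back: acting on \<delta> by h and then by k evaluates \<delta> at v \<nu>(k) \<nu>(h) = v
  \<nu>(hk).\<close>

lemma right_module_dual_twist:
  assumes "hecke_mod n B M"
    and \<nu>: "\<nu> \<in> ring_hom (hecke n) (opposite_ring (hecke n))" "\<And>z. \<nu> (scal n z) = scal n z"
  shows "right_module (hecke n) (dual_twist n \<nu> M)"
proof -
  interpret hecke_mod n B M by fact
  have \<nu>_closed: "\<nu> h \<in> carrier (hecke n)" if "h \<in> carrier (hecke n)" for h
    using ring_hom_closed[OF \<nu>(1) that] by simp
  have \<nu>_one: "\<nu> \<one>\<^bsub>hecke n\<^esub> = \<one>\<^bsub>hecke n\<^esub>"
    using ring_hom_one[OF \<nu>(1)] by simp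
  let ?D = "dual_twist n \<nu> M"
  have sum_mem: "(\<lambda>b. v b + w b) \<in> carrier M" if "v \<in> carrier M" "w \<in> carrier M" for v w
    using that by (auto simp: carrier_eq)
  have smult_mem: "(\<lambda>b. z * v b) \<in> carrier M" if "v \<in> carrier M" for v z
    using that by (auto simp: carrier_eq)
  have D: "\<delta> \<in> carrier ?D \<longleftrightarrow> \<delta> \<in> extensional (carrier M) \<and>
      (\<forall>v\<in>carrier M. \<forall>w\<in>carrier M. \<delta> (\<lambda>b. v b + w b) = \<delta> v + \<delta> w) \<and>
      (\<forall>v\<in>carrier M. \<forall>z. \<delta> (\<lambda>b. z * v b) = z * \<delta> v)" for \<delta>
    by (auto simp: dual_twist_def add_eq ract_scal)
  have add: "\<delta> \<oplus>\<^bsub>?D\<^esub> \<epsilon> = (\<lambda>v\<in>carrier M. \<delta> v + \<epsilon> v)" for \<delta> \<epsilon>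
    by (simp add: dual_twist_def)
  have zero: "\<zero>\<^bsub>?D\<^esub> = (\<lambda>v\<in>carrier M. 0)"
    by (simp add: dual_twist_def)
  have ract: "ract ?D \<delta> h = (\<lambda>v\<in>carrier M. \<delta> (ract M v (\<nu> h)))" for \<delta> h
    by (simp add: dual_twist_def)
  show ?thesis
  proof (intro right_module.intro right_module_axioms.intro ring_hecke)
    show "abelian_group ?D"
    proof (rule abelian_groupI)
      fix \<delta> assume "\<delta> \<in> carrier ?D"
      then show "\<exists>\<epsilon>\<in>carrier ?D. \<epsilon> \<oplus>\<^bsub>?D\<^esub> \<delta> = \<zero>\<^bsub>?D\<^esub>"
        by (intro bexI[of _ "\<lambda>v\<in>carrier M. - \<delta> v"]) (auto simp: D add zero sum_mem smult_mem)
    next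
      fix \<delta> assume "\<delta> \<in> carrier ?D"
      then show "\<zero>\<^bsub>?D\<^esub> \<oplus>\<^bsub>?D\<^esub> \<delta> = \<delta>"
        by (auto simp: D add zero sum_mem smult_mem extensional_def)
    qed (auto simp: D add zero sum_mem smult_mem algebra_simps)
  next
    fix \<delta> h assume "\<delta> \<in> carrier ?D" "h \<in> carrier (hecke n)"
    then show "ract ?D \<delta> h \<in> carrier ?D"
      by (auto simp: D ract sum_mem smult_mem ract_sum ract_smult ract_closed \<nu>_closed)
  next
    fix \<delta> \<epsilon> h assume "\<delta> \<in> carrier ?D" "\<epsilon> \<in> carrier ?D" "h \<in> carrier (hecke n)"
    then show "ract ?D (\<delta> \<oplus>\<^bsub>?D\<^esub> \<epsilon>) h = ract ?D \<delta> h \<oplus>\<^bsub>?D\<^esub> ract ?D \<epsilon> h"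
      by (auto simp: ract add ract_closed \<nu>_closed)
  next
    fix \<delta> h k assume "\<delta> \<in> carrier ?D" "h \<in> carrier (hecke n)" "k \<in> carrier (hecke n)"
    then show "ract ?D \<delta> (h \<oplus>\<^bsub>hecke n\<^esub> k) = ract ?D \<delta> h \<oplus>\<^bsub>?D\<^esub> ract ?D \<delta> k"
      and "ract ?D \<delta> (h \<otimes>\<^bsub>hecke n\<^esub> k) = ract ?D (ract ?D \<delta> h) k"
      using ring_hom_add[OF \<nu>(1), of h k] ring_hom_mult[OF \<nu>(1), of h k]
      by (auto simp: ract add D ract_add_elt ract_mult ract_closed \<nu>_closed)
  next
    fix \<delta> assume "\<delta> \<in> carrier ?D"
    then show "ract ?D \<delta> \<one>\<^bsub>hecke n\<^esub> = \<delta>"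
      by (auto simp: ract D \<nu>_one ract_one extensional_def)
  qed
qed

section \<open>Descents of permutations and linear extensions\<close>

lemma simple_refl_simps [simp]:
  "simple_refl i i = Suc i" "simple_refl i (Suc i) = i" "simple_refl i (Suc (Suc i)) = Suc (Suc i)"
  "simple_refl (Suc i) i = i" "k \<noteq> i \<Longrightarrow> k \<noteq> Suc i \<Longrightarrow> simple_refl i k = k"
  by (auto simp: simple_refl_def transpose_def)

lemma simple_refl_involutive [simp]: "simple_refl i (simple_refl i k) = k"
  by (simp add: simple_refl_def)

lemma comp_simple_refl_comp [simp]: "\<sigma> \<circ> simple_refl i \<circ> simple_refl i = \<sigma>"
  by (auto simp: fun_eq_iff)

lemma simple_refl_eq_iff [simp]: "simple_refl i a = simple_refl i b \<longleftrightarrow> a = b"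
  by (metis simple_refl_involutive)

lemma simple_refl_permutes: "i \<in> {1..<n} \<Longrightarrow> simple_refl i permutes {1..n}"
  unfolding simple_refl_def by (rule permutes_swap_id) auto

lemma permutes_comp_simple_refl: "\<sigma> permutes {1..n} \<Longrightarrow> i \<in> {1..<n} \<Longrightarrow> \<sigma> \<circ> simple_refl i permutes {1..n}"
  by (rule permutes_compose[OF simple_refl_permutes])

lemma simple_refl_less:
  assumes "a < b" "\<not> (a = i \<and> b = Suc i)"
  shows "simple_refl i a < simple_refl i b"
  using assms by (auto simp: simple_refl_def transpose_def)

section \<open>Length as number of inversions\<close>

definition inversions :: "nat \<Rightarrow> (nat \<Rightarrow> nat) \<Rightarrow> (nat \<times> nat) set"
  where "inversions n \<sigma> = {(i, j). i \<in> {1..n} \<and> j \<in> {1..n} \<and> i < j \<and> \<sigma> j < \<sigma> i}"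

lemma finite_inversions: "finite (inversions n \<sigma>)"
  by (rule finite_subset[of _ "{1..n} \<times> {1..n}"]) (auto simp: inversions_def)

text \<open>The reflection keeps the order of every pair of positions except (i, i+1). Applied to
  both components it carries the old inversions injectively to new ones, and (i, i+1) is the only
  inversion that is added.\<close>

lemma card_inversions_ascent:
  assumes i: "i \<in> {1..<n}" and asc: "\<sigma> i < \<sigma> (Suc i)"
  shows "card (inversions n (\<sigma> \<circ> simple_refl i)) = Suc (card (inversions n \<sigma>))"
proof -
  let ?s = "simple_refl i" and ?f = "map_prod (simple_refl i) (simple_refl i)"
  have mem: "?s a \<in> {1..n} \<longleftrightarrow> a \<in> {1..n}" for a
    using permutes_in_image[OF simple_refl_permutes[OF i]] .
  have "inversions n (\<sigma> \<circ> ?s) = insert (i, Suc i) (?f ` inversions n \<sigma>)"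
  proof (intro equalityI subsetI)
    fix p assume p: "p \<in> inversions n (\<sigma> \<circ> ?s)"
    obtain a b where ab: "p = (a, b)" by (cases p)
    show "p \<in> insert (i, Suc i) (?f ` inversions n \<sigma>)"
    proof (cases "p = (i, Suc i)")
      case False
      then have "?f p \<in> inversions n \<sigma>"
        using p simple_refl_less[of a b i] mem by (auto simp: inversions_def ab simp del: atLeastAtMost_iff)
      moreover have "p = ?f (?f p)"
        by (simp add: ab)
      ultimately show ?thesis by blast
    qed simp
  next
    fix p assume p: "p \<in> insert (i, Suc i) (?f ` inversions n \<sigma>)"
    have "?f (a, b) \<in> inversions n (\<sigma> \<circ> ?s)" if ab: "(a, b) \<in> inversions n \<sigma>" for a b
    proof -
      have "?s a < ?s b"
        using ab asc by (intro simple_refl_less) (auto simp: inversions_def)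
      then show ?thesis
        using ab mem by (auto simp: inversions_def simp del: atLeastAtMost_iff)
    qed
    moreover have "(i, Suc i) \<in> inversions n (\<sigma> \<circ> ?s)"
      using i asc by (auto simp: inversions_def)
    ultimately show "p \<in> inversions n (\<sigma> \<circ> ?s)"
      using p by auto
  qed
  moreover have "(i, Suc i) \<notin> ?f ` inversions n \<sigma>"
  proof
    assume "(i, Suc i) \<in> ?f ` inversions n \<sigma>"
    then obtain a b where "(a, b) \<in> inversions n \<sigma>" "i = ?s a" "Suc i = ?s b"
      by auto
    then have "a = Suc i" "b = i"
      by (metis simple_refl_involutive simple_refl_simps(1), metis simple_refl_involutive simple_refl_simps(2))
    with \<open>(a, b) \<in> inversions n \<sigma>\<close> show False by (auto simp: inversions_def)
  qed
  moreover have "card (?f ` inversions n \<sigma>) = card (inversions n \<sigma>)"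
    by (intro card_image) (auto simp: inj_on_def)
  ultimately show ?thesis
    by (simp add: finite_inversions)
qed

lemma card_inversions_descent:
  assumes i: "i \<in> {1..<n}" and "\<sigma> (Suc i) < \<sigma> i"
  shows "card (inversions n \<sigma>) = Suc (card (inversions n (\<sigma> \<circ> simple_refl i)))"
  using card_inversions_ascent[of i n "\<sigma> \<circ> simple_refl i"] assms by simp

lemma permutes_Suc_neq:
  assumes "\<sigma> permutes A"
  shows "\<sigma> i \<noteq> \<sigma> (Suc i)"
  using permutes_inj[OF assms] by (simp add: inj_eq)

text \<open>Starting from a value at least 1, a strictly increasing sequence satisfies i \<le>
  \<sigma> i throughout, and a permutation doing so is trivial.\<close>

lemma id_if_no_descent:
  assumes \<sigma>: "\<sigma> permutes {1..n}" and asc: "\<And>i. i \<in> {1..<n} \<Longrightarrow> \<sigma> i < \<sigma> (Suc i)"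
  shows "\<sigma> = id"
proof (rule permutes_natset_ge[OF \<sigma>], intro ballI)
  fix i assume "i \<in> {1..n}"
  then show "i \<le> \<sigma> i"
  proof (induction i)
    case (Suc i)
    show ?case
    proof (cases "i = 0")
      case True
      then show ?thesis using permutes_in_image[OF \<sigma>, of "Suc i"] Suc.prems by auto
    next
      case False
      then show ?thesis using Suc asc[of i] by auto
    qed
  qed simp
qed

lemma word_product_snoc:
  "foldr (\<circ>) (map simple_refl (w @ [i])) id = foldr (\<circ>) (map simple_refl w) id \<circ> simple_refl i"
  by (induction w) (auto simp: comp_assoc)

lemma inversions_id: "inversions n id = {}"
  by (auto simp: inversions_def)

text \<open>Each further letter raises the number of inversions by at most one. This is the lower
  bound on word lengths.\<close>

lemma card_inversions_le_length:
  assumes "set w \<subseteq> {1..<n}"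
  shows "foldr (\<circ>) (map simple_refl w) id permutes {1..n} \<and>
    card (inversions n (foldr (\<circ>) (map simple_refl w) id)) \<le> length w"
  using assms
proof (induction w rule: rev_induct)
  case Nil
  then show ?case using permutes_id[of "{1..n}"] inversions_id[of n] by (simp add: id_def)
next
  case (snoc i w)
  let ?\<sigma> = "foldr (\<circ>) (map simple_refl w) id"
  have i: "i \<in> {1..<n}" and w: "set w \<subseteq> {1..<n}"
    using snoc.prems by auto
  have IH: "?\<sigma> permutes {1..n}" "card (inversions n ?\<sigma>) \<le> length w"
    using snoc.IH[OF w] by blast+
  have "?\<sigma> i < ?\<sigma> (Suc i) \<or> ?\<sigma> (Suc i) < ?\<sigma> i"
    using permutes_Suc_neq[OF IH(1), of i] by linarith
  then have "card (inversions n (?\<sigma> \<circ> simple_refl i)) \<le> Suc (length w)"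
    using card_inversions_ascent[OF i, of ?\<sigma>] card_inversions_descent[OF i, of ?\<sigma>] IH by auto
  then show ?case
    using permutes_comp_simple_refl[OF IH(1) i] unfolding word_product_snoc length_append_singleton by blast
qed

text \<open>Undoing a descent removes exactly one inversion, so sorting \<sigma> in this way records
  a word that attains the lower bound.\<close>

lemma word_of_length_inversions:
  assumes "\<sigma> permutes {1..n}"
  shows "\<exists>w. length w = card (inversions n \<sigma>) \<and> set w \<subseteq> {1..<n} \<and> \<sigma> = foldr (\<circ>) (map simple_refl w) id"
  using assms
proof (induction "card (inversions n \<sigma>)" arbitrary: \<sigma> rule: less_induct)
  case less
  show ?case
  proof (cases "\<forall>i\<in>{1..<n}. \<sigma> i < \<sigma> (Suc i)")
    case True
    then have "\<sigma> = id" using id_if_no_descent[OF less.prems] by blast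
    then show ?thesis by (intro exI[of _ "[]"]) (simp add: inversions_id)
  next
    case False
    then obtain i where i: "i \<in> {1..<n}" "\<sigma> (Suc i) < \<sigma> i"
      using permutes_Suc_neq[OF less.prems] by (meson linorder_neqE_nat)
    note card = card_inversions_descent[of i n \<sigma>, OF i]
    obtain w where w: "length w = card (inversions n (\<sigma> \<circ> simple_refl i))" "set w \<subseteq> {1..<n}"
      "\<sigma> \<circ> simple_refl i = foldr (\<circ>) (map simple_refl w) id"
      using less.hyps[of "\<sigma> \<circ> simple_refl i"] permutes_comp_simple_refl[OF less.prems i(1)] card by auto
    have "\<sigma> = foldr (\<circ>) (map simple_refl (w @ [i])) id"
      unfolding word_product_snoc w(3)[symmetric] by simp
    then show ?thesis
      using w i card by (intro exI[of _ "w @ [i]"]) auto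
  qed
qed

lemma perm_length_eq_card_inversions:
  assumes "\<sigma> permutes {1..n}"
  shows "perm_length n \<sigma> = card (inversions n \<sigma>)"
  unfolding perm_length_def
proof (rule Least_equality)
  fix k assume "\<exists>w. length w = k \<and> set w \<subseteq> {1..<n} \<and> \<sigma> = foldr (\<circ>) (map simple_refl w) id"
  then show "card (inversions n \<sigma>) \<le> k"
    using card_inversions_le_length by metis
qed (rule word_of_length_inversions[OF assms])

lemma des_right_iff:
  assumes "\<sigma> permutes {1..n}"
  shows "i \<in> des_right n \<sigma> \<longleftrightarrow> i \<in> {1..<n} \<and> \<sigma> (Suc i) < \<sigma> i"
proof (cases "i \<in> {1..<n}")
  case True
  have "perm_length n (\<sigma> \<circ> simple_refl i) < perm_length n \<sigma> \<longleftrightarrow> \<sigma> (Suc i) < \<sigma> i"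
    unfolding perm_length_eq_card_inversions[OF assms]
      perm_length_eq_card_inversions[OF permutes_comp_simple_refl[OF assms True]]
    using card_inversions_ascent[OF True, of \<sigma>] card_inversions_descent[OF True, of \<sigma>] permutes_Suc_neq[OF assms, of i]
    by (cases "\<sigma> i < \<sigma> (Suc i)") auto
  with True show ?thesis
    by (simp add: des_right_def)
qed (auto simp: des_right_def)

section \<open>Permutations as linear extensions, and the operators on them\<close>

lemma Sigma_R_permutes: "\<sigma> \<in> Sigma_R n P \<Longrightarrow> \<sigma> permutes {1..n}"
  by (simp add: Sigma_R_def)

lemma Sigma_R_iff: "\<sigma> \<in> Sigma_R n P \<longleftrightarrow> \<sigma> permutes {1..n} \<and>
    (\<forall>i j. (i, j) \<in> P \<longrightarrow> i \<noteq> j \<longrightarrow> inv_into UNIV \<sigma> i < inv_into UNIV \<sigma> j)"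
  by (auto simp: Sigma_R_def)

lemma finite_Sigma_R: "finite (Sigma_R n P)"
  by (rule finite_subset[OF _ finite_permutations[of "{1..n}"]]) (auto simp: Sigma_R_def)

text \<open>Exchanging two adjacent entries changes no other relative order, so the only relation
  that can break is the one between the two entries.\<close>

lemma comp_simple_refl_in_Sigma_R:
  assumes \<sigma>: "\<sigma> \<in> Sigma_R n P" and i: "i \<in> {1..<n}"
  shows "\<sigma> \<circ> simple_refl i \<in> Sigma_R n P \<longleftrightarrow> (\<sigma> i, \<sigma> (Suc i)) \<notin> P"
proof -
  have p: "\<sigma> permutes {1..n}" by (rule Sigma_R_permutes[OF \<sigma>])
  have inv: "inv_into UNIV (\<sigma> \<circ> simple_refl i) = simple_refl i \<circ> inv_into UNIV \<sigma>"
    using permutes_bij[OF p] by (intro inv_equality) (auto simp: bij_is_inj inv_f_f surj_f_inv_f bij_is_surj)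
  have inv1: "inv_into UNIV \<sigma> (\<sigma> k) = k" for k
    using permutes_inj[OF p] by (simp add: inv_f_f)
  have inv2: "\<sigma> (inv_into UNIV \<sigma> k) = k" for k
    using permutes_surj[OF p] by (simp add: surj_f_inv_f)
  show ?thesis
  proof
    assume l: "\<sigma> \<circ> simple_refl i \<in> Sigma_R n P"
    show "(\<sigma> i, \<sigma> (Suc i)) \<notin> P"
    proof
      assume "(\<sigma> i, \<sigma> (Suc i)) \<in> P"
      then have "(simple_refl i \<circ> inv_into UNIV \<sigma>) (\<sigma> i) < (simple_refl i \<circ> inv_into UNIV \<sigma>) (\<sigma> (Suc i))"
        using l permutes_Suc_neq[OF p, of i] unfolding Sigma_R_iff inv by metis
      then show False by (simp add: inv1)
    qed
  next
    assume r: "(\<sigma> i, \<sigma> (Suc i)) \<notin> P"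
    have "simple_refl i (inv_into UNIV \<sigma> a) < simple_refl i (inv_into UNIV \<sigma> b)"
      if ab: "(a, b) \<in> P" "a \<noteq> b" for a b
    proof (rule simple_refl_less)
      show "inv_into UNIV \<sigma> a < inv_into UNIV \<sigma> b"
        using \<sigma> ab unfolding Sigma_R_iff by metis
      show "\<not> (inv_into UNIV \<sigma> a = i \<and> inv_into UNIV \<sigma> b = Suc i)"
        using r ab inv2 by metis
    qed
    then show "\<sigma> \<circ> simple_refl i \<in> Sigma_R n P"
      using permutes_comp_simple_refl[OF p i] unfolding Sigma_R_iff inv by simp
  qed
qed

definition poset_op :: "nat \<Rightarrow> nat rel \<Rightarrow> nat \<Rightarrow> ((nat \<Rightarrow> nat) \<Rightarrow> complex) \<Rightarrow> (nat \<Rightarrow> nat) \<Rightarrow> complex"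
  where "poset_op n P i v \<sigma> = (if \<sigma> \<in> Sigma_R n P \<and> \<sigma> (Suc i) < \<sigma> i
    then (if \<sigma> \<circ> simple_refl i \<in> Sigma_R n P then v (\<sigma> \<circ> simple_refl i) else 0) - v \<sigma> else 0)"

text \<open>The operator of \<open>pi_bar i = pi_i - 1\<close>. Subtracting the identity cancels the
  diagonal entry 1 of \<open>pi_i\<close> at descents and leaves -1 at ascents, where
  \<open>pi_i\<close> contributes nothing.\<close>

definition bold_poset_op :: "nat \<Rightarrow> nat rel \<Rightarrow> nat \<Rightarrow> ((nat \<Rightarrow> nat) \<Rightarrow> complex) \<Rightarrow> (nat \<Rightarrow> nat) \<Rightarrow> complex"
  where "bold_poset_op n P i v \<sigma> = (if \<sigma> \<in> Sigma_R n P then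
      (if \<sigma> (Suc i) < \<sigma> i then (if \<sigma> \<circ> simple_refl i \<in> Sigma_R n P then v (\<sigma> \<circ> simple_refl i) else 0)
       else - v \<sigma>) else 0)"

lemma braid_simple_refl:
  "\<sigma> \<circ> simple_refl (Suc i) \<circ> simple_refl i \<circ> simple_refl (Suc i) = \<sigma> \<circ> simple_refl i \<circ> simple_refl (Suc i) \<circ> simple_refl i"
  by (auto simp: fun_eq_iff simple_refl_def transpose_def)

lemma commute_simple_refl:
  "i + 2 \<le> j \<Longrightarrow> \<sigma> \<circ> simple_refl j \<circ> simple_refl i = \<sigma> \<circ> simple_refl i \<circ> simple_refl j"
  by (auto simp: fun_eq_iff simple_refl_def transpose_def)

text \<open>Lists the possible orders of the entries in positions i, i+1, i+2, one case for each
  pattern met in the braid relation.\<close>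

lemma three_order_cases:
  fixes x y z :: nat
  assumes "x \<noteq> y" "y \<noteq> z" "x \<noteq> z"
  obtains "x < y" "y < z" "x < z" | "x < z" "z < y" "x < y" | "y < x" "x < z" "y < z"
    | "y < z" "z < x" "y < x" | "z < x" "x < y" "z < y" | "z < y" "y < x" "z < x"
  using assms by linarith

section \<open>The action on poset modules\<close>

text \<open>At a fixed \<sigma>, both sides of a relation depend only on the order of the entries in
  the positions concerned and on which pairs of them lie in \<open>P\<close>, because
  \<open>comp_simple_refl_in_Sigma_R\<close> translates every membership test.\<close>

lemma hecke_ops_poset_op: "hecke_ops n (Sigma_R n P) (poset_op n P)"
proof
  fix i v assume i: "i \<in> {1..<n}"
  show "poset_op n P i (poset_op n P i v) = (\<lambda>\<sigma>. - poset_op n P i v \<sigma>)"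
    by (auto simp: poset_op_def fun_eq_iff)
next
  fix i v assume i: "i \<in> {1..<n}" "i + 1 \<in> {1..<n}"
  have i': "Suc i \<in> {1..<n}" using i by simp
  note mem = comp_simple_refl_in_Sigma_R[OF _ i(1), of _ P] comp_simple_refl_in_Sigma_R[OF _ i', of _ P]
  show "poset_op n P i (poset_op n P (i + 1) (poset_op n P i v)) =
      poset_op n P (i + 1) (poset_op n P i (poset_op n P (i + 1) v))"
  proof
    fix \<sigma>
    show "poset_op n P i (poset_op n P (i + 1) (poset_op n P i v)) \<sigma> =
      poset_op n P (i + 1) (poset_op n P i (poset_op n P (i + 1) v)) \<sigma>"
    proof (cases "\<sigma> \<in> Sigma_R n P")
      case True
      have neq: "\<sigma> i \<noteq> \<sigma> (Suc i)" "\<sigma> (Suc i) \<noteq> \<sigma> (Suc (Suc i))" "\<sigma> i \<noteq> \<sigma> (Suc (Suc i))"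
        using permutes_inj[OF Sigma_R_permutes[OF True]] by (simp_all add: inj_eq)
      \<comment> \<open>Needed when the three entries are decreasing: the two sides then descend to
        the same permutation along the two reduced words of the longest element on three
        positions.\<close>
      have b: "v (\<sigma> \<circ> simple_refl (Suc i) \<circ> simple_refl i \<circ> simple_refl (Suc i)) =
          v (\<sigma> \<circ> simple_refl i \<circ> simple_refl (Suc i) \<circ> simple_refl i)"
        by (simp only: braid_simple_refl)
      from neq show ?thesis
        by (rule three_order_cases; cases "(\<sigma> i, \<sigma> (Suc i)) \<in> P"; cases "(\<sigma> i, \<sigma> (Suc (Suc i))) \<in> P";
          cases "(\<sigma> (Suc i), \<sigma> (Suc (Suc i))) \<in> P";
          simp add: poset_op_def True mem; simp only: b)
    qed (simp add: poset_op_def)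
  qed
next
  fix i j v assume i: "i \<in> {1..<n}" "j \<in> {1..<n}" "i + 2 \<le> j"
  note mem = comp_simple_refl_in_Sigma_R[OF _ i(1), of _ P] comp_simple_refl_in_Sigma_R[OF _ i(2), of _ P]
  show "poset_op n P i (poset_op n P j v) = poset_op n P j (poset_op n P i v)"
  proof
    fix \<sigma>
    have "v (\<sigma> \<circ> simple_refl j \<circ> simple_refl i) = v (\<sigma> \<circ> simple_refl i \<circ> simple_refl j)"
      by (simp only: commute_simple_refl[OF i(3)])
    then show "poset_op n P i (poset_op n P j v) \<sigma> = poset_op n P j (poset_op n P i v) \<sigma>"
      using i(3) by (cases "\<sigma> \<in> Sigma_R n P"; cases "(\<sigma> i, \<sigma> (Suc i)) \<in> P"; cases "(\<sigma> j, \<sigma> (Suc j)) \<in> P")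
          (auto simp: poset_op_def mem)
  qed
qed (auto simp: lin_op_def poset_op_def fun_eq_iff algebra_simps)

lemma hecke_ops_bold_poset_op: "hecke_ops n (Sigma_R n P) (bold_poset_op n P)"
proof
  fix i v assume i: "i \<in> {1..<n}"
  show "bold_poset_op n P i (bold_poset_op n P i v) = (\<lambda>\<sigma>. - bold_poset_op n P i v \<sigma>)"
    by (auto simp: bold_poset_op_def fun_eq_iff)
next
  fix i v assume i: "i \<in> {1..<n}" "i + 1 \<in> {1..<n}"
  have i': "Suc i \<in> {1..<n}" using i by simp
  note mem = comp_simple_refl_in_Sigma_R[OF _ i(1), of _ P] comp_simple_refl_in_Sigma_R[OF _ i', of _ P]
  show "bold_poset_op n P i (bold_poset_op n P (i + 1) (bold_poset_op n P i v)) =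
      bold_poset_op n P (i + 1) (bold_poset_op n P i (bold_poset_op n P (i + 1) v))"
  proof
    fix \<sigma>
    show "bold_poset_op n P i (bold_poset_op n P (i + 1) (bold_poset_op n P i v)) \<sigma> =
      bold_poset_op n P (i + 1) (bold_poset_op n P i (bold_poset_op n P (i + 1) v)) \<sigma>"
    proof (cases "\<sigma> \<in> Sigma_R n P")
      case True
      have neq: "\<sigma> i \<noteq> \<sigma> (Suc i)" "\<sigma> (Suc i) \<noteq> \<sigma> (Suc (Suc i))" "\<sigma> i \<noteq> \<sigma> (Suc (Suc i))"
        using permutes_inj[OF Sigma_R_permutes[OF True]] by (simp_all add: inj_eq)
      have b: "v (\<sigma> \<circ> simple_refl (Suc i) \<circ> simple_refl i \<circ> simple_refl (Suc i)) =
          v (\<sigma> \<circ> simple_refl i \<circ> simple_refl (Suc i) \<circ> simple_refl i)"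
        by (simp only: braid_simple_refl)
      from neq show ?thesis
        by (rule three_order_cases; cases "(\<sigma> i, \<sigma> (Suc i)) \<in> P"; cases "(\<sigma> i, \<sigma> (Suc (Suc i))) \<in> P";
          cases "(\<sigma> (Suc i), \<sigma> (Suc (Suc i))) \<in> P";
          simp add: bold_poset_op_def True mem; simp only: b)
    qed (simp add: bold_poset_op_def)
  qed
next
  fix i j v assume i: "i \<in> {1..<n}" "j \<in> {1..<n}" "i + 2 \<le> j"
  note mem = comp_simple_refl_in_Sigma_R[OF _ i(1), of _ P] comp_simple_refl_in_Sigma_R[OF _ i(2), of _ P]
  show "bold_poset_op n P i (bold_poset_op n P j v) = bold_poset_op n P j (bold_poset_op n P i v)"
  proof
    fix \<sigma>
    have "v (\<sigma> \<circ> simple_refl j \<circ> simple_refl i) = v (\<sigma> \<circ> simple_refl i \<circ> simple_refl j)"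
      by (simp only: commute_simple_refl[OF i(3)])
    then show "bold_poset_op n P i (bold_poset_op n P j v) \<sigma> = bold_poset_op n P j (bold_poset_op n P i v) \<sigma>"
      using i(3) by (cases "\<sigma> \<in> Sigma_R n P"; cases "(\<sigma> i, \<sigma> (Suc i)) \<in> P"; cases "(\<sigma> j, \<sigma> (Suc j)) \<in> P")
          (auto simp: bold_poset_op_def mem)
  qed
qed (auto simp: lin_op_def bold_poset_op_def fun_eq_iff algebra_simps)

lemma poset_op_basis_vec:
  assumes \<gamma>: "\<gamma> \<in> Sigma_R n P" and i: "i \<in> {1..<n}"
  shows "poset_op n P i (basis_vec \<gamma>) =
    (if \<gamma> (Suc i) < \<gamma> i then (\<lambda>\<tau>. - basis_vec \<gamma> \<tau>)
     else if \<gamma> \<circ> simple_refl i \<in> Sigma_R n P then basis_vec (\<gamma> \<circ> simple_refl i) else (\<lambda>\<tau>. 0))"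
proof
  fix \<tau>
  have "(\<tau> \<circ> simple_refl i = \<gamma>) = (\<tau> = \<gamma> \<circ> simple_refl i)"
    by (metis comp_simple_refl_comp)
  moreover have "\<gamma> \<circ> simple_refl i \<noteq> \<gamma>"
    using permutes_Suc_neq[OF Sigma_R_permutes[OF \<gamma>], of i] by (metis comp_apply simple_refl_simps(1))
  ultimately show "poset_op n P i (basis_vec \<gamma>) \<tau> =
    (if \<gamma> (Suc i) < \<gamma> i then (\<lambda>\<tau>. - basis_vec \<gamma> \<tau>)
     else if \<gamma> \<circ> simple_refl i \<in> Sigma_R n P then basis_vec (\<gamma> \<circ> simple_refl i) else (\<lambda>\<tau>. 0)) \<tau>"
    using i \<gamma> permutes_Suc_neq[OF Sigma_R_permutes[OF \<gamma>], of i]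
    by (auto simp: poset_op_def basis_vec_def)
qed

lemma poset_module:
  shows hecke_mod_poset_module: "hecke_mod n (Sigma_R n P) (poset_module n P)"
    and ract_poset_module: "v \<in> carrier (poset_module n P) \<Longrightarrow> i \<in> {1..<n} \<Longrightarrow>
      ract (poset_module n P) v (pi_bar n i) = poset_op n P i v"
proof -
  let ?A = "\<lambda>\<gamma> i. if i \<in> des_right n \<gamma> then (\<lambda>\<tau>. - basis_vec \<gamma> \<tau>)
            else if \<gamma> \<circ> simple_refl i \<in> Sigma_R n P then basis_vec (\<gamma> \<circ> simple_refl i)
            else (\<lambda>\<tau>. 0)"
  have A: "?A \<gamma> i = poset_op n P i (basis_vec \<gamma>)" if \<gamma>: "\<gamma> \<in> Sigma_R n P" and i: "i \<in> {1..<n}" for \<gamma> i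
    using i by (simp add: poset_op_basis_vec[OF \<gamma> i] des_right_iff[OF Sigma_R_permutes[OF \<gamma>]])
  show "hecke_mod n (Sigma_R n P) (poset_module n P)"
    unfolding poset_module_def by (rule hecke_mod_basis_module[OF finite_Sigma_R hecke_ops_poset_op]) (use A in blast)
  then show "v \<in> carrier (poset_module n P) \<Longrightarrow> i \<in> {1..<n} \<Longrightarrow>
      ract (poset_module n P) v (pi_bar n i) = poset_op n P i v"
    unfolding poset_module_def using A
    by (intro ract_basis_module[OF finite_Sigma_R hecke_ops_poset_op]) (auto simp: hecke_mod.carrier_eq)
qed

lemma bold_poset_module:
  shows hecke_mod_bold_poset_module: "hecke_mod n (Sigma_R n P) (bold_poset_module n P)"
    and ract_bold_poset_module: "v \<in> carrier (bold_poset_module n P) \<Longrightarrow> i \<in> {1..<n} \<Longrightarrow>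
      ract (bold_poset_module n P) v (pi_bar n i) = bold_poset_op n P i v"
proof -
  let ?A = "\<lambda>\<gamma> i. if i \<in> des_right n \<gamma> then basis_vec \<gamma>
            else if \<gamma> \<circ> simple_refl i \<in> Sigma_R n P then basis_vec (\<gamma> \<circ> simple_refl i)
            else (\<lambda>\<tau>. 0)"
  have A: "?A \<gamma> i = (\<lambda>\<tau>. bold_poset_op n P i (basis_vec \<gamma>) \<tau> + basis_vec \<gamma> \<tau>)"
    if \<gamma>: "\<gamma> \<in> Sigma_R n P" and i: "i \<in> {1..<n}" for \<gamma> i
  proof
    fix \<tau>
    have "(\<tau> \<circ> simple_refl i = \<gamma>) = (\<tau> = \<gamma> \<circ> simple_refl i)"
      by (metis comp_simple_refl_comp)
    moreover have "\<gamma> \<circ> simple_refl i \<noteq> \<gamma>"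
      using permutes_Suc_neq[OF Sigma_R_permutes[OF \<gamma>], of i] by (metis comp_apply simple_refl_simps(1))
    ultimately show "?A \<gamma> i \<tau> = bold_poset_op n P i (basis_vec \<gamma>) \<tau> + basis_vec \<gamma> \<tau>"
      using i \<gamma> permutes_Suc_neq[OF Sigma_R_permutes[OF \<gamma>], of i]
      by (auto simp: des_right_iff[OF Sigma_R_permutes[OF \<gamma>]] bold_poset_op_def basis_vec_def)
  qed
  show "hecke_mod n (Sigma_R n P) (bold_poset_module n P)"
    unfolding bold_poset_module_def by (rule hecke_mod_basis_module[OF finite_Sigma_R hecke_ops_bold_poset_op]) (use A in blast)
  then show "v \<in> carrier (bold_poset_module n P) \<Longrightarrow> i \<in> {1..<n} \<Longrightarrow>
      ract (bold_poset_module n P) v (pi_bar n i) = bold_poset_op n P i v"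
    unfolding bold_poset_module_def using A
    by (intro ract_basis_module[OF finite_Sigma_R hecke_ops_bold_poset_op]) (auto simp: hecke_mod.carrier_eq)
qed

section \<open>Isomorphisms of twisted poset modules\<close>

text \<open>The longest permutation of [n], fixing everything else so that it is a permutation of
  \<open>{1..n}\<close> and an involution on all of \<open>nat\<close>.\<close>

definition flip :: "nat \<Rightarrow> nat \<Rightarrow> nat"
  where "flip n k = (if k \<in> {1..n} then n + 1 - k else k)"

lemma flip_flip [simp]: "flip n (flip n k) = k"
  by (auto simp: flip_def)

lemma flip_comp_flip [simp]: "flip n \<circ> (flip n \<circ> \<sigma>) = \<sigma>" "\<sigma> \<circ> flip n \<circ> flip n = \<sigma>"
  by (auto simp: fun_eq_iff)

lemma flip_in [simp]: "flip n k \<in> {1..n} \<longleftrightarrow> k \<in> {1..n}"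
  by (auto simp: flip_def)

lemmas flip_in_Suc [simp] = flip_in[unfolded One_nat_def]

lemma flip_eq_iff [simp]: "flip n a = flip n b \<longleftrightarrow> a = b"
  by (metis flip_flip)

lemma flip_less_iff: "a \<in> {1..n} \<Longrightarrow> b \<in> {1..n} \<Longrightarrow> flip n a < flip n b \<longleftrightarrow> b < a"
  by (auto simp: flip_def)

lemma flip_permutes: "flip n permutes {1..n}"
  unfolding permutes_def by (metis flip_def flip_flip)

lemma flip_comp_simple_refl:
  assumes "i \<in> {1..<n}"
  shows "flip n \<circ> simple_refl i = simple_refl (n - i) \<circ> flip n"
  using assms by (auto simp: fun_eq_iff flip_def simple_refl_def transpose_def)

text \<open>Quantifying over positions instead of values removes the inverse permutation.
  Composition with \<open>flip\<close> on either side then becomes a plain substitution.\<close>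

lemma Sigma_R_iff_positions:
  assumes P: "P \<subseteq> {1..n} \<times> {1..n}"
  shows "\<sigma> \<in> Sigma_R n P \<longleftrightarrow> \<sigma> permutes {1..n} \<and>
    (\<forall>k\<in>{1..n}. \<forall>l\<in>{1..n}. (\<sigma> k, \<sigma> l) \<in> P \<longrightarrow> k \<noteq> l \<longrightarrow> k < l)"
proof (cases "\<sigma> permutes {1..n}")
  case p: True
  have inv1: "inv_into UNIV \<sigma> (\<sigma> k) = k" for k
    using permutes_inj[OF p] by (simp add: inv_f_f)
  have inv2: "\<sigma> (inv_into UNIV \<sigma> k) = k" for k
    using permutes_surj[OF p] by (simp add: surj_f_inv_f)
  have mem: "inv_into UNIV \<sigma> k \<in> {1..n} \<longleftrightarrow> k \<in> {1..n}" for k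
    using permutes_in_image[OF permutes_inv[OF p]] .
  show ?thesis
  proof
    assume "\<sigma> \<in> Sigma_R n P"
    then show "\<sigma> permutes {1..n} \<and> (\<forall>k\<in>{1..n}. \<forall>l\<in>{1..n}. (\<sigma> k, \<sigma> l) \<in> P \<longrightarrow> k \<noteq> l \<longrightarrow> k < l)"
      unfolding Sigma_R_iff by (metis inv1)
  next
    assume r: "\<sigma> permutes {1..n} \<and> (\<forall>k\<in>{1..n}. \<forall>l\<in>{1..n}. (\<sigma> k, \<sigma> l) \<in> P \<longrightarrow> k \<noteq> l \<longrightarrow> k < l)"
    have "inv_into UNIV \<sigma> i < inv_into UNIV \<sigma> j" if "(i, j) \<in> P" "i \<noteq> j" for i j
    proof -
      have "i \<in> {1..n}" "j \<in> {1..n}" using that P by auto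
      then show ?thesis using r that inv2 mem by metis
    qed
    with p show "\<sigma> \<in> Sigma_R n P" unfolding Sigma_R_iff by blast
  qed
qed (simp add: Sigma_R_iff)

lemma poset_bar_flip_iff:
  "(a, b) \<in> poset_bar n P \<longleftrightarrow> a \<in> {1..n} \<and> b \<in> {1..n} \<and> (flip n a, flip n b) \<in> P"
  by (auto simp: poset_bar_def flip_def)

lemma flip_conj_permutes: "\<sigma> permutes {1..n} \<Longrightarrow> flip n \<circ> \<sigma> \<circ> flip n permutes {1..n}"
  by (intro permutes_compose flip_permutes)

text \<open>The left \<open>flip\<close> relabels values, which produces the bar; the right one
  reverses positions, which produces the converse. Conjugation being an involution, two implications
  suffice.\<close>

lemma flip_conj_in_Sigma_R:
  assumes P: "P \<subseteq> {1..n} \<times> {1..n}"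
  shows "flip n \<circ> \<sigma> \<circ> flip n \<in> Sigma_R n P \<longleftrightarrow> \<sigma> \<in> Sigma_R n ((poset_bar n P)\<inverse>)"
proof -
  have "flip n \<circ> \<tau> \<circ> flip n \<in> Sigma_R n P" if \<tau>: "\<tau> \<in> Sigma_R n ((poset_bar n P)\<inverse>)" for \<tau>
  proof -
    have P': "(poset_bar n P)\<inverse> \<subseteq> {1..n} \<times> {1..n}" by (auto simp: poset_bar_def)
    have p: "\<tau> permutes {1..n}" by (rule Sigma_R_permutes[OF \<tau>])
    have "k < l" if kl: "k \<in> {1..n}" "l \<in> {1..n}" "(flip n (\<tau> (flip n k)), flip n (\<tau> (flip n l))) \<in> P" "k \<noteq> l" for k l
    proof -
      have "(\<tau> (flip n l), \<tau> (flip n k)) \<in> (poset_bar n P)\<inverse>"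
        using kl permutes_in_image[OF p] by (simp add: poset_bar_flip_iff del: atLeastAtMost_iff)
      then have "flip n l < flip n k"
        using \<tau> kl unfolding Sigma_R_iff_positions[OF P'] by (metis flip_in flip_eq_iff)
      then show ?thesis using kl by (simp add: flip_less_iff del: atLeastAtMost_iff)
    qed
    then show ?thesis
      unfolding Sigma_R_iff_positions[OF P] using flip_conj_permutes[OF p] by simp
  qed
  moreover have "flip n \<circ> \<tau> \<circ> flip n \<in> Sigma_R n ((poset_bar n P)\<inverse>)" if \<tau>: "\<tau> \<in> Sigma_R n P" for \<tau>
  proof -
    have P': "(poset_bar n P)\<inverse> \<subseteq> {1..n} \<times> {1..n}" by (auto simp: poset_bar_def)
    have p: "\<tau> permutes {1..n}" by (rule Sigma_R_permutes[OF \<tau>])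
    have "k < l" if kl: "k \<in> {1..n}" "l \<in> {1..n}"
      "(flip n (\<tau> (flip n k)), flip n (\<tau> (flip n l))) \<in> (poset_bar n P)\<inverse>" "k \<noteq> l" for k l
    proof -
      have "(\<tau> (flip n l), \<tau> (flip n k)) \<in> P"
        using kl by (simp add: poset_bar_flip_iff)
      then have "flip n l < flip n k"
        using \<tau> kl unfolding Sigma_R_iff_positions[OF P] by (metis flip_in flip_eq_iff)
      then show ?thesis using kl by (simp add: flip_less_iff del: atLeastAtMost_iff)
    qed
    then show ?thesis
      unfolding Sigma_R_iff_positions[OF P'] using flip_conj_permutes[OF p] by simp
  qed
  moreover have "flip n \<circ> (flip n \<circ> \<sigma> \<circ> flip n) \<circ> flip n = \<sigma>"
    by (auto simp: fun_eq_iff)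
  ultimately show ?thesis by metis
qed

text \<open>Only values are relabelled and positions stay in place, so the bar appears without the
  converse.\<close>

lemma flip_comp_in_Sigma_R:
  assumes P: "P \<subseteq> {1..n} \<times> {1..n}"
  shows "flip n \<circ> \<sigma> \<in> Sigma_R n P \<longleftrightarrow> \<sigma> \<in> Sigma_R n (poset_bar n P)"
proof -
  have P': "poset_bar n P \<subseteq> {1..n} \<times> {1..n}" by (auto simp: poset_bar_def)
  have p: "flip n \<circ> \<sigma> permutes {1..n} \<longleftrightarrow> \<sigma> permutes {1..n}"
    using permutes_compose[OF _ flip_permutes, of \<sigma> n] permutes_compose[OF _ flip_permutes, of "flip n \<circ> \<sigma>" n]
    by auto
  show ?thesis
    unfolding Sigma_R_iff_positions[OF P] Sigma_R_iff_positions[OF P'] p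
    using permutes_in_image[of \<sigma> "{1..n}"]
    by (auto simp: poset_bar_flip_iff simp del: atLeastAtMost_iff)
qed

lemma (in hecke_mod) ract_a_inv:
  assumes v: "v \<in> carrier M" and h: "h \<in> carrier (hecke n)"
  shows "ract M v (\<ominus>\<^bsub>hecke n\<^esub> h) = (\<lambda>b. - ract M v h b)"
proof -
  \<comment> \<open>An element of a group that equals its own double is zero; this identifies the
    zero of the quotient with a scalar, whose action is known.\<close>
  have "scal n 0 \<oplus>\<^bsub>hecke n\<^esub> scal n 0 = scal n 0"
    by (simp flip: scal_add)
  then have "\<zero>\<^bsub>hecke n\<^esub> = scal n 0"
    using R.add.l_cancel_one[of "scal n 0" "scal n 0"] by simp
  then have "ract M v (\<ominus>\<^bsub>hecke n\<^esub> h \<oplus>\<^bsub>hecke n\<^esub> h) = (\<lambda>b. 0)"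
    using h v by (simp add: R.l_neg ract_scal)
  then show ?thesis
    using h v by (simp add: ract_add_elt fun_eq_iff add_eq_0_iff2)
qed

lemma twist_simps [simp]:
  "carrier (twist \<mu> M) = carrier M" "ract (twist \<mu> M) v h = ract M v (\<mu> h)"
  by (auto simp: twist_def)

text \<open>Conjugation by \<open>flip\<close> turns right multiplication by s_(n-i) into that by
  s_i and moves a descent at n-i to one at i. Substituting the conjugate into coordinate functions
  therefore intertwines the two operators, with the same formula as inverse.\<close>

lemma phi_poset_module_iso:
  assumes P: "P \<subseteq> {1..n} \<times> {1..n}"
  shows "rmod_iso (hecke n) (twist (hecke_phi n) (poset_module n P)) (poset_module n ((poset_bar n P)\<inverse>))"
    (is "rmod_iso _ ?M ?N")
proof -
  interpret M0: hecke_mod n "Sigma_R n P" "poset_module n P" by (rule hecke_mod_poset_module)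
  interpret M: hecke_mod n "Sigma_R n P" ?M
    by (rule hecke_mod_twist[OF hecke_mod_poset_module hecke_phi_hom hecke_phi_scal])
  interpret N: hecke_mod n "Sigma_R n ((poset_bar n P)\<inverse>)" ?N by (rule hecke_mod_poset_module)
  define f :: "((nat \<Rightarrow> nat) \<Rightarrow> complex) \<Rightarrow> (nat \<Rightarrow> nat) \<Rightarrow> complex"
    where "f v = (\<lambda>\<tau>. v (flip n \<circ> \<tau> \<circ> flip n))" for v
  have ff: "f (f v) = v" for v
  proof
    fix \<tau>
    have "flip n \<circ> (flip n \<circ> \<tau> \<circ> flip n) \<circ> flip n = \<tau>" by (auto simp: fun_eq_iff)
    then show "f (f v) \<tau> = v \<tau>" by (simp add: f_def)
  qed
  have f_MN: "f v \<in> carrier ?N" if "v \<in> carrier ?M" for v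
    using that by (auto simp: M0.carrier_eq N.carrier_eq f_def flip_conj_in_Sigma_R[OF P])
  have f_NM: "f v \<in> carrier ?M" if "v \<in> carrier ?N" for v
  proof -
    have "f v \<sigma> = 0" if \<sigma>: "\<sigma> \<notin> Sigma_R n P" for \<sigma>
    proof -
      have "flip n \<circ> (flip n \<circ> \<sigma> \<circ> flip n) \<circ> flip n = \<sigma>" by (auto simp: fun_eq_iff)
      then have "flip n \<circ> \<sigma> \<circ> flip n \<notin> Sigma_R n ((poset_bar n P)\<inverse>)"
        using \<sigma> flip_conj_in_Sigma_R[OF P, of "flip n \<circ> \<sigma> \<circ> flip n"] by metis
      then show ?thesis using \<open>v \<in> carrier ?N\<close> by (simp add: N.carrier_eq f_def)
    qed
    then show ?thesis by (simp add: M0.carrier_eq)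
  qed
  have gen: "f (poset_op n P (n - i) v) = poset_op n ((poset_bar n P)\<inverse>) i (f v)" if i: "i \<in> {1..<n}" for v i
  proof
    fix \<tau>
    have "flip n (Suc (n - i)) = i" "flip n (n - i) = Suc i"
      using i by (auto simp: flip_def)
    moreover have "flip n \<circ> simple_refl (n - i) = simple_refl i \<circ> flip n"
      using flip_comp_simple_refl[of "n - i" n] i by auto
    then have "flip n \<circ> \<tau> \<circ> flip n \<circ> simple_refl (n - i) = flip n \<circ> (\<tau> \<circ> simple_refl i) \<circ> flip n"
      by (simp add: comp_assoc)
    moreover have "flip n (\<tau> i) < flip n (\<tau> (Suc i)) \<longleftrightarrow> \<tau> (Suc i) < \<tau> i" if "\<tau> permutes {1..n}"
      using permutes_in_image[OF that, of i] permutes_in_image[OF that, of "Suc i"] i by (intro flip_less_iff) auto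
    ultimately show "f (poset_op n P (n - i) v) \<tau> = poset_op n ((poset_bar n P)\<inverse>) i (f v) \<tau>"
      using Sigma_R_permutes[of \<tau> n] by (auto simp: f_def poset_op_def flip_conj_in_Sigma_R[OF P])
  qed
  have "f \<in> rmod_hom (hecke n) ?M ?N"
  proof (rule rmod_hom_hecke[OF M.right_module N.right_module f_MN])
    fix v i assume v: "v \<in> carrier ?M" and i: "i \<in> {1..<n}"
    have "n - i \<in> {1..<n}" using i by auto
    then show "f (ract ?M v (pi_bar n i)) = ract ?N (f v) (pi_bar n i)"
      using v i f_MN[OF v] by (simp add: hecke_phi_pi_bar ract_poset_module gen del: atLeastLessThan_iff)
  next
    fix v z assume v: "v \<in> carrier ?M"
    show "f (ract ?M v (scal n z)) = ract ?N (f v) (scal n z)"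
      unfolding M.ract_scal[OF v] N.ract_scal[OF f_MN[OF v]] by (simp add: f_def)
  qed (simp_all add: M.add_eq N.add_eq f_def)
  moreover have "bij_betw f (carrier ?M) (carrier ?N)"
    by (rule bij_betw_byWitness[where f' = f]) (use ff f_MN f_NM in auto)
  ultimately show ?thesis
    by (rule rmod_isoI[OF M.right_module N.right_module])
qed

lemma sign_comp_simple_refl:
  assumes "\<sigma> permutes {1..n}"
  shows "sign (\<sigma> \<circ> simple_refl i) = - sign \<sigma>"
  using assms unfolding simple_refl_def
  by (subst sign_compose) (auto simp: sign_swap_id intro: permutation_permutes[THEN iffD2] permutation_swap_id)

text \<open>The image of \<open>pi_bar i\<close> acts by \<open>-(poset_op + id)\<close>. This has
  -1 on the diagonal at ascents, 0 at descents, and off-diagonal entry -1. Since \<sigma> and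
  \<sigma> s_i have opposite signs, multiplying by the sign changes the last entry to 1.\<close>

lemma theta_poset_module_iso:
  "rmod_iso (hecke n) (twist (hecke_theta n) (poset_module n P)) (bold_poset_module n P)"
    (is "rmod_iso _ ?M ?N")
proof -
  interpret M0: hecke_mod n "Sigma_R n P" "poset_module n P" by (rule hecke_mod_poset_module)
  interpret M: hecke_mod n "Sigma_R n P" ?M
    by (rule hecke_mod_twist[OF hecke_mod_poset_module hecke_theta_hom hecke_theta_scal])
  interpret N: hecke_mod n "Sigma_R n P" ?N by (rule hecke_mod_bold_poset_module)
  define f :: "((nat \<Rightarrow> nat) \<Rightarrow> complex) \<Rightarrow> (nat \<Rightarrow> nat) \<Rightarrow> complex"
    where "f v = (\<lambda>\<tau>. of_int (sign \<tau>) * v \<tau>)" for v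
  have ff: "f (f v) = v" for v
    by (auto simp: f_def fun_eq_iff sign_def)
  have f_MN: "f v \<in> carrier ?N" if "v \<in> carrier ?M" for v
    using that by (auto simp: M0.carrier_eq N.carrier_eq f_def)
  have f_NM: "f v \<in> carrier ?M" if "v \<in> carrier ?N" for v
    using that by (auto simp: M0.carrier_eq N.carrier_eq f_def)
  have gen: "f (\<lambda>\<tau>. - (poset_op n P i v \<tau> + v \<tau>)) = bold_poset_op n P i (f v)"
    if v: "v \<in> carrier (poset_module n P)" for v i
  proof
    fix \<tau>
    show "f (\<lambda>\<tau>. - (poset_op n P i v \<tau> + v \<tau>)) \<tau> = bold_poset_op n P i (f v) \<tau>"
      using v sign_comp_simple_refl[OF Sigma_R_permutes, of \<tau> n P i]
      by (auto simp: f_def poset_op_def bold_poset_op_def M0.carrier_eq)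
  qed
  have "f \<in> rmod_hom (hecke n) ?M ?N"
  proof (rule rmod_hom_hecke[OF M.right_module N.right_module f_MN])
    fix v i assume v: "v \<in> carrier ?M" and i: "i \<in> {1..<n}"
    then show "f (ract ?M v (pi_bar n i)) = ract ?N (f v) (pi_bar n i)"
      using f_MN[OF v]
      by (simp add: hecke_theta_pi_bar M0.ract_a_inv M0.ract_pi_gen ract_poset_module ract_bold_poset_module
          gen[symmetric] del: atLeastLessThan_iff)
  next
    fix v z assume v: "v \<in> carrier ?M"
    show "f (ract ?M v (scal n z)) = ract ?N (f v) (scal n z)"
      unfolding M.ract_scal[OF v] N.ract_scal[OF f_MN[OF v]] by (simp add: f_def algebra_simps)
  qed (simp_all add: M.add_eq N.add_eq f_def algebra_simps)
  moreover have "bij_betw f (carrier ?M) (carrier ?N)"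
    by (rule bij_betw_byWitness[where f' = f]) (use ff f_MN f_NM in auto)
  ultimately show ?thesis
    by (rule rmod_isoI[OF M.right_module N.right_module])
qed

text \<open>Evaluating a functional at a basis vector acted upon gives \<open>-\<delta>\<close> at a
  descent of \<gamma> and the value at \<gamma> s_i, or 0, at an ascent. With \<gamma> =
  \<open>flip n \<circ> \<tau>\<close> the ascents of \<gamma> are the descents of \<tau>, and this
  becomes \<open>bold_poset_op\<close>.\<close>

lemma chi_poset_module_iso:
  assumes P: "P \<subseteq> {1..n} \<times> {1..n}"
  shows "rmod_iso (hecke n) (dual_twist n (hecke_chi n) (poset_module n P)) (bold_poset_module n (poset_bar n P))"
    (is "rmod_iso _ ?D ?N")
proof -
  let ?S = "Sigma_R n P" and ?S' = "Sigma_R n (poset_bar n P)"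
  interpret M: hecke_mod n ?S "poset_module n P" by (rule hecke_mod_poset_module)
  interpret N: hecke_mod n ?S' ?N by (rule hecke_mod_bold_poset_module)
  let ?V = "carrier (poset_module n P)"
  have D: "right_module (hecke n) ?D"
    by (rule right_module_dual_twist[OF hecke_mod_poset_module hecke_chi_hom hecke_chi_scal])
  have D_iff: "\<delta> \<in> carrier ?D \<longleftrightarrow> \<delta> \<in> extensional ?V \<and>
      (\<forall>v\<in>?V. \<forall>w\<in>?V. \<delta> (\<lambda>b. v b + w b) = \<delta> v + \<delta> w) \<and> (\<forall>v\<in>?V. \<forall>z. \<delta> (\<lambda>b. z * v b) = z * \<delta> v)" for \<delta>
    by (auto simp: dual_twist_def M.add_eq M.ract_scal)
  have D_add: "\<delta> \<oplus>\<^bsub>?D\<^esub> \<epsilon> = (\<lambda>v\<in>?V. \<delta> v + \<epsilon> v)" for \<delta> \<epsilon>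
    by (simp add: dual_twist_def)
  have D_ract: "ract ?D \<delta> h = (\<lambda>v\<in>?V. \<delta> (ract (poset_module n P) v (hecke_chi n h)))" for \<delta> h
    by (simp add: dual_twist_def)
  have mem: "flip n \<circ> \<tau> \<in> ?S \<longleftrightarrow> \<tau> \<in> ?S'" for \<tau>
    by (rule flip_comp_in_Sigma_R[OF P])
  define f :: "(((nat \<Rightarrow> nat) \<Rightarrow> complex) \<Rightarrow> complex) \<Rightarrow> (nat \<Rightarrow> nat) \<Rightarrow> complex"
    where "f \<delta> = (\<lambda>\<tau>. if \<tau> \<in> ?S' then \<delta> (basis_vec (flip n \<circ> \<tau>)) else 0)" for \<delta>
  \<comment> \<open>The functional with prescribed values on the basis, restricted to the module
    because the dual consists of extensional functions.\<close>
  define g :: "((nat \<Rightarrow> nat) \<Rightarrow> complex) \<Rightarrow> ((nat \<Rightarrow> nat) \<Rightarrow> complex) \<Rightarrow> complex"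
    where "g u = (\<lambda>v\<in>?V. \<Sum>\<gamma>\<in>?S. v \<gamma> * u (flip n \<circ> \<gamma>))" for u
  have bv: "basis_vec (flip n \<circ> \<tau>) \<in> ?V" if "\<tau> \<in> ?S'" for \<tau>
    using that mem by (intro M.basis_vec_mem) simp
  have f_mem: "f \<delta> \<in> carrier ?N" for \<delta>
    by (auto simp: f_def N.carrier_eq)
  have sum_mem: "(\<lambda>b. v b + w b) \<in> ?V" if "v \<in> ?V" "w \<in> ?V" for v w
    using that by (auto simp: M.carrier_eq)
  have smult_mem: "(\<lambda>b. z * v b) \<in> ?V" if "v \<in> ?V" for v z
    using that by (auto simp: M.carrier_eq)
  have g_mem: "g u \<in> carrier ?D" for u
    by (auto simp: g_def D_iff sum_mem smult_mem algebra_simps sum.distrib sum_distrib_left)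
  have \<delta>_neg: "\<delta> (\<lambda>b. - v b) = - \<delta> v" if "\<delta> \<in> carrier ?D" "v \<in> ?V" for \<delta> v
  proof -
    have "\<delta> (\<lambda>b. (- 1) * v b) = (- 1) * \<delta> v"
      using that unfolding D_iff by blast
    then show ?thesis by simp
  qed
  have \<delta>_zero: "\<delta> (\<lambda>b. 0) = 0" if "\<delta> \<in> carrier ?D" for \<delta>
  proof -
    have "(\<lambda>b. 0) \<in> ?V" by (simp add: M.carrier_eq)
    moreover have "\<forall>v\<in>?V. \<forall>z. \<delta> (\<lambda>b. z * v b) = z * \<delta> v"
      using that unfolding D_iff by blast
    ultimately have "\<forall>z. \<delta> (\<lambda>b. z * 0) = z * \<delta> (\<lambda>b. 0)"
      by (rule bspec[rotated])
    then show ?thesis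
      using spec[of _ 0] by (metis mult_zero_left)
  qed
  have "f \<in> rmod_hom (hecke n) ?D ?N"
  proof (rule rmod_hom_hecke[OF D N.right_module f_mem])
    show "f (\<delta> \<oplus>\<^bsub>?D\<^esub> \<epsilon>) = f \<delta> \<oplus>\<^bsub>?N\<^esub> f \<epsilon>" for \<delta> \<epsilon>
      using bv by (auto simp: f_def D_add N.add_eq)
  next
    fix \<delta> z assume \<delta>: "\<delta> \<in> carrier ?D"
    show "f (ract ?D \<delta> (scal n z)) = ract ?N (f \<delta>) (scal n z)"
      unfolding N.ract_scal[OF f_mem]
      using \<delta> bv by (auto simp: f_def D_ract hecke_chi_scal M.ract_scal D_iff)
  next
    fix \<delta> i assume \<delta>: "\<delta> \<in> carrier ?D" and i: "i \<in> {1..<n}"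
    show "f (ract ?D \<delta> (pi_bar n i)) = ract ?N (f \<delta>) (pi_bar n i)"
    proof
      fix \<tau>
      show "f (ract ?D \<delta> (pi_bar n i)) \<tau> = ract ?N (f \<delta>) (pi_bar n i) \<tau>"
      proof (cases "\<tau> \<in> ?S'")
        case True
        then have \<gamma>: "flip n \<circ> \<tau> \<in> ?S" and p: "\<tau> permutes {1..n}"
          using mem Sigma_R_permutes by auto
        have desc: "(flip n \<circ> \<tau>) (Suc i) < (flip n \<circ> \<tau>) i \<longleftrightarrow> \<tau> i < \<tau> (Suc i)"
          using flip_less_iff[of "\<tau> (Suc i)" n "\<tau> i"] permutes_in_image[OF p, of i] permutes_in_image[OF p, of "Suc i"] i
          by auto
        have "f (ract ?D \<delta> (pi_bar n i)) \<tau> = \<delta> (poset_op n P i (basis_vec (flip n \<circ> \<tau>)))"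
          using True bv i by (simp add: f_def D_ract hecke_chi_pi_bar ract_poset_module del: atLeastLessThan_iff)
        also have "\<dots> = bold_poset_op n (poset_bar n P) i (f \<delta>) \<tau>"
          unfolding poset_op_basis_vec[OF \<gamma> i] desc bold_poset_op_def
          using True mem[of "\<tau> \<circ> simple_refl i"] permutes_Suc_neq[OF p, of i] \<delta>_neg[OF \<delta> bv[OF True]] \<delta>_zero[OF \<delta>]
          by (auto simp: f_def comp_assoc)
        finally show ?thesis
          using i f_mem by (simp add: ract_bold_poset_module del: atLeastLessThan_iff)
      next
        case False
        then show ?thesis
          using i f_mem[of \<delta>] by (simp add: f_def[of "ract _ _ _"] ract_bold_poset_module bold_poset_op_def del: atLeastLessThan_iff)
      qed
    qed
  qed
  moreover have "bij_betw f (carrier ?D) (carrier ?N)"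
  proof (rule bij_betw_byWitness[where f' = g])
    show "\<forall>\<delta>\<in>carrier ?D. g (f \<delta>) = \<delta>"
    proof
      fix \<delta> assume \<delta>: "\<delta> \<in> carrier ?D"
      have g\<delta>: "g (f \<delta>) \<in> carrier ?D" by (rule g_mem)
      show "g (f \<delta>) = \<delta>"
      proof (rule extensionalityI)
        show "g (f \<delta>) \<in> extensional ?V" "\<delta> \<in> extensional ?V"
          using \<delta> g\<delta> unfolding D_iff by blast+
        fix v assume v: "v \<in> ?V"
        \<comment> \<open>Functionals are viewed as families over one point, so that agreement on
          the basis suffices.\<close>
        have "(\<lambda>_::unit. g (f \<delta>) v) = (\<lambda>_. \<delta> v)"
        proof (rule linear_eq_on_basis[OF finite_Sigma_R M.carrier_eq, where f = "\<lambda>v _. g (f \<delta>) v" and g = "\<lambda>v _. \<delta> v"])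
          fix \<gamma> assume \<gamma>: "\<gamma> \<in> ?S"
          have "flip n \<circ> \<gamma> \<in> ?S'"
            using \<gamma> mem[of "flip n \<circ> \<gamma>"] by simp
          then have "(\<Sum>\<beta>\<in>?S. basis_vec \<gamma> \<beta> * f \<delta> (flip n \<circ> \<beta>)) = \<delta> (basis_vec \<gamma>)"
            using \<gamma> finite_Sigma_R[of n P] sum.delta[of ?S \<gamma> "\<lambda>\<beta>. f \<delta> (flip n \<circ> \<beta>)"]
            by (simp add: basis_vec_def if_distrib[of "\<lambda>x. x * _"] f_def cong: if_cong)
          then show "(\<lambda>_::unit. g (f \<delta>) (basis_vec \<gamma>)) = (\<lambda>_. \<delta> (basis_vec \<gamma>))"
            using M.basis_vec_mem[OF \<gamma>] by (simp add: g_def)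
        qed (use \<delta> g\<delta> v in \<open>auto simp: D_iff\<close>)
        then show "g (f \<delta>) v = \<delta> v" by metis
      qed
    qed
    show "\<forall>u\<in>carrier ?N. f (g u) = u"
    proof
      fix u assume u: "u \<in> carrier ?N"
      show "f (g u) = u"
      proof
        fix \<tau>
        show "f (g u) \<tau> = u \<tau>"
        proof (cases "\<tau> \<in> ?S'")
          case True
          then have \<gamma>: "flip n \<circ> \<tau> \<in> ?S" using mem by simp
          then have "(\<Sum>\<beta>\<in>?S. basis_vec (flip n \<circ> \<tau>) \<beta> * u (flip n \<circ> \<beta>)) = u \<tau>"
            using finite_Sigma_R[of n P] sum.delta[of ?S "flip n \<circ> \<tau>" "\<lambda>\<beta>. u (flip n \<circ> \<beta>)"]
            by (simp add: basis_vec_def if_distrib[of "\<lambda>x. x * _"] cong: if_cong)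
          then show ?thesis using True bv by (simp add: f_def g_def)
        next
          case False
          then show ?thesis using u by (simp add: f_def N.carrier_eq)
        qed
      qed
    qed
  qed (use f_mem g_mem in auto)
  ultimately show ?thesis
    by (rule rmod_isoI[OF D N.right_module])
qed

section \<open>Compositions and P-partitions\<close>

lemma sum_list_take_in:
  assumes "composition n \<alpha>" "k \<in> {1..<length \<alpha>}"
  shows "sum_list (take k \<alpha>) \<in> {1..<n}"
proof -
  have pos: "0 < sum_list xs" if "xs \<noteq> []" "0 \<notin> set xs" for xs :: "nat list"
    using that by (cases xs) auto
  have "sum_list (take k \<alpha>) + sum_list (drop k \<alpha>) = n"
    using assms by (simp add: composition_def flip: sum_list_append)
  moreover have "0 \<notin> set (take k \<alpha>)" "0 \<notin> set (drop k \<alpha>)"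
    using assms by (auto simp: composition_def dest: in_set_takeD in_set_dropD)
  then have "0 < sum_list (take k \<alpha>)" "0 < sum_list (drop k \<alpha>)"
    using assms(2) by (auto intro!: pos simp del: sum_list_eq_0_iff)
  ultimately show ?thesis by auto
qed

lemma comp_set_subset: "composition n \<alpha> \<Longrightarrow> comp_set \<alpha> \<subseteq> {1..<n}"
  unfolding comp_set_def using sum_list_take_in by blast

lemma comp_set_snoc:
  assumes "\<beta> \<noteq> []"
  shows "comp_set (\<beta> @ [x]) = insert (sum_list \<beta>) (comp_set \<beta>)"
proof -
  have "{1..<length (\<beta> @ [x])} = insert (length \<beta>) {1..<length \<beta>}"
    using assms by (cases \<beta>) auto
  then show ?thesis
    unfolding comp_set_def setcompr_eq_image Collect_mem_eq
    by (simp only: image_insert) auto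
qed

lemma comp_set_small: "comp_set [] = {}" "comp_set [x] = {}" "comp_set ([] @ [x]) = {}"
  by (auto simp: comp_set_def)

lemma composition_snoc: "composition n (\<beta> @ [x]) \<longleftrightarrow> composition (sum_list \<beta>) \<beta> \<and> 0 < x \<and> n = sum_list \<beta> + x"
  by (auto simp: composition_def)

text \<open>Peel off the largest element of \<open>S\<close>: it is the sum of all parts but the
  last, so the last part is \<open>n - Max S\<close>.\<close>

lemma ex_composition:
  assumes "S \<subseteq> {1..<n}"
  shows "\<exists>\<alpha>. composition n \<alpha> \<and> comp_set \<alpha> = S"
  using assms
proof (induction n arbitrary: S rule: less_induct)
  case (less n)
  have fin: "finite S" using less.prems finite_subset by blast
  consider "n = 0" | "n > 0" "S = {}" | "S \<noteq> {}" by blast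
  then show ?case
  proof cases
    case 1
    then show ?thesis using less.prems by (intro exI[of _ "[]"]) (auto simp: composition_def comp_set_small)
  next
    case 2
    then show ?thesis by (intro exI[of _ "[n]"]) (auto simp: composition_def comp_set_small)
  next
    case 3
    let ?m = "Max S"
    have m: "?m \<in> S" using fin 3 by simp
    then have mn: "1 \<le> ?m" "?m < n" using less.prems by auto
    have "S - {?m} \<subseteq> {1..<?m}"
      using less.prems fin by (auto simp: less_le)
    then obtain \<beta> where \<beta>: "composition ?m \<beta>" "comp_set \<beta> = S - {?m}"
      using less.IH[OF mn(2)] by blast
    have "\<beta> \<noteq> []" using \<beta>(1) mn by (auto simp: composition_def)
    then show ?thesis
      using \<beta> mn m by (intro exI[of _ "\<beta> @ [n - ?m]"]) (auto simp: comp_set_snoc composition_def)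
  qed
qed

text \<open>The maximum of the set of partial sums determines the last part, and removing it leaves
  the set of the shorter composition. A composition with one part has to be separated since its set
  is empty.\<close>

lemma composition_unique:
  assumes "composition n \<alpha>" "composition n \<beta>" "comp_set \<alpha> = comp_set \<beta>"
  shows "\<alpha> = \<beta>"
  using assms
proof (induction \<alpha> arbitrary: n \<beta> rule: rev_induct)
  case Nil
  then show ?case by (cases \<beta>) (auto simp: composition_def)
next
  case (snoc x \<alpha>)
  then have "n > 0" by (auto simp: composition_def)
  then obtain \<gamma> y where \<beta>: "\<beta> = \<gamma> @ [y]"
    using snoc.prems(2) by (cases \<beta> rule: rev_cases) (auto simp: composition_def)
  have \<alpha>: "composition (sum_list \<alpha>) \<alpha>" and \<gamma>: "composition (sum_list \<gamma>) \<gamma>"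
    and n: "n = sum_list \<alpha> + x" "n = sum_list \<gamma> + y"
    using snoc.prems by (auto simp: \<beta> composition_snoc)
  have max: "Max (insert (sum_list \<delta>) (comp_set \<delta>)) = sum_list \<delta>" "sum_list \<delta> \<notin> comp_set \<delta>"
    if "composition (sum_list \<delta>) \<delta>" for \<delta>
    using comp_set_subset[OF that] finite_subset[OF comp_set_subset[OF that]] by (auto intro!: Max_eqI)
  consider "\<alpha> = []" "\<gamma> = []" | "\<alpha> = []" "\<gamma> \<noteq> []" | "\<alpha> \<noteq> []" "\<gamma> = []" | "\<alpha> \<noteq> []" "\<gamma> \<noteq> []" by blast
  then show ?case
  proof cases
    case 4
    then have eq: "insert (sum_list \<alpha>) (comp_set \<alpha>) = insert (sum_list \<gamma>) (comp_set \<gamma>)"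
      using snoc.prems(3) by (simp add: \<beta> comp_set_snoc)
    then have s: "sum_list \<alpha> = sum_list \<gamma>"
      using max(1)[OF \<alpha>] max(1)[OF \<gamma>] by metis
    then have "comp_set \<alpha> = comp_set \<gamma>"
      using eq max(2)[OF \<alpha>] max(2)[OF \<gamma>] by (metis insert_ident)
    then have "\<alpha> = \<gamma>" using snoc.IH[OF \<alpha>] \<gamma> s by simp
    then show ?thesis using n by (simp add: \<beta>)
  qed (use snoc.prems(3) n in \<open>auto simp: \<beta> comp_set_snoc comp_set_small simp del: append.simps dest: sym\<close>)
qed

lemma comp_complement:
  assumes "composition n \<alpha>"
  shows "composition n (comp_complement \<alpha>)" "comp_set (comp_complement \<alpha>) = {1..<n} - comp_set \<alpha>"
proof -
  have n: "sum_list \<alpha> = n" using assms by (simp add: composition_def)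
  obtain \<beta> where \<beta>: "composition n \<beta>" "comp_set \<beta> = {1..<n} - comp_set \<alpha>"
    using ex_composition[of "{1..<n} - comp_set \<alpha>" n] by blast
  have "composition n (comp_complement \<alpha>) \<and> comp_set (comp_complement \<alpha>) = {1..<n} - comp_set \<alpha>"
    unfolding comp_complement_def n
    by (rule theI[of _ \<beta>]) (use \<beta> composition_unique in \<open>auto simp del: One_nat_def\<close>)
  then show "composition n (comp_complement \<alpha>)" "comp_set (comp_complement \<alpha>) = {1..<n} - comp_set \<alpha>"
    by auto
qed

text \<open>An initial part of the reversed list is the reversal of a final part, whose sum is n
  minus a partial sum.\<close>

lemma comp_set_rev:
  assumes "composition n \<alpha>"
  shows "comp_set (rev \<alpha>) = (\<lambda>s. n - s) ` comp_set \<alpha>"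
proof -
  have n: "sum_list \<alpha> = n" using assms by (simp add: composition_def)
  have take: "sum_list (take k (rev \<alpha>)) = n - sum_list (take (length \<alpha> - k) \<alpha>)" for k
  proof -
    have "sum_list (take (length \<alpha> - k) \<alpha>) + sum_list (drop (length \<alpha> - k) \<alpha>) = n"
      by (simp add: n flip: sum_list_append)
    then show ?thesis by (simp add: take_rev)
  qed
  have "{1..<length \<alpha>} = (\<lambda>k. length \<alpha> - k) ` {1..<length \<alpha>}"
  proof (intro equalityI subsetI)
    fix k assume "k \<in> {1..<length \<alpha>}"
    then show "k \<in> (\<lambda>k. length \<alpha> - k) ` {1..<length \<alpha>}"
      by (intro image_eqI[of _ _ "length \<alpha> - k"]) auto
  qed auto
  then have "comp_set \<alpha> = (\<lambda>k. sum_list (take (length \<alpha> - k) \<alpha>)) ` {1..<length \<alpha>}"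
    unfolding comp_set_def setcompr_eq_image Collect_mem_eq by (metis (no_types, lifting) image_cong image_image)
  then show ?thesis
    unfolding comp_set_def[of "rev \<alpha>"] setcompr_eq_image Collect_mem_eq by (simp add: take image_image)
qed

text \<open>Fundamental functions indexed by subsets, so that descent sets can be inserted without
  naming the corresponding composition.\<close>

definition fund_series :: "nat \<Rightarrow> nat set \<Rightarrow> series"
  where "fund_series n S = gen_series n {f \<in> {1..n} \<rightarrow>\<^sub>E {1..}. \<forall>j\<in>{1..<n}.
    f j \<le> f (j + 1) \<and> (j \<in> S \<longrightarrow> f j < f (j + 1))}"

lemma fundamental_eq: "composition n \<alpha> \<Longrightarrow> fundamental \<alpha> = fund_series n (comp_set \<alpha>)"
  by (simp add: fundamental_def fund_series_def composition_def)

section \<open>Sorting permutations and P-partitions\<close>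

lemma strict_mono_steps:
  fixes g :: "nat \<Rightarrow> nat"
  assumes step: "\<forall>j\<in>{1..<n}. g j < g (Suc j)" and "1 \<le> j" "j < k" "k \<le> n"
  shows "g j < g k"
  using assms(3,4)
proof (induction k)
  case (Suc k)
  then show ?case
    using step assms(2) by (cases "j = k") (force intro: less_trans)+
qed simp

lemma ex_sorting_permutation:
  fixes key :: "nat \<Rightarrow> nat"
  assumes inj: "inj_on key {1..n}"
  shows "\<exists>\<sigma>. \<sigma> permutes {1..n} \<and> (\<forall>j\<in>{1..<n}. key (\<sigma> j) < key (\<sigma> (Suc j)))"
proof -
  define xs where "xs = sort_key key [1..<Suc n]"
  have len: "length xs = n" and set: "set xs = {1..n}" and dist: "distinct xs"
    by (auto simp: xs_def)
  have "sorted (map key xs)" by (simp add: xs_def)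
  moreover have "distinct (map key xs)"
    using inj dist by (simp add: distinct_map set)
  ultimately have sorted: "sorted_wrt (<) (map key xs)"
    by (simp add: strict_sorted_iff)
  \<comment> \<open>List positions start at 0 and permutations of [n] at 1, hence the shift.\<close>
  define \<sigma> where "\<sigma> j = (if j \<in> {1..n} then xs ! (j - 1) else j)" for j
  have "bij_betw (\<lambda>j. j - 1) {1..n} {..<n}"
    by (rule bij_betw_byWitness[where f' = Suc]) auto
  then have "bij_betw ((\<lambda>j. xs ! j) \<circ> (\<lambda>j. j - 1)) {1..n} {1..n}"
    using bij_betw_nth[OF dist _ set[symmetric], of "{..<n}"] len by (intro bij_betw_trans) auto
  then have "bij_betw \<sigma> {1..n} {1..n}"
    by (rule bij_betw_cong[THEN iffD1, rotated]) (simp add: \<sigma>_def)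
  then have "\<sigma> permutes {1..n}"
    by (rule bij_imp_permutes) (auto simp: \<sigma>_def)
  moreover have "key (\<sigma> j) < key (\<sigma> (Suc j))" if "j \<in> {1..<n}" for j
    using sorted_wrt_nth_less[OF sorted, of "j - 1" j] that by (auto simp: \<sigma>_def len)
  ultimately show ?thesis by blast
qed

text \<open>Both permutations list the set of keys in increasing order, and a finite set has only
  one such list. Injectivity turns equal keys into equal entries.\<close>

lemma sorting_permutation_unique:
  fixes key :: "nat \<Rightarrow> nat"
  assumes inj: "inj_on key {1..n}"
    and \<sigma>: "\<sigma> permutes {1..n}" "\<forall>j\<in>{1..<n}. key (\<sigma> j) < key (\<sigma> (Suc j))"
    and \<tau>: "\<tau> permutes {1..n}" "\<forall>j\<in>{1..<n}. key (\<tau> j) < key (\<tau> (Suc j))"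
  shows "\<sigma> = \<tau>"
proof -
  have list: "sorted (map (key \<circ> \<rho>) [1..<Suc n]) \<and> distinct (map (key \<circ> \<rho>) [1..<Suc n]) \<and>
    set (map (key \<circ> \<rho>) [1..<Suc n]) = key ` {1..n}"
    if \<rho>: "\<rho> permutes {1..n}" "\<forall>j\<in>{1..<n}. key (\<rho> j) < key (\<rho> (Suc j))" for \<rho>
  proof -
    have "sorted_wrt (<) (map (key \<circ> \<rho>) [1..<Suc n])"
      using strict_mono_steps[of n "key \<circ> \<rho>"] \<rho>(2) by (auto simp: sorted_wrt_iff_nth_less simp del: upt_Suc)
    moreover have "set [1..<Suc n] = {1..n}" by auto
    then have "set (map (key \<circ> \<rho>) [1..<Suc n]) = key ` {1..n}"
      using permutes_image[OF \<rho>(1)] by (metis image_comp set_map)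
    ultimately show ?thesis by (simp only: strict_sorted_iff)
  qed
  have "map (key \<circ> \<sigma>) [1..<Suc n] = map (key \<circ> \<tau>) [1..<Suc n]"
    using list[OF \<sigma>] list[OF \<tau>] by (intro sorted_distinct_set_unique) auto
  then have eq: "key (\<sigma> j) = key (\<tau> j)" if "j \<in> {1..n}" for j
    using that by (auto simp del: upt_Suc)
  show ?thesis
  proof
    fix j
    show "\<sigma> j = \<tau> j"
    proof (cases "j \<in> {1..n}")
      case True
      then show ?thesis
        using eq[OF True] inj permutes_in_image[OF \<sigma>(1)] permutes_in_image[OF \<tau>(1)] by (auto dest: inj_onD)
    next
      case False
      then show ?thesis using \<sigma>(1) \<tau>(1) by (simp add: permutes_not_in)
    qed
  qed
qed

text \<open>In terms of \<open>f \<circ> \<sigma>\<close> this is the monotonicity condition of the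
  fundamental function of the descent set of \<sigma>: weak rises, strict at descents.\<close>

definition sorts :: "nat \<Rightarrow> (nat \<Rightarrow> nat) \<Rightarrow> (nat \<Rightarrow> nat) \<Rightarrow> bool"
  where "sorts n \<sigma> f \<longleftrightarrow> (\<forall>j\<in>{1..<n}. f (\<sigma> j) \<le> f (\<sigma> (Suc j)) \<and> (\<sigma> (Suc j) < \<sigma> j \<longrightarrow> f (\<sigma> j) < f (\<sigma> (Suc j))))"

text \<open>Encodes the lexicographic order on the pairs \<open>(f i, i)\<close> with \<open>i \<le> n\<close>.\<close>

definition lex_key :: "nat \<Rightarrow> (nat \<Rightarrow> nat) \<Rightarrow> nat \<Rightarrow> nat"
  where "lex_key n f i = f i * Suc n + i"

lemma lex_key_less_iff:
  assumes "i \<in> {1..n}" "j \<in> {1..n}"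
  shows "lex_key n f i < lex_key n f j \<longleftrightarrow> f i < f j \<or> f i = f j \<and> i < j"
proof -
  have less: "lex_key n f a < lex_key n f b" if "f a < f b" "a \<in> {1..n}" for a b
  proof -
    have "Suc (f a) * Suc n \<le> f b * Suc n"
      using that by (intro mult_right_mono) auto
    then show ?thesis using that by (simp add: lex_key_def)
  qed
  show ?thesis
  proof (cases "f i" "f j" rule: linorder_cases)
    case equal
    then show ?thesis by (simp add: lex_key_def)
  qed (use less[of i j] less[of j i] assms in auto)
qed

lemma inj_on_lex_key: "inj_on (lex_key n f) {1..n}"
proof (rule inj_onI)
  fix i j assume "i \<in> {1..n}" "j \<in> {1..n}" "lex_key n f i = lex_key n f j"
  then show "i = j"
    using lex_key_less_iff[of i n j f] lex_key_less_iff[of j n i f] by (metis less_irrefl linorder_neqE_nat)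
qed

text \<open>For consecutive entries, a tie in \<open>f\<close> is allowed exactly when the entries
  themselves increase, which is how the lexicographic order breaks ties.\<close>

lemma sorts_iff:
  assumes "\<sigma> permutes {1..n}"
  shows "sorts n \<sigma> f \<longleftrightarrow> (\<forall>j\<in>{1..<n}. lex_key n f (\<sigma> j) < lex_key n f (\<sigma> (Suc j)))"
proof -
  have "lex_key n f (\<sigma> j) < lex_key n f (\<sigma> (Suc j)) \<longleftrightarrow>
    f (\<sigma> j) \<le> f (\<sigma> (Suc j)) \<and> (\<sigma> (Suc j) < \<sigma> j \<longrightarrow> f (\<sigma> j) < f (\<sigma> (Suc j)))" if "j \<in> {1..<n}" for j
  proof -
    have "\<sigma> j \<in> {1..n}" "\<sigma> (Suc j) \<in> {1..n}"
      using that permutes_in_image[OF assms, of j] permutes_in_image[OF assms, of "Suc j"] by auto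
    then show ?thesis
      using permutes_Suc_neq[OF assms, of j] by (auto simp: lex_key_less_iff simp del: atLeastAtMost_iff)
  qed
  then show ?thesis unfolding sorts_def by blast
qed

text \<open>For distinct related elements, the P-partition condition, strict where the labels
  decrease, says precisely that the keys increase. So it asks that listing [n] by key respects
  \<open>P\<close>.\<close>

lemma P_partition_iff_sorting_in_Sigma_R:
  assumes P: "P \<subseteq> {1..n} \<times> {1..n}" and f: "f \<in> {1..n} \<rightarrow>\<^sub>E {1..}"
    and \<sigma>: "\<sigma> permutes {1..n}" and sorts: "sorts n \<sigma> f"
  shows "f \<in> P_partitions n P \<longleftrightarrow> \<sigma> \<in> Sigma_R n P"
proof -
  have key: "lex_key n f (\<sigma> k) < lex_key n f (\<sigma> l)" if "k \<in> {1..n}" "l \<in> {1..n}" "k < l" for k l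
    using strict_mono_steps[of n "\<lambda>k. lex_key n f (\<sigma> k)" k l] sorts that unfolding sorts_iff[OF \<sigma>] by auto
  show ?thesis
  proof
    assume fP: "f \<in> P_partitions n P"
    have "k < l" if kl: "k \<in> {1..n}" "l \<in> {1..n}" "(\<sigma> k, \<sigma> l) \<in> P" "k \<noteq> l" for k l
    proof (rule ccontr)
      assume "\<not> k < l"
      then have "lex_key n f (\<sigma> l) < lex_key n f (\<sigma> k)"
        using key kl by auto
      moreover have "\<sigma> k \<in> {1..n}" "\<sigma> l \<in> {1..n}" using kl P by auto
      moreover have "f (\<sigma> k) \<le> f (\<sigma> l) \<and> (\<sigma> k > \<sigma> l \<longrightarrow> f (\<sigma> k) < f (\<sigma> l))"
        using fP kl by (auto simp: P_partitions_def)
      ultimately show False by (auto simp: lex_key_less_iff simp del: atLeastAtMost_iff)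
    qed
    then show "\<sigma> \<in> Sigma_R n P"
      using \<sigma> unfolding Sigma_R_iff_positions[OF P] by blast
  next
    assume \<sigma>P: "\<sigma> \<in> Sigma_R n P"
    have "f a \<le> f b \<and> (a > b \<longrightarrow> f a < f b)" if ab: "(a, b) \<in> P" for a b
    proof (cases "a = b")
      case False
      have mem: "a \<in> {1..n}" "b \<in> {1..n}" using ab P by auto
      obtain k l where kl: "a = \<sigma> k" "b = \<sigma> l" "k \<in> {1..n}" "l \<in> {1..n}"
        using mem permutes_image[OF \<sigma>] by (metis imageE)
      then have "k < l"
        using \<sigma>P ab False unfolding Sigma_R_iff_positions[OF P] by blast
      then show ?thesis
        using key[of k l] kl mem by (auto simp: lex_key_less_iff simp del: atLeastAtMost_iff)
    qed simp
    then show "f \<in> P_partitions n P"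
      using f by (auto simp: P_partitions_def)
  qed
qed

text \<open>Coefficients of \<open>gen_series\<close> are cardinalities, which add up over disjoint
  pieces only when these are finite. Every value of such a map is the index of a variable occurring
  in \<open>m\<close>.\<close>

lemma finite_maps_with_content:
  fixes n :: nat and m :: monomial
  shows "finite {f \<in> {1..n} \<rightarrow>\<^sub>E {1..}. (\<Sum>i\<in>{1..n}. Poly_Mapping.single (f i) (1::nat)) = m}"
proof (rule finite_subset)
  show "finite ({1..n} \<rightarrow>\<^sub>E Poly_Mapping.keys m)" by (intro finite_PiE) auto
  show "{f \<in> {1..n} \<rightarrow>\<^sub>E {1..}. (\<Sum>i\<in>{1..n}. Poly_Mapping.single (f i) (1::nat)) = m} \<subseteq> {1..n} \<rightarrow>\<^sub>E Poly_Mapping.keys m"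
  proof
    fix f assume f: "f \<in> {f \<in> {1..n} \<rightarrow>\<^sub>E {1..}. (\<Sum>i\<in>{1..n}. Poly_Mapping.single (f i) (1::nat)) = m}"
    have "f i \<in> Poly_Mapping.keys m" if "i \<in> {1..n}" for i
    proof -
      have "Poly_Mapping.lookup m (f i) = (\<Sum>j\<in>{1..n}. Poly_Mapping.lookup (Poly_Mapping.single (f j) (1::nat)) (f i))"
        using f by (auto simp: lookup_sum)
      moreover have "Poly_Mapping.lookup (Poly_Mapping.single (f i) (1::nat)) (f i) \<le> (\<Sum>j\<in>{1..n}. Poly_Mapping.lookup (Poly_Mapping.single (f j) (1::nat)) (f i))"
        using that by (intro member_le_sum) auto
      ultimately have "1 \<le> Poly_Mapping.lookup m (f i)"
        by (simp only: lookup_single_eq)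
      then show ?thesis by (simp add: in_keys_iff)
    qed
    then show "f \<in> {1..n} \<rightarrow>\<^sub>E Poly_Mapping.keys m"
      using f by (auto simp: PiE_iff)
  qed
qed

text \<open>The fundamental lemma of P-partitions, proved one coefficient at a time by counting the
  maps with a given monomial according to their sorting permutation.\<close>

lemma K_series_expansion:
  assumes P: "P \<subseteq> {1..n} \<times> {1..n}"
  shows "K_series n P = (\<lambda>m. \<Sum>\<sigma>\<in>Sigma_R n P. fund_series n (des_right n \<sigma>) m)"
proof
  fix m
  define cont where "cont f = (\<Sum>i\<in>{1..n}. Poly_Mapping.single (f i) (1::nat))" for f :: "nat \<Rightarrow> nat"
  let ?X = "\<lambda>\<sigma>. {f \<in> {1..n} \<rightarrow>\<^sub>E {1..}. sorts n \<sigma> f \<and> cont f = m}"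
  let ?Y = "\<lambda>\<sigma>. {f \<in> {1..n} \<rightarrow>\<^sub>E {1..}. (\<forall>j\<in>{1..<n}. f j \<le> f (j + 1) \<and> (j \<in> des_right n \<sigma> \<longrightarrow> f j < f (j + 1))) \<and> cont f = m}"
  have X_eq: "{f \<in> P_partitions n P. cont f = m} = (\<Union>\<sigma>\<in>Sigma_R n P. ?X \<sigma>)"
  proof (intro equalityI subsetI)
    fix f assume f: "f \<in> {f \<in> P_partitions n P. cont f = m}"
    obtain \<sigma> where \<sigma>: "\<sigma> permutes {1..n}" "sorts n \<sigma> f"
      using ex_sorting_permutation[OF inj_on_lex_key[of n f]] sorts_iff by blast
    have "f \<in> {1..n} \<rightarrow>\<^sub>E {1..}" using f by (simp add: P_partitions_def)
    then show "f \<in> (\<Union>\<sigma>\<in>Sigma_R n P. ?X \<sigma>)"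
      using f P_partition_iff_sorting_in_Sigma_R[OF P _ \<sigma>] \<sigma> by blast
  next
    fix f assume "f \<in> (\<Union>\<sigma>\<in>Sigma_R n P. ?X \<sigma>)"
    then obtain \<sigma> where "\<sigma> \<in> Sigma_R n P" "f \<in> {1..n} \<rightarrow>\<^sub>E {1..}" "sorts n \<sigma> f" "cont f = m" by blast
    then show "f \<in> {f \<in> P_partitions n P. cont f = m}"
      using P_partition_iff_sorting_in_Sigma_R[OF P] Sigma_R_permutes by blast
  qed
  have fin: "finite (?X \<sigma>)" for \<sigma>
    by (rule finite_subset[OF _ finite_maps_with_content[of n m]]) (auto simp: cont_def)
  have disj: "?X \<sigma> \<inter> ?X \<tau> = {}" if st: "\<sigma> \<in> Sigma_R n P" "\<tau> \<in> Sigma_R n P" "\<sigma> \<noteq> \<tau>" for \<sigma> \<tau>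
  proof -
    note p = Sigma_R_permutes[OF st(1)] Sigma_R_permutes[OF st(2)]
    have "\<not> (sorts n \<sigma> f \<and> sorts n \<tau> f)" for f
      using sorting_permutation_unique[OF inj_on_lex_key[of n f] p(1) _ p(2)] st(3)
      unfolding sorts_iff[OF p(1)] sorts_iff[OF p(2)] by blast
    then show ?thesis by blast
  qed
  have card: "card (?X \<sigma>) = card (?Y \<sigma>)" if "\<sigma> \<in> Sigma_R n P" for \<sigma>
  \<comment> \<open>Composition with \<sigma> only reorders the factors of the monomial, and it
    turns the maps sorted by \<sigma> into the sequences counted by the fundamental
    function.\<close>
  proof (rule bij_betw_same_card[of "\<lambda>f. f \<circ> \<sigma>"])
    note p = Sigma_R_permutes[OF that]
    note p' = permutes_inv[OF p]
    have cont: "cont (f \<circ> \<rho>) = cont f" if "\<rho> permutes {1..n}" for f \<rho>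
      unfolding cont_def using sum.permute[OF that, of "\<lambda>i. Poly_Mapping.single (f i) (1::nat)"] by (simp add: o_def)
    have ext: "f \<circ> \<rho> \<in> {1..n} \<rightarrow>\<^sub>E {1..}" if f: "f \<in> {1..n} \<rightarrow>\<^sub>E {1..}" and \<rho>: "\<rho> permutes {1..n}" for f \<rho>
      using f permutes_in_image[OF \<rho>] permutes_not_in[OF \<rho>]
      by (auto simp: PiE_iff extensional_def simp del: atLeastAtMost_iff)
    have inv1: "inv_into UNIV \<sigma> \<circ> \<sigma> = id" and inv2: "\<sigma> \<circ> inv_into UNIV \<sigma> = id"
      using permutes_inv_o[OF p] by auto
    have sort: "sorts n \<sigma> f \<longleftrightarrow> (\<forall>j\<in>{1..<n}. (f \<circ> \<sigma>) j \<le> (f \<circ> \<sigma>) (j + 1) \<and>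
        (j \<in> des_right n \<sigma> \<longrightarrow> (f \<circ> \<sigma>) j < (f \<circ> \<sigma>) (j + 1)))" for f
      by (auto simp: sorts_def des_right_iff[OF p])
    show "bij_betw (\<lambda>f. f \<circ> \<sigma>) (?X \<sigma>) (?Y \<sigma>)"
    proof (rule bij_betw_byWitness[where f' = "\<lambda>f. f \<circ> inv_into UNIV \<sigma>"])
      show "(\<lambda>f. f \<circ> \<sigma>) ` ?X \<sigma> \<subseteq> ?Y \<sigma>"
        using ext[OF _ p] cont[OF p] sort by blast
      show "(\<lambda>f. f \<circ> inv_into UNIV \<sigma>) ` ?Y \<sigma> \<subseteq> ?X \<sigma>"
      proof (rule image_subsetI)
        fix f assume f: "f \<in> ?Y \<sigma>"
        have "f \<circ> inv_into UNIV \<sigma> \<circ> \<sigma> = f" by (simp add: comp_assoc inv1)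
        then have "sorts n \<sigma> (f \<circ> inv_into UNIV \<sigma>)"
          unfolding sort using f by (simp only: mem_Collect_eq) blast
        moreover have "f \<circ> inv_into UNIV \<sigma> \<in> {1..n} \<rightarrow>\<^sub>E {1..}" "cont (f \<circ> inv_into UNIV \<sigma>) = m"
          using f ext[OF _ p'] cont[OF p'] by blast+
        ultimately show "f \<circ> inv_into UNIV \<sigma> \<in> ?X \<sigma>" by blast
      qed
    qed (simp_all add: comp_assoc inv1 inv2)
  qed
  have "K_series n P m = int (card (\<Union>\<sigma>\<in>Sigma_R n P. ?X \<sigma>))"
    unfolding K_series_def gen_series_def X_eq[symmetric] by (simp add: cont_def)
  also have "\<dots> = (\<Sum>\<sigma>\<in>Sigma_R n P. int (card (?X \<sigma>)))"
    using fin disj by (subst card_UN_disjoint) (auto simp: finite_Sigma_R)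
  also have "\<dots> = (\<Sum>\<sigma>\<in>Sigma_R n P. fund_series n (des_right n \<sigma>) m)"
    using card by (intro sum.cong) (auto simp: fund_series_def gen_series_def cont_def conj_assoc)
  finally show "K_series n P m = (\<Sum>\<sigma>\<in>Sigma_R n P. fund_series n (des_right n \<sigma>) m)" .
qed

section \<open>Classes in the Grothendieck group\<close>

lemma short_exactI:
  assumes "f \<in> rmod_hom (hecke n) M' M" "g \<in> rmod_hom (hecke n) M M''"
    and "inj_on f (carrier M')" "g ` carrier M = carrier M''"
    and "f ` carrier M' = {v \<in> carrier M. g v = \<zero>\<^bsub>M''\<^esub>}"
  shows "short_exact (hecke n) M' M M''"
  using assms by (auto simp: short_exact_def)

lemma rmod_hom_zero:
  assumes M: "right_module R M" and N: "right_module R N" and f: "f \<in> rmod_hom R M N"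
  shows "f \<zero>\<^bsub>M\<^esub> = \<zero>\<^bsub>N\<^esub>"
proof -
  interpret M: right_module R M by fact
  interpret N: right_module R N by fact
  have "f \<zero>\<^bsub>M\<^esub> \<oplus>\<^bsub>N\<^esub> f \<zero>\<^bsub>M\<^esub> = f \<zero>\<^bsub>M\<^esub>" "f \<zero>\<^bsub>M\<^esub> \<in> carrier N"
    using f M.M.zero_closed M.M.l_zero[of "\<zero>\<^bsub>M\<^esub>"] unfolding rmod_hom_def by (metis (mono_tags, lifting) mem_Collect_eq, blast)
  then show ?thesis
    using N.M.add.l_cancel_one by blast
qed

lemma rmod_iso_sym:
  assumes "rmod_iso R M N"
  shows "rmod_iso R N M"
proof -
  obtain f where M: "right_module R M" and N: "right_module R N" and f: "f \<in> rmod_hom R M N"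
    and bij: "bij_betw f (carrier M) (carrier N)"
    using assms by (auto simp: rmod_iso_def)
  interpret M: right_module R M by fact
  interpret N: right_module R N by fact
  let ?g = "inv_into (carrier M) f"
  have g: "?g w \<in> carrier M" "f (?g w) = w" if "w \<in> carrier N" for w
    using that bij by (auto simp: bij_betw_def inv_into_into f_inv_into_f)
  have gf: "?g (f v) = v" if "v \<in> carrier M" for v
    using that bij by (auto simp: bij_betw_def)
  have add: "f (v \<oplus>\<^bsub>M\<^esub> w) = f v \<oplus>\<^bsub>N\<^esub> f w" if "v \<in> carrier M" "w \<in> carrier M" for v w
    using f that by (auto simp: rmod_hom_def)
  have ract: "f (ract M v h) = ract N (f v) h" if "v \<in> carrier M" "h \<in> carrier R" for v h
    using f that by (auto simp: rmod_hom_def)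
  have "?g \<in> rmod_hom R N M"
    unfolding rmod_hom_def
  proof (intro CollectI conjI ballI)
    fix v w assume vw: "v \<in> carrier N" "w \<in> carrier N"
    then have "f (?g v \<oplus>\<^bsub>M\<^esub> ?g w) = v \<oplus>\<^bsub>N\<^esub> w" by (simp add: add g)
    then show "?g (v \<oplus>\<^bsub>N\<^esub> w) = ?g v \<oplus>\<^bsub>M\<^esub> ?g w"
      using gf[of "?g v \<oplus>\<^bsub>M\<^esub> ?g w"] vw g by simp
  next
    fix v h assume vh: "v \<in> carrier N" "h \<in> carrier R"
    then have "f (ract M (?g v) h) = ract N v h" by (simp add: ract g)
    then show "?g (ract N v h) = ract M (?g v) h"
      using gf[of "ract M (?g v) h"] vh g M.ract_closed by simp
  qed (use g in auto)
  then show ?thesis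
    using M N bij_betw_inv_into[OF bij] by (auto simp: rmod_iso_def)
qed

lemma rmod_iso_trans:
  assumes "rmod_iso R M N" "rmod_iso R N L"
  shows "rmod_iso R M L"
proof -
  obtain f g where M: "right_module R M" and N: "right_module R N" and L: "right_module R L"
    and f: "f \<in> rmod_hom R M N" "bij_betw f (carrier M) (carrier N)"
    and g: "g \<in> rmod_hom R N L" "bij_betw g (carrier N) (carrier L)"
    using assms by (auto simp: rmod_iso_def)
  have "g \<circ> f \<in> rmod_hom R M L"
    using f(1) g(1) by (auto simp: rmod_hom_def Pi_def)
  then show ?thesis
    using M L bij_betw_trans[OF f(2) g(2)] by (auto simp: rmod_iso_def)
qed

lemma G0_relations_subset: "G0_relations n \<subseteq> carrier (free_Abelian_group (fd_modules n))"
proof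
  fix x assume "x \<in> G0_relations n"
  then obtain M' M M'' where x: "x = frag_of M - frag_of M' - frag_of M''"
    and m: "M' \<in> fd_modules n" "M \<in> fd_modules n" "M'' \<in> fd_modules n"
    by (auto simp: G0_relations_def)
  have "Poly_Mapping.keys x \<subseteq> {M, M', M''}"
    unfolding x using keys_diff[of "frag_of M - frag_of M'" "frag_of M''"] keys_diff[of "frag_of M" "frag_of M'"]
    by (auto simp: keys_frag_of)
  then show "x \<in> carrier (free_Abelian_group (fd_modules n))"
    using m by auto
qed

lemma normal_G0_kernel: "G0_kernel n \<lhd> free_Abelian_group (fd_modules n)"
  unfolding G0_kernel_def
  by (intro comm_group.subgroup_imp_normal[OF abelian_free_Abelian_group]
      group.generate_is_subgroup[OF group_free_Abelian_group G0_relations_subset])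

lemma group_G0 [simp]: "group (G0 n)"
  unfolding G0_def by (rule normal.factorgroup_is_group[OF normal_G0_kernel])

text \<open>The class of a module already lying in the universe, without the choice of
  representative hidden in \<open>G0_class\<close>.\<close>

definition std_class :: "nat \<Rightarrow> std_hmod \<Rightarrow> (std_hmod \<Rightarrow>\<^sub>0 int) set"
  where "std_class n N = G0_kernel n #>\<^bsub>free_Abelian_group (fd_modules n)\<^esub> frag_of N"

lemma std_class_closed: "N \<in> fd_modules n \<Longrightarrow> std_class n N \<in> carrier (G0 n)"
  unfolding std_class_def G0_def FactGroup_def
  using group.rcosetsI[OF group_free_Abelian_group, of "G0_kernel n" "fd_modules n" "frag_of N"]
    normal_imp_subgroup[OF normal_G0_kernel, THEN subgroup.subset, of n]
  by simp

lemma std_class_short_exact: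
  assumes m: "M' \<in> fd_modules n" "M \<in> fd_modules n" "M'' \<in> fd_modules n"
    and ex: "short_exact (hecke n) M' M M''"
  shows "std_class n M = std_class n M' \<otimes>\<^bsub>G0 n\<^esub> std_class n M''"
proof -
  let ?F = "free_Abelian_group (fd_modules n)"
  have rel: "frag_of M - frag_of M' - frag_of M'' \<in> G0_kernel n"
    unfolding G0_kernel_def using m ex by (intro generate.incl) (auto simp: G0_relations_def)
  have in_F: "frag_of N \<in> carrier ?F" if "N \<in> fd_modules n" for N
    using that by simp
  have sum_F: "frag_of M' + frag_of M'' \<in> carrier ?F"
    using group.is_monoid[OF group_free_Abelian_group, THEN monoid.m_closed, OF in_F[OF m(1)] in_F[OF m(3)]] by simp
  have "frag_of M = (frag_of M - frag_of M' - frag_of M'') + (frag_of M' + frag_of M'')"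
    by simp
  then have "frag_of M \<in> G0_kernel n #>\<^bsub>?F\<^esub> (frag_of M' + frag_of M'')"
    using rel unfolding r_coset_def mult_free_Abelian_group by blast
  then have "G0_kernel n #>\<^bsub>?F\<^esub> (frag_of M' + frag_of M'') = G0_kernel n #>\<^bsub>?F\<^esub> frag_of M"
    by (rule group.repr_independence[OF group_free_Abelian_group _ sum_F normal_imp_subgroup[OF normal_G0_kernel]])
  also have "G0_kernel n #>\<^bsub>?F\<^esub> (frag_of M' + frag_of M'') = std_class n M' <#>\<^bsub>?F\<^esub> std_class n M''"
    unfolding std_class_def using normal.rcos_sum[OF normal_G0_kernel in_F[OF m(1)] in_F[OF m(3)]] by simp
  finally show ?thesis
    by (simp add: std_class_def G0_def FactGroup_def)
qed

text \<open>In \<open>finite_dimensional\<close> the coefficients are attached to vectors rather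
  than to indices; \<open>SOME\<close> recovers the index, which is unambiguous because
  \<open>basis_vec\<close> is injective.\<close>

lemma finsum_basis:
  assumes M: "hecke_mod n B M" and S: "finite S" "S \<subseteq> B"
  shows "(\<Oplus>\<^bsub>M\<^esub>b\<in>basis_vec ` S. ract M b (scal n (v (SOME s. b = basis_vec s)))) = (\<lambda>s. if s \<in> S then v s else 0)"
  using S
proof (induction S)
  interpret hecke_mod n B M by fact
  {
    case empty
    show ?case by (simp add: zero_eq)
  next
    case (insert s S)
    have inj: "basis_vec a = basis_vec b \<longleftrightarrow> a = b" for a b :: 'a
    proof
      assume "basis_vec a = (basis_vec b :: 'a \<Rightarrow> complex)"
      then have "basis_vec a a = (basis_vec b a :: complex)" by simp
      then show "a = b" by (simp add: basis_vec_def split: if_splits)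
    qed simp
    have mem: "basis_vec t \<in> carrier M" if "t \<in> insert s S" for t
      using that insert.prems by (intro basis_vec_mem) auto
    have "basis_vec s \<notin> basis_vec ` S"
      using insert.hyps by (auto simp: inj)
    then have "(\<Oplus>\<^bsub>M\<^esub>b\<in>insert (basis_vec s) (basis_vec ` S). ract M b (scal n (v (SOME s. b = basis_vec s)))) =
        ract M (basis_vec s) (scal n (v (SOME t. basis_vec s = basis_vec t))) \<oplus>\<^bsub>M\<^esub>
          (\<Oplus>\<^bsub>M\<^esub>b\<in>basis_vec ` S. ract M b (scal n (v (SOME s. b = basis_vec s))))"
      using insert.hyps mem by (intro M.finsum_insert) (auto intro!: ract_closed)
    then have "(\<Oplus>\<^bsub>M\<^esub>b\<in>basis_vec ` insert s S. ract M b (scal n (v (SOME s. b = basis_vec s)))) =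
        ract M (basis_vec s) (scal n (v s)) \<oplus>\<^bsub>M\<^esub> (\<lambda>t. if t \<in> S then v t else 0)"
      using insert.IH insert.prems by (simp add: inj)
    also have "\<dots> = (\<lambda>t. if t \<in> insert s S then v t else 0)"
      using insert.hyps mem by (auto simp: ract_scal add_eq basis_vec_def)
    finally show ?case .
  }
qed

lemma finite_dimensional_hecke_mod:
  assumes M: "hecke_mod n B M" and B: "finite B"
  shows "finite_dimensional n M"
  unfolding finite_dimensional_def
proof (intro exI[of _ "basis_vec ` B"] conjI ballI)
  interpret hecke_mod n B M by fact
  show "basis_vec ` B \<subseteq> carrier M" using basis_vec_mem by blast
  fix v assume v: "v \<in> carrier M"
  have "v = (\<lambda>s. if s \<in> B then v s else 0)"
    using v by (auto simp: carrier_eq)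
  also have "\<dots> = (\<Oplus>\<^bsub>M\<^esub>b\<in>basis_vec ` B. ract M b (scal n (v (SOME s. b = basis_vec s))))"
    by (rule finsum_basis[OF M B subset_refl, symmetric])
  finally show "\<exists>c. v = (\<Oplus>\<^bsub>M\<^esub>b\<in>basis_vec ` B. ract M b (scal n (c b)))"
    by (intro exI[of _ "\<lambda>b. v (SOME s. b = basis_vec s)"])
qed (use B in auto)

lemma hecke_mod_fd:
  assumes "hecke_mod n B M" "finite B"
  shows "M \<in> fd_modules n"
  using assms finite_dimensional_hecke_mod hecke_mod.right_module by (auto simp: fd_modules_def)

lemma short_exact_zero:
  assumes "hecke_mod n {} Z"
  shows "short_exact (hecke n) Z Z Z"
proof -
  interpret Z: hecke_mod n "{}" Z by fact
  have carrier: "carrier Z = {\<zero>\<^bsub>Z\<^esub>}"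
    by (auto simp: Z.carrier_eq Z.zero_eq)
  have "id \<in> rmod_hom (hecke n) Z Z"
    by (auto simp: rmod_hom_def)
  then show ?thesis
    by (rule short_exactI[of id n Z Z id]) (use carrier in \<open>auto simp: rmod_hom_def\<close>)
qed

text \<open>Two identity maps make Z, Z, Z exact when Z is zero, so the class equals its own square
  in a group.\<close>

lemma std_class_zero:
  assumes "hecke_mod n {} Z"
  shows "std_class n Z = \<one>\<^bsub>G0 n\<^esub>"
proof -
  have Z: "Z \<in> fd_modules n" by (rule hecke_mod_fd[OF assms]) simp
  have "std_class n Z \<otimes>\<^bsub>G0 n\<^esub> std_class n Z = std_class n Z"
    using std_class_short_exact[OF Z Z Z short_exact_zero[OF assms]] by simp
  then show ?thesis
    using group.l_cancel_one[OF group_G0 std_class_closed[OF Z] std_class_closed[OF Z]] by simp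
qed

text \<open>Zero operators on an empty basis; this module serves as the kernel in exact sequences
  that come from isomorphisms.\<close>

lemma ex_zero_hecke_mod: "\<exists>Z :: ('b \<Rightarrow> complex) hmod. hecke_mod n {} Z"
proof -
  have "hecke_ops n ({} :: 'b set) (\<lambda>i v b. 0)"
    by unfold_locales (auto simp: lin_op_def)
  then show ?thesis
    using hecke_mod_basis_module[of "{} :: 'b set" n _ "pi_bar n" "\<lambda>_ _ _. 0"] by blast
qed

text \<open>An isomorphism is a short exact sequence with zero kernel, and the class of the kernel
  is trivial.\<close>

lemma std_class_iso:
  assumes iso: "rmod_iso (hecke n) M N" and fd: "M \<in> fd_modules n" "N \<in> fd_modules n"
  shows "std_class n M = std_class n N"
proof -
  obtain Z :: std_hmod where Z: "hecke_mod n {} Z" using ex_zero_hecke_mod by blast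
  interpret Z: hecke_mod n "{}" Z by fact
  have Zfd: "Z \<in> fd_modules n" by (rule hecke_mod_fd[OF Z]) simp
  obtain g where M: "right_module (hecke n) M" and N: "right_module (hecke n) N"
    and g: "g \<in> rmod_hom (hecke n) M N" "bij_betw g (carrier M) (carrier N)"
    using iso by (auto simp: rmod_iso_def)
  interpret M: right_module "hecke n" M by fact
  have carrier: "carrier Z = {\<zero>\<^bsub>Z\<^esub>}"
    by (auto simp: Z.carrier_eq Z.zero_eq)
  have ract_zero: "ract M \<zero>\<^bsub>M\<^esub> h = \<zero>\<^bsub>M\<^esub>" if "h \<in> carrier (hecke n)" for h
    using M.ract_add_left[of "\<zero>\<^bsub>M\<^esub>" "\<zero>\<^bsub>M\<^esub>" h] that M.M.add.l_cancel_one[of "ract M \<zero>\<^bsub>M\<^esub> h" "ract M \<zero>\<^bsub>M\<^esub> h"]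
    by (simp add: M.ract_closed)
  have g0: "g \<zero>\<^bsub>M\<^esub> = \<zero>\<^bsub>N\<^esub>" by (rule rmod_hom_zero[OF M N g(1)])
  have "short_exact (hecke n) Z M N"
  proof (rule short_exactI[OF _ g(1)])
    show "(\<lambda>_. \<zero>\<^bsub>M\<^esub>) \<in> rmod_hom (hecke n) Z M"
      by (auto simp: rmod_hom_def ract_zero)
    show "g ` carrier M = carrier N" using g(2) by (simp add: bij_betw_def)
    have "v = \<zero>\<^bsub>M\<^esub>" if "v \<in> carrier M" "g v = \<zero>\<^bsub>N\<^esub>" for v
      using that g0 g(2) by (auto simp: bij_betw_def inj_on_def)
    then show "(\<lambda>_. \<zero>\<^bsub>M\<^esub>) ` carrier Z = {v \<in> carrier M. g v = \<zero>\<^bsub>N\<^esub>}"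
      using g0 by (auto simp: carrier)
  qed (simp add: carrier)
  then have "std_class n M = \<one>\<^bsub>G0 n\<^esub> \<otimes>\<^bsub>G0 n\<^esub> std_class n N"
    using std_class_short_exact[OF Zfd fd] std_class_zero[OF Z] by simp
  then show ?thesis
    using group.is_monoid[OF group_G0, THEN monoid.l_one, OF std_class_closed[OF fd(2)]] by simp
qed

text \<open>All representatives in the universe are isomorphic to one another, so the set under
  \<open>the_elem\<close> is a single coset.\<close>

lemma G0_class_eq:
  assumes N: "N \<in> fd_modules n" and iso: "rmod_iso (hecke n) N M"
  shows "G0_class n M = std_class n N"
proof -
  have "(\<lambda>N. G0_kernel n #>\<^bsub>free_Abelian_group (fd_modules n)\<^esub> frag_of N) ` {N \<in> fd_modules n. rmod_iso (hecke n) N M}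
      = {std_class n N}"
  proof (intro equalityI subsetI)
    fix X assume "X \<in> (\<lambda>N. G0_kernel n #>\<^bsub>free_Abelian_group (fd_modules n)\<^esub> frag_of N) ` {N \<in> fd_modules n. rmod_iso (hecke n) N M}"
    then obtain N' where N': "N' \<in> fd_modules n" "rmod_iso (hecke n) N' M" "X = std_class n N'"
      by (auto simp: std_class_def)
    then show "X \<in> {std_class n N}"
      using std_class_iso[OF rmod_iso_trans[OF N'(2) rmod_iso_sym[OF iso]] N'(1) N] by simp
  qed (use N iso in \<open>auto simp: std_class_def\<close>)
  then show ?thesis by (simp add: G0_class_def)
qed

definition std_series :: "((nat \<Rightarrow> (std_hmod \<Rightarrow>\<^sub>0 int) set) \<Rightarrow> series) \<Rightarrow> nat \<Rightarrow> std_hmod \<Rightarrow> series"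
  where "std_series ch n N = ch (\<lambda>m. if m = n then std_class n N else \<one>\<^bsub>G0 m\<^esub>)"

lemma ch_eq_std_series:
  assumes "N \<in> fd_modules n" "rmod_iso (hecke n) N M"
  shows "ch (G0_sum_class n M) = std_series ch n N"
  unfolding std_series_def G0_sum_class_def G0_class_eq[OF assms] ..

lemma single_class_in_G0_sum:
  assumes "N \<in> fd_modules n"
  shows "(\<lambda>m. if m = n then std_class n N else \<one>\<^bsub>G0 m\<^esub>) \<in> carrier G0_sum"
proof -
  have "{m. (if m = n then std_class n N else \<one>\<^bsub>G0 m\<^esub>) \<noteq> \<one>\<^bsub>G0 m\<^esub>} \<subseteq> {n}" by auto
  then have "finite {m. (if m = n then std_class n N else \<one>\<^bsub>G0 m\<^esub>) \<noteq> \<one>\<^bsub>G0 m\<^esub>}"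
    by (rule finite_subset) simp
  then show ?thesis
    using std_class_closed[OF assms] group.is_monoid[OF group_G0, THEN monoid.one_closed]
    by (auto simp: carrier_sum_group PiE_iff)
qed

lemma std_series_in_QSym:
  assumes "qsym_characteristic ch" "N \<in> fd_modules n"
  shows "std_series ch n N \<in> carrier QSym"
  using assms single_class_in_G0_sum[OF assms(2)]
  by (auto simp: qsym_characteristic_def std_series_def iso_def hom_def)

lemma std_series_short_exact:
  assumes ch: "qsym_characteristic ch"
    and fd: "M' \<in> fd_modules n" "M \<in> fd_modules n" "M'' \<in> fd_modules n"
    and ex: "short_exact (hecke n) M' M M''"
  shows "std_series ch n M = (\<lambda>m. std_series ch n M' m + std_series ch n M'' m)"
proof -
  let ?c = "\<lambda>N m. if m = n then std_class n N else \<one>\<^bsub>G0 m\<^esub>"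
  have one: "\<one>\<^bsub>G0 m\<^esub> \<otimes>\<^bsub>G0 m\<^esub> \<one>\<^bsub>G0 m\<^esub> = \<one>\<^bsub>G0 m\<^esub>" for m
    using group.is_monoid[OF group_G0] by (simp add: monoid.one_closed monoid.l_one)
  have "?c M = ?c M' \<otimes>\<^bsub>G0_sum\<^esub> ?c M''"
    using std_class_short_exact[OF fd ex] one by (auto simp: fun_eq_iff)
  moreover have "ch \<in> hom G0_sum QSym"
    using ch by (auto simp: qsym_characteristic_def iso_def)
  ultimately have "std_series ch n M = std_series ch n M' \<otimes>\<^bsub>QSym\<^esub> std_series ch n M''"
    unfolding std_series_def
    by (simp only: hom_mult single_class_in_G0_sum[OF fd(1)] single_class_in_G0_sum[OF fd(3)])
  then show ?thesis by (simp add: QSym_def)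
qed

lemma std_series_zero:
  assumes ch: "qsym_characteristic ch" and Z: "hecke_mod n {} Z"
  shows "std_series ch n Z = (\<lambda>m. 0)"
proof -
  have fd: "Z \<in> fd_modules n" by (rule hecke_mod_fd[OF Z]) simp
  from std_series_short_exact[OF ch fd fd fd short_exact_zero[OF Z]] have "std_series ch n Z m = std_series ch n Z m + std_series ch n Z m" for m
    by metis
  then show ?thesis by (simp add: fun_eq_iff)
qed

text \<open>The index set is left open because \<open>simple_module\<close> is built on
  \<open>unit\<close>, while composition factors inside the universe need an index of type
  \<open>nat\<close>.\<close>

definition scalar_module :: "nat \<Rightarrow> 'b set \<Rightarrow> nat set \<Rightarrow> ('b \<Rightarrow> complex) hmod"
  where "scalar_module n B D = basis_module n B (pi_bar n)
    (\<lambda>b i. if i \<in> D then (\<lambda>c. - basis_vec b c) else (\<lambda>c. 0))"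

lemma scalar_module:
  assumes B: "finite B"
  shows hecke_mod_scalar_module: "hecke_mod n B (scalar_module n B D)"
    and ract_scalar_module: "v \<in> carrier (scalar_module n B D) \<Longrightarrow> i \<in> {1..<n} \<Longrightarrow>
      ract (scalar_module n B D) v (pi_bar n i) = (\<lambda>b. if i \<in> D then - v b else 0)"
proof -
  let ?T = "\<lambda>i v b. if b \<in> B \<and> i \<in> D then - v b else (0 :: complex)"
  have ops: "hecke_ops n B ?T"
    by unfold_locales (auto simp: lin_op_def fun_eq_iff)
  have A: "(if i \<in> D then (\<lambda>c. - basis_vec b c) else (\<lambda>c. 0)) = ?T i (basis_vec b)" if "b \<in> B" for b i
    using that by (auto simp: basis_vec_def)
  show mod: "hecke_mod n B (scalar_module n B D)"
    unfolding scalar_module_def by (rule hecke_mod_basis_module[OF B ops]) (use A in blast)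
  assume v: "v \<in> carrier (scalar_module n B D)" and i: "i \<in> {1..<n}"
  then have "v \<in> carrier (basis_space B)"
    by (simp add: hecke_mod.carrier_eq[OF mod])
  then have "ract (scalar_module n B D) v (pi_bar n i) = ?T i v"
    unfolding scalar_module_def using A i by (intro ract_basis_module[OF B ops]) blast+
  also have "\<dots> = (\<lambda>b. if i \<in> D then - v b else 0)"
    using v by (auto simp: hecke_mod.carrier_eq[OF mod])
  finally show "ract (scalar_module n B D) v (pi_bar n i) = (\<lambda>b. if i \<in> D then - v b else 0)" .
qed

text \<open>Transfers the prescribed value of \<open>ch\<close> on \<open>simple_module\<close> to
  its copy on the index set \<open>{0}\<close>.\<close>

lemma std_series_scalar_module:
  assumes ch: "qsym_characteristic ch" and D: "D \<subseteq> {1..<n}"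
  shows "std_series ch n (scalar_module n {0} D) = fund_series n D"
proof -
  obtain \<alpha> where \<alpha>: "composition n \<alpha>" "comp_set \<alpha> = D"
    using ex_composition[OF D] by blast
  have simple: "simple_module \<alpha> = scalar_module n UNIV D"
    using \<alpha> by (simp add: simple_module_def scalar_module_def composition_def)
  let ?M = "scalar_module n {0::nat} D" and ?N = "scalar_module n (UNIV :: unit set) D"
  interpret M: hecke_mod n "{0}" ?M by (rule hecke_mod_scalar_module) simp
  interpret N: hecke_mod n UNIV ?N by (rule hecke_mod_scalar_module) simp
  define f :: "(nat \<Rightarrow> complex) \<Rightarrow> unit \<Rightarrow> complex" where "f v = (\<lambda>_. v 0)" for v
  have "f \<in> rmod_hom (hecke n) ?M ?N"
    by (rule rmod_hom_hecke[OF M.right_module N.right_module])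
      (auto simp: N.carrier_eq M.add_eq N.add_eq M.ract_scal N.ract_scal f_def ract_scalar_module simp del: atLeastLessThan_iff)
  moreover have "bij_betw f (carrier ?M) (carrier ?N)"
    by (rule bij_betw_byWitness[where f' = "\<lambda>w j. if j = 0 then w () else 0"])
      (auto simp: f_def M.carrier_eq N.carrier_eq fun_eq_iff)
  ultimately have "rmod_iso (hecke n) ?M ?N"
    by (rule rmod_isoI[OF M.right_module N.right_module])
  moreover have "?M \<in> fd_modules n"
    by (rule hecke_mod_fd[OF M.hecke_mod_axioms]) simp
  ultimately have "std_series ch n ?M = ch (G0_sum_class n (simple_module \<alpha>))"
    unfolding simple by (rule ch_eq_std_series[symmetric, rotated])
  also have "\<dots> = fundamental \<alpha>"
    using ch \<alpha> by (simp add: qsym_characteristic_def)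
  finally show ?thesis using \<alpha> by (simp add: fundamental_eq)
qed

section \<open>Characteristics of triangular modules\<close>

text \<open>The vectors vanishing at the first \<open>k\<close> basis elements form a submodule, and consecutive
  submodules have one-dimensional quotients.\<close>

lemma ch_triangular_module:
  fixes M :: "('b \<Rightarrow> complex) hmod" and e :: "nat \<Rightarrow> 'b"
  assumes ch: "qsym_characteristic ch" and M: "hecke_mod n B M" and e: "bij_betw e {..<N} B"
    and D: "\<And>b. b \<in> B \<Longrightarrow> D b \<subseteq> {1..<n}"
    and tri: "\<And>v k i. v \<in> carrier M \<Longrightarrow> k < N \<Longrightarrow> i \<in> {1..<n} \<Longrightarrow> \<forall>j<k. v (e j) = 0 \<Longrightarrow>
      ract M v (pi_bar n i) (e k) = (if i \<in> D (e k) then - v (e k) else 0)"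
  shows "ch (G0_sum_class n M) = (\<lambda>m. \<Sum>b\<in>B. fund_series n (D b) m)"
proof -
  interpret M: hecke_mod n B M by fact
  \<comment> \<open>\<open>pull\<close> and \<open>push\<close> carry coordinates between
    \<open>nat\<close> and \<open>B\<close> along the enumeration \<open>e\<close>; this moves the
    whole filtration into the universe of the Grothendieck group.\<close>
  define pull :: "(nat \<Rightarrow> complex) \<Rightarrow> 'b \<Rightarrow> complex"
    where "pull u b = (if b \<in> B then u (inv_into {..<N} e b) else 0)" for u b
  define push :: "('b \<Rightarrow> complex) \<Rightarrow> nat \<Rightarrow> complex"
    where "push v j = (if j < N then v (e j) else 0)" for v j
  have eB: "e j \<in> B" if "j < N" for j
    using e that by (auto simp: bij_betw_def)
  have inv_e: "inv_into {..<N} e (e j) = j" if "j < N" for j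
    using e that by (auto simp: bij_betw_def)
  have e_inv: "inv_into {..<N} e b < N" "e (inv_into {..<N} e b) = b" if "b \<in> B" for b
    using e that inv_into_into[of b e "{..<N}"] f_inv_into_f[of b e "{..<N}"] by (auto simp: bij_betw_def)
  have pull_mem: "pull u \<in> carrier M" for u
    by (auto simp: pull_def M.carrier_eq)
  have pull_e: "pull u (e j) = u j" if "j < N" for u j
    using that by (simp add: pull_def eB inv_e)
  have pull_push: "pull (push v) = v" if "v \<in> carrier M" for v
    using that e_inv by (auto simp: pull_def push_def M.carrier_eq)
  have push_pull: "push (pull u) = u" if "\<forall>j. j \<notin> {..<N} \<longrightarrow> u j = 0" for u
    using that by (auto simp: push_def pull_e)
  have pull_add: "pull (\<lambda>j. u j + w j) = (\<lambda>b. pull u b + pull w b)" for u w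
    by (auto simp: pull_def)
  have push_add: "push (\<lambda>b. v b + w b) = (\<lambda>j. push v j + push w j)" for v w
    by (auto simp: push_def)
  define U :: "nat \<Rightarrow> std_hmod"
    where "U k = (basis_space {k..<N})\<lparr>ract := \<lambda>u h. push (ract M (pull u) h)\<rparr>" for k
  have U_simps: "carrier (U k) = {u. \<forall>j. j \<notin> {k..<N} \<longrightarrow> u j = 0}" "\<zero>\<^bsub>U k\<^esub> = (\<lambda>j. 0)"
    "u \<oplus>\<^bsub>U k\<^esub> w = (\<lambda>j. u j + w j)" "ract (U k) u h = push (ract M (pull u) h)" for k u w h
    by (auto simp: U_def)
  \<comment> \<open>By \<open>tri\<close>, coordinate j of the image is a multiple of coordinate j
    once all earlier ones vanish, so vanishing of the first k coordinates is preserved.\<close>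
  have invariant: "\<forall>v\<in>carrier M. (\<forall>j<k. v (e j) = 0) \<longrightarrow> (\<forall>j<k. ract M v h (e j) = 0)"
    if "k \<le> N" "h \<in> carrier (hecke n)" for k h
    using that(2)
  proof (induction h rule: hecke_induct)
    case (scal c)
    then show ?case by (simp add: M.ract_scal)
  next
    case (gen i)
    then show ?case using tri[of _ _ i] that(1) by auto
  next
    case (add h1 h2)
    then show ?case by (simp add: M.ract_add_elt)
  next
    case (mult h1 h2)
    then show ?case by (simp add: M.ract_mult M.ract_closed)
  qed
  have mod_U: "hecke_mod n {k..<N} (U k)" if k: "k \<le> N" for k
  proof (rule hecke_modI)
    fix u h assume u: "u \<in> carrier (U k)" and h: "h \<in> carrier (hecke n)"
    have "\<forall>j<k. pull u (e j) = 0"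
      using u k by (auto simp: U_simps pull_e)
    then have "\<forall>j<k. ract M (pull u) h (e j) = 0"
      using invariant[OF k h] pull_mem by blast
    then show "ract (U k) u h \<in> carrier (U k)"
      by (auto simp: U_simps push_def)
  next
    fix u h1 h2 assume u: "u \<in> carrier (U k)" and h: "h1 \<in> carrier (hecke n)" "h2 \<in> carrier (hecke n)"
    show "ract (U k) u (h1 \<otimes>\<^bsub>hecke n\<^esub> h2) = ract (U k) (ract (U k) u h1) h2"
      using h by (simp add: U_simps(4) M.ract_mult pull_mem pull_push M.ract_closed)
  next
    fix u z assume u: "u \<in> carrier (U k)"
    show "ract (U k) u (scal n z) = (\<lambda>j. z * u j)"
      using u by (auto simp: U_simps M.ract_scal pull_mem push_def pull_e fun_eq_iff)
  qed (simp_all add: U_simps M.ract_sum M.ract_add_elt pull_mem pull_add push_add)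
  have fd_U: "U k \<in> fd_modules n" if "k \<le> N" for k
    by (rule hecke_mod_fd[OF mod_U[OF that]]) simp
  have iso: "rmod_iso (hecke n) (U 0) M"
  proof (rule rmod_isoI)
    show "right_module (hecke n) (U 0)"
      using mod_U[of 0] by (simp add: hecke_mod.right_module)
    show "right_module (hecke n) M" by (rule M.right_module)
    show "pull \<in> rmod_hom (hecke n) (U 0) M"
      by (auto simp: rmod_hom_def U_simps M.add_eq pull_mem pull_add pull_push M.ract_closed)
    have "push v \<in> carrier (U 0)" for v
      by (auto simp: U_simps push_def)
    then show "bij_betw pull (carrier (U 0)) (carrier M)"
      using push_pull pull_push pull_mem by (intro bij_betw_byWitness[where f' = push]) (auto simp: U_simps)
  qed
  have step: "short_exact (hecke n) (U (Suc k)) (U k) (scalar_module n {0 :: nat} (D (e k)))" if k: "k < N" for k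
  proof -
    let ?L = "scalar_module n {0 :: nat} (D (e k))"
    interpret U: hecke_mod n "{k..<N}" "U k" by (rule mod_U) (use k in simp)
    interpret U': hecke_mod n "{Suc k..<N}" "U (Suc k)" by (rule mod_U) (use k in simp)
    interpret L: hecke_mod n "{0}" ?L by (rule hecke_mod_scalar_module) simp
    \<comment> \<open>The quotient of consecutive steps is read off from coordinate k, renumbered as
      0.\<close>
    define g :: "(nat \<Rightarrow> complex) \<Rightarrow> nat \<Rightarrow> complex" where "g u j = (if j = 0 then u k else 0)" for u j
    have g_mem: "g u \<in> carrier ?L" for u
      by (auto simp: g_def L.carrier_eq)
    have id_hom: "id \<in> rmod_hom (hecke n) (U (Suc k)) (U k)"
      by (auto simp: rmod_hom_def U_simps)
    have g_hom: "g \<in> rmod_hom (hecke n) (U k) ?L"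
    proof (rule rmod_hom_hecke[OF U.right_module L.right_module g_mem])
      fix u i assume u: "u \<in> carrier (U k)" and i: "i \<in> {1..<n}"
      have "\<forall>j<k. pull u (e j) = 0"
        using u k by (auto simp: U_simps pull_e)
      then have "push (ract M (pull u) (pi_bar n i)) k = (if i \<in> D (e k) then - u k else 0)"
        using tri[OF pull_mem k i] k by (simp add: push_def pull_e)
      then show "g (ract (U k) u (pi_bar n i)) = ract ?L (g u) (pi_bar n i)"
        using ract_scalar_module[OF _ g_mem i] by (auto simp: U_simps(4) g_def fun_eq_iff)
    next
      fix u z assume "u \<in> carrier (U k)"
      then show "g (ract (U k) u (scal n z)) = ract ?L (g u) (scal n z)"
        using g_mem by (auto simp: U.ract_scal L.ract_scal g_def)
    qed (auto simp: U.add_eq L.add_eq g_def)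
    have g_surj: "g ` carrier (U k) = carrier ?L"
    proof (intro equalityI subsetI)
      fix w assume "w \<in> carrier ?L"
      then have "w = g (\<lambda>j. if j = k then w 0 else 0)"
        by (auto simp: g_def L.carrier_eq)
      moreover have "(\<lambda>j. if j = k then w 0 else 0) \<in> carrier (U k)"
        using k by (auto simp: U_simps)
      ultimately show "w \<in> g ` carrier (U k)" by blast
    qed (use g_mem in auto)
    have kernel: "id ` carrier (U (Suc k)) = {u \<in> carrier (U k). g u = \<zero>\<^bsub>?L\<^esub>}"
      by (auto simp: U_simps L.zero_eq g_def fun_eq_iff Suc_le_eq) (metis le_neq_implies_less not_less)
    show ?thesis
      by (rule short_exactI[OF id_hom g_hom _ g_surj kernel]) simp
  qed
  \<comment> \<open>Downward induction from \<open>U N\<close>, which is zero; each step adds one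
    factor of the filtration.\<close>
  have "std_series ch n (U k) = (\<lambda>m. \<Sum>j\<in>{k..<N}. fund_series n (D (e j)) m)" if "k \<le> N" for k
    using that
  proof (induction k rule: inc_induct)
    case base
    show ?case using std_series_zero[OF ch, of n "U N"] mod_U[of N] by simp
  next
    case (step k)
    have L: "scalar_module n {0 :: nat} (D (e k)) \<in> fd_modules n"
      by (rule hecke_mod_fd[OF hecke_mod_scalar_module]) simp_all
    have "std_series ch n (U k) = (\<lambda>m. std_series ch n (U (Suc k)) m + std_series ch n (scalar_module n {0} (D (e k))) m)"
      using step.hyps by (intro std_series_short_exact[OF ch fd_U fd_U L] \<open>\<And>k. k < N \<Longrightarrow> short_exact _ _ _ _\<close>) auto
    then show ?case
      using step.hyps D[OF eB] by (simp add: step.IH std_series_scalar_module[OF ch] sum.atLeast_Suc_lessThan add.commute)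
  qed
  from this[of 0] have "std_series ch n (U 0) = (\<lambda>m. \<Sum>j\<in>{..<N}. fund_series n (D (e j)) m)"
    by (simp add: atLeast0LessThan)
  also have "\<dots> = (\<lambda>m. \<Sum>b\<in>B. fund_series n (D b) m)"
    using sum.reindex_bij_betw[OF e, of "\<lambda>b. fund_series n (D b) _"] by auto
  finally show ?thesis
    using ch_eq_std_series[OF fd_U iso] by simp
qed

lemma ex_enumeration_by_rank:
  fixes r :: "'b \<Rightarrow> nat"
  assumes "finite B"
  shows "\<exists>e. bij_betw e {..<card B} B \<and> (\<forall>j k. j \<le> k \<longrightarrow> k < card B \<longrightarrow> r (e j) \<le> r (e k))"
proof -
  obtain ys where ys: "set ys = B" "distinct ys"
    using finite_distinct_list[OF assms] by blast
  define xs where "xs = sort_key r ys"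
  have xs: "set xs = B" "distinct xs" "length xs = card B" "sorted (map r xs)"
    using ys distinct_card[OF ys(2)] by (auto simp: xs_def)
  have "bij_betw ((!) xs) {..<card B} B"
    by (rule bij_betw_nth[OF xs(2)]) (simp_all only: xs(1,3))
  moreover have "r (xs ! j) \<le> r (xs ! k)" if "j \<le> k" "k < card B" for j k
    using sorted_nth_mono[OF xs(4), of j k] that xs(3) by simp
  ultimately show ?thesis by blast
qed

text \<open>Off-diagonal contributions come from strictly smaller rank, so any enumeration by weakly
  increasing rank is triangular, whatever the order within a rank.\<close>

lemma ch_graded_module:
  fixes M :: "('b \<Rightarrow> complex) hmod" and r :: "'b \<Rightarrow> nat"
  assumes ch: "qsym_characteristic ch" and M: "hecke_mod n B M" and B: "finite B"
    and D: "\<And>b. b \<in> B \<Longrightarrow> D b \<subseteq> {1..<n}"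
    and tri: "\<And>v b i. v \<in> carrier M \<Longrightarrow> b \<in> B \<Longrightarrow> i \<in> {1..<n} \<Longrightarrow> \<forall>c\<in>B. r c < r b \<longrightarrow> v c = 0 \<Longrightarrow>
      ract M v (pi_bar n i) b = (if i \<in> D b then - v b else 0)"
  shows "ch (G0_sum_class n M) = (\<lambda>m. \<Sum>b\<in>B. fund_series n (D b) m)"
proof -
  obtain e where e: "bij_betw e {..<card B} B" and mono: "\<And>j k. j \<le> k \<Longrightarrow> k < card B \<Longrightarrow> r (e j) \<le> r (e k)"
    using ex_enumeration_by_rank[OF B, of r] by blast
  show ?thesis
  proof (rule ch_triangular_module[OF ch M e D])
    fix v k i assume v: "v \<in> carrier M" and k: "k < card B" and i: "i \<in> {1..<n}" and zero: "\<forall>j<k. v (e j) = 0"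
    have "v c = 0" if c: "c \<in> B" "r c < r (e k)" for c
    proof -
      obtain j where j: "j < card B" "c = e j"
        using e c(1) by (auto simp: bij_betw_def)
      then have "j < k"
        using mono[of k j] c(2) by (metis leI not_less)
      then show ?thesis using zero j by simp
    qed
    moreover have "e k \<in> B" using e k by (auto simp: bij_betw_def)
    ultimately show "ract M v (pi_bar n i) (e k) = (if i \<in> D (e k) then - v (e k) else 0)"
      using tri[OF v _ i] by blast
  qed
qed

text \<open>The one off-diagonal term at \<sigma> is the coordinate at \<sigma> s_i for a descent i,
  and that permutation has one inversion less.\<close>

lemma ch_poset_module:
  assumes ch: "qsym_characteristic ch"
  shows "ch (G0_sum_class n (poset_module n P)) = (\<lambda>m. \<Sum>\<sigma>\<in>Sigma_R n P. fund_series n (des_right n \<sigma>) m)"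
proof (rule ch_graded_module[OF ch hecke_mod_poset_module finite_Sigma_R, where r = "\<lambda>\<sigma>. card (inversions n \<sigma>)"])
  show "des_right n \<sigma> \<subseteq> {1..<n}" for \<sigma>
    by (auto simp: des_right_def)
  fix v \<sigma> i assume v: "v \<in> carrier (poset_module n P)" and \<sigma>: "\<sigma> \<in> Sigma_R n P" and i: "i \<in> {1..<n}"
    and zero: "\<forall>\<tau>\<in>Sigma_R n P. card (inversions n \<tau>) < card (inversions n \<sigma>) \<longrightarrow> v \<tau> = 0"
  show "ract (poset_module n P) v (pi_bar n i) \<sigma> = (if i \<in> des_right n \<sigma> then - v \<sigma> else 0)"
    using zero \<sigma> card_inversions_descent[OF i, of \<sigma>] i
    by (auto simp: ract_poset_module[OF v i] poset_op_def des_right_iff[OF Sigma_R_permutes[OF \<sigma>]])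
qed

lemma ch_bold_poset_module:
  assumes ch: "qsym_characteristic ch"
  shows "ch (G0_sum_class n (bold_poset_module n P)) =
    (\<lambda>m. \<Sum>\<sigma>\<in>Sigma_R n P. fund_series n ({1..<n} - des_right n \<sigma>) m)"
proof (rule ch_graded_module[OF ch hecke_mod_bold_poset_module finite_Sigma_R, where r = "\<lambda>\<sigma>. card (inversions n \<sigma>)"])
  fix v \<sigma> i assume v: "v \<in> carrier (bold_poset_module n P)" and \<sigma>: "\<sigma> \<in> Sigma_R n P" and i: "i \<in> {1..<n}"
    and zero: "\<forall>\<tau>\<in>Sigma_R n P. card (inversions n \<tau>) < card (inversions n \<sigma>) \<longrightarrow> v \<tau> = 0"
  show "ract (bold_poset_module n P) v (pi_bar n i) \<sigma> = (if i \<in> {1..<n} - des_right n \<sigma> then - v \<sigma> else 0)"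
    using zero \<sigma> card_inversions_descent[OF i, of \<sigma>] i
    by (auto simp: ract_bold_poset_module[OF v i] bold_poset_op_def des_right_iff[OF Sigma_R_permutes[OF \<sigma>]])
qed auto

text \<open>Obtained as a value of \<open>ch\<close> on a one-dimensional module, which spares a
  direct check of the coefficient condition.\<close>

lemma fund_series_in_QSym:
  assumes "qsym_characteristic ch" "S \<subseteq> {1..<n}"
  shows "fund_series n S \<in> carrier QSym"
proof -
  have "scalar_module n {0 :: nat} S \<in> fd_modules n"
    by (rule hecke_mod_fd[OF hecke_mod_scalar_module]) simp_all
  then show ?thesis
    using std_series_in_QSym[OF assms(1)] std_series_scalar_module[OF assms] by metis
qed

section \<open>Additive maps on quasisymmetric functions\<close>

lemma zero_in_QSym: "(\<lambda>m. 0) \<in> carrier QSym"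
  by (simp add: QSym_def)

lemma QSym_iff: "f \<in> carrier QSym \<longleftrightarrow>
    (\<forall>m. f m \<noteq> 0 \<longrightarrow> Poly_Mapping.keys m \<subseteq> {1..}) \<and>
    (\<exists>d. \<forall>m. f m \<noteq> 0 \<longrightarrow> (\<Sum>k\<in>Poly_Mapping.keys m. Poly_Mapping.lookup m k) \<le> d) \<and>
    (\<forall>m m'. Poly_Mapping.keys m \<subseteq> {1..} \<longrightarrow> Poly_Mapping.keys m' \<subseteq> {1..} \<longrightarrow>
      map (Poly_Mapping.lookup m) (sorted_list_of_set (Poly_Mapping.keys m)) =
      map (Poly_Mapping.lookup m') (sorted_list_of_set (Poly_Mapping.keys m')) \<longrightarrow> f m = f m')"
  unfolding QSym_def partial_object.simps mem_Collect_eq ..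

lemma add_in_QSym:
  assumes "f \<in> carrier QSym" "g \<in> carrier QSym"
  shows "(\<lambda>m. f m + g m) \<in> carrier QSym"
proof -
  note f = assms(1)[unfolded QSym_iff] and g = assms(2)[unfolded QSym_iff]
  obtain a b where a: "\<forall>m. f m \<noteq> 0 \<longrightarrow> (\<Sum>k\<in>Poly_Mapping.keys m. Poly_Mapping.lookup m k) \<le> a"
    and b: "\<forall>m. g m \<noteq> 0 \<longrightarrow> (\<Sum>k\<in>Poly_Mapping.keys m. Poly_Mapping.lookup m k) \<le> b"
    using conjunct1[OF conjunct2[OF f]] conjunct1[OF conjunct2[OF g]] by (elim exE) (rule that)
  have or: "f m \<noteq> 0 \<or> g m \<noteq> 0" if "f m + g m \<noteq> 0" for m
    using that by auto
  show ?thesis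
    unfolding QSym_iff
  proof (intro conjI allI impI exI[of _ "max a b"])
    fix m assume m: "f m + g m \<noteq> 0"
    show "(\<Sum>k\<in>Poly_Mapping.keys m. Poly_Mapping.lookup m k) \<le> max a b"
      using or[OF m]
    proof
      assume "f m \<noteq> 0"
      then show ?thesis using spec[OF a, of m] by (simp add: le_max_iff_disj)
    next
      assume "g m \<noteq> 0"
      then show ?thesis using spec[OF b, of m] by (simp add: le_max_iff_disj)
    qed
    show "Poly_Mapping.keys m \<subseteq> {1..}"
      using or[OF m] spec[OF conjunct1[OF f], of m] spec[OF conjunct1[OF g], of m] by (elim disjE) simp_all
  next
    fix m m' :: monomial
    assume m: "Poly_Mapping.keys m \<subseteq> {1..}" "Poly_Mapping.keys m' \<subseteq> {1..}"
      "map (Poly_Mapping.lookup m) (sorted_list_of_set (Poly_Mapping.keys m)) =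
       map (Poly_Mapping.lookup m') (sorted_list_of_set (Poly_Mapping.keys m'))"
    show "f m + g m = f m' + g m'"
      using conjunct2[OF conjunct2[OF f], rule_format, OF m] conjunct2[OF conjunct2[OF g], rule_format, OF m]
      by (rule arg_cong2)
  qed
qed

text \<open>Additivity of \<open>h\<close> is known only inside the carrier, so the induction also
  carries membership of the partial sums. The value at zero follows from being equal to its own
  double.\<close>

lemma QSym_hom_sum:
  assumes h: "h \<in> hom QSym QSym" and fin: "finite I" and f: "\<And>i. i \<in> I \<Longrightarrow> f i \<in> carrier QSym"
  shows "h (\<lambda>m. \<Sum>i\<in>I. f i m) = (\<lambda>m. \<Sum>i\<in>I. h (f i) m)"
proof -
  have add: "h (\<lambda>m. a m + b m) = (\<lambda>m. h a m + h b m)" if "a \<in> carrier QSym" "b \<in> carrier QSym" for a b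
    using hom_mult[OF h that] by (simp add: QSym_def)
  have "h (\<lambda>m. 0) m = h (\<lambda>m. 0) m + h (\<lambda>m. 0) m" for m
    using add[OF zero_in_QSym zero_in_QSym] by (simp add: fun_eq_iff)
  then have zero: "h (\<lambda>m. 0) = (\<lambda>m. 0)" by (simp add: fun_eq_iff)
  have "h (\<lambda>m. \<Sum>i\<in>I. f i m) = (\<lambda>m. \<Sum>i\<in>I. h (f i) m) \<and> (\<lambda>m. \<Sum>i\<in>I. f i m) \<in> carrier QSym"
    using fin f
  proof (induction I)
    case empty
    then show ?case by (simp add: zero zero_in_QSym)
  next
    case (insert i I)
    then show ?case
      using add[of "f i" "\<lambda>m. \<Sum>i\<in>I. f i m"] add_in_QSym[of "f i" "\<lambda>m. \<Sum>i\<in>I. f i m"] by simp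
  qed
  then show ?thesis by blast
qed

lemma rho_fund_series:
  assumes "qsym_rho \<rho>" "S \<subseteq> {1..<n}"
  shows "\<rho> (fund_series n S) = fund_series n ((\<lambda>s. n - s) ` S)"
proof -
  obtain \<alpha> where \<alpha>: "composition n \<alpha>" "comp_set \<alpha> = S"
    using ex_composition[OF assms(2)] by blast
  moreover have "composition n (rev \<alpha>)" using \<alpha> by (simp add: composition_def)
  ultimately show ?thesis
    using assms(1) fundamental_eq[of n \<alpha>] fundamental_eq[of n "rev \<alpha>"] comp_set_rev[of n \<alpha>]
    unfolding qsym_rho_def by metis
qed

lemma psi_fund_series:
  assumes "qsym_psi \<psi>" "S \<subseteq> {1..<n}"
  shows "\<psi> (fund_series n S) = fund_series n ({1..<n} - S)"
proof -
  obtain \<alpha> where \<alpha>: "composition n \<alpha>" "comp_set \<alpha> = S"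
    using ex_composition[OF assms(2)] by blast
  then show ?thesis
    using assms(1) fundamental_eq[of n \<alpha>] fundamental_eq[of n "comp_complement \<alpha>"] comp_complement[of n \<alpha>]
    unfolding qsym_psi_def by metis
qed

text \<open>Isomorphic modules have the same representatives in the universe. This lets the dual,
  whose elements are functionals, be replaced by a poset module.\<close>

lemma G0_sum_class_cong:
  assumes iso: "rmod_iso (hecke n) M N"
  shows "G0_sum_class n M = G0_sum_class n N"
proof -
  have "{L \<in> fd_modules n. rmod_iso (hecke n) L M} = {L \<in> fd_modules n. rmod_iso (hecke n) L N}"
    using rmod_iso_trans[OF _ iso] rmod_iso_trans[OF _ rmod_iso_sym[OF iso]] by blast
  then show ?thesis by (simp only: G0_sum_class_def G0_class_def)
qed

section \<open>Descent sets under the longest permutation\<close>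

lemma bij_betw_flip_conj:
  assumes "P \<subseteq> {1..n} \<times> {1..n}"
  shows "bij_betw (\<lambda>\<sigma>. flip n \<circ> \<sigma> \<circ> flip n) (Sigma_R n P) (Sigma_R n ((poset_bar n P)\<inverse>))"
proof -
  have inv: "flip n \<circ> (flip n \<circ> \<sigma> \<circ> flip n) \<circ> flip n = \<sigma>" for \<sigma>
    by (auto simp: fun_eq_iff)
  show ?thesis
    by (rule bij_betw_byWitness[where f' = "\<lambda>\<sigma>. flip n \<circ> \<sigma> \<circ> flip n"])
      (use inv flip_conj_in_Sigma_R[OF assms] in \<open>auto simp: flip_conj_in_Sigma_R[OF assms, symmetric] inv\<close>)
qed

text \<open>Reversing positions sends i, i+1 to n+1-i, n-i and so exchanges ascents with descents
  there; reversing values exchanges them once more.\<close>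

lemma des_right_flip_conj:
  assumes \<sigma>: "\<sigma> permutes {1..n}"
  shows "des_right n (flip n \<circ> \<sigma> \<circ> flip n) = (\<lambda>s. n - s) ` des_right n \<sigma>"
proof -
  have iff: "i \<in> des_right n (flip n \<circ> \<sigma> \<circ> flip n) \<longleftrightarrow> n - i \<in> des_right n \<sigma>" if i: "i \<in> {1..<n}" for i
  proof -
    have "n - i \<in> {1..<n}" using i by auto
    moreover have "flip n (Suc i) = n - i" "flip n i = Suc (n - i)"
      using i by (auto simp: flip_def)
    moreover have "flip n (\<sigma> (n - i)) < flip n (\<sigma> (Suc (n - i))) \<longleftrightarrow> \<sigma> (Suc (n - i)) < \<sigma> (n - i)"
      using i permutes_in_image[OF \<sigma>, of "n - i"] permutes_in_image[OF \<sigma>, of "Suc (n - i)"] by (intro flip_less_iff) auto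
    ultimately show ?thesis
      using i by (simp add: des_right_iff[OF \<sigma>] des_right_iff[OF flip_conj_permutes[OF \<sigma>]] del: atLeastLessThan_iff)
  qed
  have sub: "des_right n \<tau> \<subseteq> {1..<n}" for \<tau> by (auto simp: des_right_def)
  show ?thesis
  proof (intro equalityI subsetI)
    fix i assume i: "i \<in> des_right n (flip n \<circ> \<sigma> \<circ> flip n)"
    then have "i \<in> {1..<n}" using sub by blast
    then show "i \<in> (\<lambda>s. n - s) ` des_right n \<sigma>"
      using iff i by (intro image_eqI[of _ _ "n - i"]) auto
  next
    fix i assume "i \<in> (\<lambda>s. n - s) ` des_right n \<sigma>"
    then obtain s where s: "s \<in> des_right n \<sigma>" "i = n - s" by blast
    then have "s \<in> {1..<n}" using sub by blast
    then have "i \<in> {1..<n}" "n - i = s" using s by auto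
    then show "i \<in> des_right n (flip n \<circ> \<sigma> \<circ> flip n)" using iff s by metis
  qed
qed

lemma bij_betw_flip_comp:
  assumes "P \<subseteq> {1..n} \<times> {1..n}"
  shows "bij_betw (\<lambda>\<sigma>. flip n \<circ> \<sigma>) (Sigma_R n P) (Sigma_R n (poset_bar n P))"
  by (rule bij_betw_byWitness[where f' = "\<lambda>\<sigma>. flip n \<circ> \<sigma>"])
    (use flip_comp_in_Sigma_R[OF assms] in \<open>auto simp: flip_comp_in_Sigma_R[OF assms, symmetric]\<close>)

lemma des_right_flip_comp:
  assumes \<sigma>: "\<sigma> permutes {1..n}"
  shows "des_right n (flip n \<circ> \<sigma>) = {1..<n} - des_right n \<sigma>"
proof -
  have p: "flip n \<circ> \<sigma> permutes {1..n}" by (rule permutes_compose[OF \<sigma> flip_permutes])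
  have "flip n (\<sigma> (Suc i)) < flip n (\<sigma> i) \<longleftrightarrow> \<not> \<sigma> (Suc i) < \<sigma> i" if "i \<in> {1..<n}" for i
    using that permutes_in_image[OF \<sigma>, of i] permutes_in_image[OF \<sigma>, of "Suc i"] permutes_Suc_neq[OF \<sigma>, of i]
    by (subst flip_less_iff) auto
  then show ?thesis
    by (auto simp: des_right_iff[OF \<sigma>] des_right_iff[OF p])
qed

theorem theorem3p6:
  fixes n :: nat and P :: "nat rel"
  assumes "partial_order_on {1..n} P"
  shows "(rmod_iso (hecke n) (twist (hecke_phi n) (poset_module n P))
            (poset_module n ((poset_bar n P)\<inverse>)) \<and>
          rmod_iso (hecke n) (twist (hecke_theta n) (poset_module n P))
            (bold_poset_module n P) \<and>
          rmod_iso (hecke n) (dual_twist n (hecke_chi n) (poset_module n P))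
            (bold_poset_module n (poset_bar n P))) \<and>
         (\<forall>ch \<rho> \<psi>. qsym_characteristic ch \<longrightarrow> qsym_rho \<rho> \<longrightarrow> qsym_psi \<psi> \<longrightarrow>
            ch (G0_sum_class n (twist (hecke_phi n) (poset_module n P))) = \<rho> (K_series n P) \<and>
            ch (G0_sum_class n (twist (hecke_theta n) (poset_module n P))) = \<psi> (K_series n P) \<and>
            ch (G0_sum_class n (dual_twist n (hecke_chi n) (poset_module n P))) = K_series n P)"
proof -
  have P: "P \<subseteq> {1..n} \<times> {1..n}"
    using assms by (rule partial_order_onD)
  note iso = phi_poset_module_iso[OF P] theta_poset_module_iso[of n P] chi_poset_module_iso[OF P]
  note K = K_series_expansion[OF P]
  have des: "des_right n \<sigma> \<subseteq> {1..<n}" for \<sigma>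
    by (auto simp: des_right_def)
  have "ch (G0_sum_class n (twist (hecke_phi n) (poset_module n P))) = \<rho> (K_series n P) \<and>
      ch (G0_sum_class n (twist (hecke_theta n) (poset_module n P))) = \<psi> (K_series n P) \<and>
      ch (G0_sum_class n (dual_twist n (hecke_chi n) (poset_module n P))) = K_series n P"
    if ch: "qsym_characteristic ch" and \<rho>: "qsym_rho \<rho>" and \<psi>: "qsym_psi \<psi>" for ch \<rho> \<psi>
  proof (intro conjI)
    have mem: "fund_series n (des_right n \<sigma>) \<in> carrier QSym" for \<sigma>
      by (rule fund_series_in_QSym[OF ch des])
    have "\<rho> \<in> hom QSym QSym" "\<psi> \<in> hom QSym QSym"
      using \<rho> \<psi> by (simp_all add: qsym_rho_def qsym_psi_def)
    \<comment> \<open>Two facts at once: the first for \<rho>, the second for \<psi>.\<close>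
    note hom_K = this[THEN QSym_hom_sum[OF _ finite_Sigma_R mem]]
    have "\<rho> (K_series n P) = (\<lambda>m. \<Sum>\<sigma>\<in>Sigma_R n P. fund_series n ((\<lambda>s. n - s) ` des_right n \<sigma>) m)"
      unfolding K hom_K(1) rho_fund_series[OF \<rho> des] ..
    also have "\<dots> = (\<lambda>m. \<Sum>\<sigma>\<in>Sigma_R n P. fund_series n (des_right n (flip n \<circ> \<sigma> \<circ> flip n)) m)"
      by (intro ext sum.cong refl) (simp add: des_right_flip_conj[OF Sigma_R_permutes])
    also have "\<dots> = (\<lambda>m. \<Sum>\<sigma>\<in>Sigma_R n ((poset_bar n P)\<inverse>). fund_series n (des_right n \<sigma>) m)"
      using sum.reindex_bij_betw[OF bij_betw_flip_conj[OF P], of "\<lambda>\<sigma>. fund_series n (des_right n \<sigma>) _"] by auto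
    finally show "ch (G0_sum_class n (twist (hecke_phi n) (poset_module n P))) = \<rho> (K_series n P)"
      unfolding G0_sum_class_cong[OF iso(1)] ch_poset_module[OF ch] by simp
    have "\<psi> (K_series n P) = (\<lambda>m. \<Sum>\<sigma>\<in>Sigma_R n P. fund_series n ({1..<n} - des_right n \<sigma>) m)"
      unfolding K hom_K(2) psi_fund_series[OF \<psi> des] ..
    then show "ch (G0_sum_class n (twist (hecke_theta n) (poset_module n P))) = \<psi> (K_series n P)"
      unfolding G0_sum_class_cong[OF iso(2)] ch_bold_poset_module[OF ch] by simp
    \<comment> \<open>Two complements meet and cancel here: the bold module contributes one, left
      multiplication by the longest permutation the other.\<close>
    have "{1..<n} - ({1..<n} - des_right n \<sigma>) = des_right n \<sigma>" for \<sigma>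
      using des[of \<sigma>] by blast
    then have "K_series n P = (\<lambda>m. \<Sum>\<sigma>\<in>Sigma_R n P. fund_series n ({1..<n} - des_right n (flip n \<circ> \<sigma>)) m)"
      unfolding K by (intro ext sum.cong refl) (simp add: des_right_flip_comp[OF Sigma_R_permutes])
    also have "\<dots> = (\<lambda>m. \<Sum>\<sigma>\<in>Sigma_R n (poset_bar n P). fund_series n ({1..<n} - des_right n \<sigma>) m)"
      using sum.reindex_bij_betw[OF bij_betw_flip_comp[OF P], of "\<lambda>\<sigma>. fund_series n ({1..<n} - des_right n \<sigma>) _"] by auto
    finally show "ch (G0_sum_class n (dual_twist n (hecke_chi n) (poset_module n P))) = K_series n P"
      unfolding G0_sum_class_cong[OF iso(3)] ch_bold_poset_module[OF ch] by simp
  qed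
  with iso show ?thesis by blast
qed

end
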